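(* $f_{\mathcal{DG}}(n) = 2^{2^{\Theta(n)}}$; that is, there exist constants $c_1, c_2 > 0$ and $n_0$ such that for all $n \geq n_0$, \[ 2^{2^{c_1 n}} \leq f_{\mathcal{DG}}(n) \leq 2^{2^{c_2 n}}. \]
   Context: The intersection graph of a tuple of sets $(A(v) : v \in V)$ is the graph with vertex set $V$ in which distinct $u,v$ are adjacent iff $A(u)\cap A(v) \neq \emptyset$; the tuple is then said to realize the graph. A disk graph is a graph that is (isomorphic to) the intersection graph of finitely many open disks (of positive radius) in $\mathbb{R}^2$. Let $\mathcal{DG}(n)$ be the set of disk graphs with $n$ vertices. An integer $\mathcal{DG}$-realization of a disk graph $G$ is a realization of $G$ by open disks whose centers lie in $\mathbb{Z}^2$ and whose radii are (positive) integers; every disk graph has one. For a finite collection $\mathcal{A}$ of bounded sets in the plane let $k(\mathcal{A}) := \min\{k \in \mathbb{N} : A \subseteq [-k,k]^2 \text{ for all } A \in \mathcal{A}\}$. Define $f_{\mathcal{DG}}(G) := \min k(\mathcal{A})$, the minimum being over all integer $\mathcal{DG}$-realizations $\mathcal{A}$ of $G$, and $f_{\mathcal{DG}}(n) := \max_{G \in \mathcal{DG}(n)} f_{\mathcal{DG}}(G)$. *)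

theory Defs
  imports "HOL-Analysis.Analysis" "Graph_Theory.Pair_Digraph"
begin

text \<open>
  A finite simple graph is a \<^locale>\<open>pair_graph\<close>, that is a finite, loop-free, symmetric digraph:
  an undirected edge \<open>uv\<close> is the pair of arcs \<open>(u, v)\<close> and \<open>(v, u)\<close>.
\<close>

definition intersection_graph :: "'v set \<Rightarrow> ('v \<Rightarrow> 'x set) \<Rightarrow> 'v pair_pre_digraph" where
  "intersection_graph V A =
     \<lparr>pverts = V, parcs = {(u, v). u \<in> V \<and> v \<in> V \<and> u \<noteq> v \<and> A u \<inter> A v \<noteq> {}}\<rparr>"

text \<open>
  Realizations are indexed by the vertices of the graph itself. A graph isomorphic to an
  intersection graph is realized, in this sense, by the relabelled tuple; see
  \<open>realizes_relabel\<close> below.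
\<close>

definition realizes :: "('v \<Rightarrow> 'x set) \<Rightarrow> 'v pair_pre_digraph \<Rightarrow> bool" where
  "realizes A G \<longleftrightarrow> G = intersection_graph (pverts G) A"

definition open_disk :: "(real ^ 2) set \<Rightarrow> bool" where
  "open_disk D \<longleftrightarrow> (\<exists>c r. r > 0 \<and> D = ball c r)"

definition integer_open_disk :: "(real ^ 2) set \<Rightarrow> bool" where
  "integer_open_disk D \<longleftrightarrow> (\<exists>c r. (\<forall>i. c $ i \<in> \<int>) \<and> r \<in> \<int> \<and> r > 0 \<and> D = ball c r)"

definition disk_graph :: "'v pair_pre_digraph \<Rightarrow> bool" where
  "disk_graph G \<longleftrightarrow>
     pair_graph G \<and> (\<exists>A. realizes A G \<and> (\<forall>v \<in> pverts G. open_disk (A v)))"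

definition integer_DG_realization :: "('v \<Rightarrow> (real ^ 2) set) \<Rightarrow> 'v pair_pre_digraph \<Rightarrow> bool" where
  "integer_DG_realization A G \<longleftrightarrow> realizes A G \<and> (\<forall>v \<in> pverts G. integer_open_disk (A v))"

text \<open>The quantity \<open>k(\<A>)\<close>, for a finite collection \<open>\<A>\<close> of bounded sets.\<close>

definition box_size :: "(real ^ 2) set set \<Rightarrow> nat" where
  "box_size \<A> = (LEAST k. \<forall>A \<in> \<A>. A \<subseteq> cbox (\<chi> i. - real k) (\<chi> i. real k))"

definition f_DG_graph :: "'v pair_pre_digraph \<Rightarrow> nat" where
  "f_DG_graph G = (LEAST m. \<exists>A. integer_DG_realization A G \<and> m = box_size (A ` pverts G))"

text \<open>
  Vertices are taken to be natural numbers, so that every finite graph occurs up to isomorphism.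
\<close>

definition DG :: "nat \<Rightarrow> nat pair_pre_digraph set" where
  "DG n = {G. disk_graph G \<and> card (pverts G) = n}"

definition f_DG :: "nat \<Rightarrow> nat" where
  "f_DG n = Max (f_DG_graph ` DG n)"

text \<open>
  The set \<^term>\<open>DG n\<close> is infinite, but \<^const>\<open>f_DG_graph\<close> is invariant under isomorphism, so that
  the maximum defining \<^const>\<open>f_DG\<close> is over a finite set of values.
\<close>

lemma realizes_relabel:
  assumes bij: "bij_betw p (pverts H) (pverts G)"
    and arcs: "parcs H = {(u, v). u \<in> pverts H \<and> v \<in> pverts H \<and> (p u, p v) \<in> parcs G}"
    and real: "realizes A G"
  shows "realizes (A \<circ> p) H"
proof -
  have G: "parcs G = {(u, v). u \<in> pverts G \<and> v \<in> pverts G \<and> u \<noteq> v \<and> A u \<inter> A v \<noteq> {}}"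
    by (subst real[unfolded realizes_def intersection_graph_def]) simp
  have "parcs H = {(u, v). u \<in> pverts H \<and> v \<in> pverts H \<and> u \<noteq> v \<and> (A \<circ> p) u \<inter> (A \<circ> p) v \<noteq> {}}"
    unfolding arcs G using bij by (auto simp: bij_betw_def inj_on_def)
  then show ?thesis
    unfolding realizes_def intersection_graph_def by (simp add: pair_pre_digraph.equality)
qed

lemma f_DG_graph_relabel:
  assumes bij: "bij_betw p (pverts H) (pverts G)"
    and arcs: "parcs H = {(u, v). u \<in> pverts H \<and> v \<in> pverts H \<and> (p u, p v) \<in> parcs G}"
    and wf: "parcs G \<subseteq> pverts G \<times> pverts G"
  shows "f_DG_graph H = f_DG_graph G"
proof -
  define q where "q = inv_into (pverts H) p"
  have q: "bij_betw q (pverts G) (pverts H)"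
    unfolding q_def by (rule bij_betw_inv_into[OF bij])
  have pq: "p (q v) = v" if "v \<in> pverts G" for v
    using that bij unfolding q_def by (simp add: bij_betw_inv_into_right)
  have arcs': "parcs G = {(u, v). u \<in> pverts G \<and> v \<in> pverts G \<and> (q u, q v) \<in> parcs H}"
    using wf q pq unfolding arcs by (auto simp: bij_betw_def)
  have 1: "integer_DG_realization (A \<circ> p) H \<and> (A \<circ> p) ` pverts H = A ` pverts G"
    if "integer_DG_realization A G" for A
  proof -
    have im: "p ` pverts H = pverts G"
      by (rule bij_betw_imp_surj_on[OF bij])
    then have "(A \<circ> p) ` pverts H = A ` pverts G"
      by (metis image_comp)
    with im show ?thesis
      using that realizes_relabel[OF bij arcs, of A]
      unfolding integer_DG_realization_def by auto
  qed
  have 2: "integer_DG_realization (A \<circ> q) G \<and> (A \<circ> q) ` pverts G = A ` pverts H"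
    if "integer_DG_realization A H" for A
  proof -
    have im: "q ` pverts G = pverts H"
      by (rule bij_betw_imp_surj_on[OF q])
    then have "(A \<circ> q) ` pverts G = A ` pverts H"
      by (metis image_comp)
    with im show ?thesis
      using that realizes_relabel[OF q arcs', of A]
      unfolding integer_DG_realization_def by auto
  qed
  have "(\<exists>A. integer_DG_realization A H \<and> m = box_size (A ` pverts H)) \<longleftrightarrow>
        (\<exists>A. integer_DG_realization A G \<and> m = box_size (A ` pverts G))" for m
    by (metis 1 2)
  then show ?thesis
    unfolding f_DG_graph_def by simp
qed

lemma finite_f_DG_graph_values: "finite (f_DG_graph ` DG n)"
proof -
  define S where "S = (\<lambda>E. \<lparr>pverts = {..<n}, parcs = E\<rparr>) ` Pow ({..<n} \<times> {..<n})"
  have "f_DG_graph G \<in> f_DG_graph ` S" if "G \<in> DG n" for G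
  proof -
    from that have g: "pair_graph G" and c: "card (pverts G) = n"
      by (auto simp: DG_def disk_graph_def)
    interpret pair_graph G by (rule g)
    obtain p where p: "bij_betw p {..<n} (pverts G)"
      using ex_bij_betw_nat_finite[OF pair_finite_verts] c by (auto simp: lessThan_atLeast0)
    define H where
      "H = \<lparr>pverts = {..<n}, parcs = {(u, v). u \<in> {..<n} \<and> v \<in> {..<n} \<and> (p u, p v) \<in> parcs G}\<rparr>"
    have "H \<in> S" unfolding S_def H_def by auto
    moreover have "f_DG_graph H = f_DG_graph G"
      by (rule f_DG_graph_relabel[of p]) (use p in \<open>auto simp: H_def in_arcsD1 in_arcsD2\<close>)
    ultimately show ?thesis by (metis imageI)
  qed
  then have "f_DG_graph ` DG n \<subseteq> f_DG_graph ` S" by auto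
  moreover have "finite S" unfolding S_def by simp
  ultimately show ?thesis by (meson finite_imageI finite_subset)
qed

end

theory Submission
  imports Defs
begin

text \<open>
  Upper bound. Realizability of a disk graph is the solvability of quadratic inequalities
  \<open>g i x \<ge> 1\<close> in \<open>3 n\<close> real variables. A minimizer of
  \<open>t * \<Sum>x\<^sub>j\<^sup>2 + \<Sum>(max 0 (1 - g i x))\<^sup>2 - \<Sum>t ^ ((D+1) ^ (j+1)) * x\<^sub>j\<close> satisfies
  polynomial equations of degree three, whatever the number of constraints, with values that are
  powers of \<open>t\<close> on the other side. A pigeonhole argument in the manner of Perron and Siegel gives
  an integer relation of degree \<open>2^O(n)\<close> and coefficients \<open>2^2^O(n)\<close> between these values and a
  coordinate \<open>x\<^sub>j\<close>. The exponents of \<open>t\<close> are those of a Kronecker substitution, so for small \<open>t\<close> the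
  terms of lowest order form a nonzero integer polynomial that bounds \<open>\<bar>x\<^sub>j\<bar>\<close>; scaling and rounding
  gives an integer realization.

  Lower bound. In the coordinates \<open>(1, r, c\<^sub>1, c\<^sub>2, r\<^sup>2 - \<bar>c\<bar>\<^sup>2)\<close> of a disk, the condition of meeting a
  given disk is the sign of a linear functional. Each line of a planar configuration is encoded by
  four disks, and eliminating two auxiliary disks from the four functionals leaves one functional
  whose signs are those of the line. Pairs of nearby lines yield in the same way functionals
  that vanish exactly at a vertex of a reference triangle. With a bounded number of lines and
  points per step, the three pencils of lines at the vertices force a cross ratio to be squared. In
  an integer realization all these functionals have bounded integer values.
\<close>

section \<open>Integer polynomials and the pigeonhole principle\<close>

text \<open>Upper bound: the obstacle is the number of inequalities, of order \<open>n * n\<close>.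
  One slack variable for each would put \<open>n * n\<close> into the exponent of the degree. The
  squared penalty leaves \<open>k + 2\<close> polynomials (a coordinate, \<open>t\<close> and
  \<open>k\<close> partial derivatives) in \<open>k + 1\<close> unknowns, where
  \<open>k = 3 * n\<close>, and the inequalities affect only the coefficients. Without the linear
  terms all derivatives would be 0 at the minimizer and the integer relation might become void
  there; distinct powers of \<open>t\<close> as their values exclude this. One fixed small
  \<open>t\<close> suffices, no limit is taken.

  Lower bound: a graph fixes only signs, so that no incidence can be prescribed and the arithmetic
  has to run on strict inequalities. Those between \<open>x\<close>, \<open>y\<close> and
  \<open>z\<close> multiply the ratios to \<open>x 0\<close> and \<open>y 0\<close>, but from the
  initial ratio 1 they give growth of no definite size. The line \<open>LS\<close> and the points
  \<open>D1\<close>, \<open>D2\<close> supply a definite factor 2.\<close>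

definition expo :: "nat \<Rightarrow> nat \<Rightarrow> (nat \<Rightarrow> nat) set" where
  "expo N T = {e. (\<forall>i\<ge>N. e i = 0) \<and> (\<Sum>i<N. e i) \<le> T}"

definition monom_val :: "nat \<Rightarrow> (nat \<Rightarrow> nat) \<Rightarrow> (nat \<Rightarrow> real) \<Rightarrow> real" where
  "monom_val N e x = (\<Prod>i<N. x i ^ e i)"

text \<open>\<open>B\<close> bounds the sum of the absolute values of the coefficients. This norm is
  submultiplicative, so bounds multiply in products without any count of terms.\<close>

definition intpoly :: "nat \<Rightarrow> nat \<Rightarrow> nat \<Rightarrow> ((nat \<Rightarrow> real) \<Rightarrow> real) \<Rightarrow> bool" where
  "intpoly N T B f \<longleftrightarrow>
     (\<exists>c :: (nat \<Rightarrow> nat) \<Rightarrow> int. (\<Sum>e\<in>expo N T. \<bar>c e\<bar>) \<le> int B \<and>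
        (\<forall>x. f x = (\<Sum>e\<in>expo N T. of_int (c e) * monom_val N e x)))"

text \<open>Stars and bars: a last entry takes up the slack \<open>T - (\<Sum>i<N. e i)\<close> and
  turns the inequality into an equation.\<close>

lemma bij_expo:
  "bij_betw (\<lambda>l i. if i < N then l ! i else 0) {l. length l = Suc N \<and> sum_list l = T} (expo N T)"
proof (rule bij_betwI[where g = "\<lambda>e. map e [0..<N] @ [T - (\<Sum>i<N. e i)]"])
  have s: "sum_list l = (\<Sum>i<N. l ! i) + l ! N" if "length l = Suc N" for l :: "nat list"
    using that by (simp add: sum_list_sum_nth lessThan_atLeast0 del: sum.op_ivl_Suc) (simp add: sum.atLeast0_lessThan_Suc)
  show "(\<lambda>l i. if i < N then l ! i else 0) \<in> {l. length l = Suc N \<and> sum_list l = T} \<rightarrow> expo N T"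
    using s by (auto simp: expo_def)
  show "(\<lambda>e. map e [0..<N] @ [T - (\<Sum>i<N. e i)]) \<in> expo N T \<rightarrow> {l. length l = Suc N \<and> sum_list l = T}"
    by (auto simp: expo_def interv_sum_list_conv_sum_set_nat lessThan_atLeast0)
  show "map (\<lambda>i. if i < N then l ! i else 0) [0..<N] @ [T - (\<Sum>i<N. if i < N then l ! i else 0)] = l"
    if "l \<in> {l. length l = Suc N \<and> sum_list l = T}" for l
  proof (rule nth_equalityI)
    show "length (map (\<lambda>i. if i < N then l ! i else 0) [0..<N] @ [T - (\<Sum>i<N. if i < N then l ! i else 0)]) = length l"
      using that by simp
    fix j assume "j < length (map (\<lambda>i. if i < N then l ! i else 0) [0..<N] @ [T - (\<Sum>i<N. if i < N then l ! i else 0)])"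
    then have "j < N \<or> j = N" by auto
    then show "(map (\<lambda>i. if i < N then l ! i else 0) [0..<N] @ [T - (\<Sum>i<N. if i < N then l ! i else 0)]) ! j = l ! j"
      using that s[of l] by (auto simp: nth_append)
  qed
  show "(\<lambda>i. if i < N then (map e [0..<N] @ [T - (\<Sum>i<N. e i)]) ! i else 0) = e" if "e \<in> expo N T" for e
    using that by (auto simp: expo_def nth_append fun_eq_iff)
qed

lemma card_expo: "card (expo N T) = (T + N) choose N"
proof -
  have "card (expo N T) = card {l :: nat list. length l = Suc N \<and> sum_list l = T}"
    using bij_betw_same_card[OF bij_expo] by simp
  also have "\<dots> = (T + Suc N - 1) choose T"
    by (rule card_length_sum_list)
  also have "\<dots> = (T + N) choose N"
    using binomial_symmetric[of N "T + N"] by simp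
  finally show ?thesis .
qed

lemma finite_expo [simp]: "finite (expo N T)"
  using card_expo[of N T] by (metis card_ge_0_finite zero_less_binomial le_add2)

lemma expo_mono: "T \<le> T' \<Longrightarrow> expo N T \<subseteq> expo N T'"
  by (auto simp: expo_def)

lemma expo_le: assumes "e \<in> expo N T" shows "e i \<le> T"
proof (cases "i < N")
  case True
  then have "e i \<le> (\<Sum>i<N. e i)" by (intro member_le_sum) auto
  then show ?thesis using assms by (simp add: expo_def)
qed (use assms in \<open>auto simp: expo_def\<close>)

section \<open>Arithmetic of integer polynomials with bounded degree and coefficients\<close>

lemma intpoly_mono:
  assumes "intpoly N T B f" "T \<le> T'" "B \<le> B'"
  shows "intpoly N T' B' f"
proof -
  obtain c where c: "(\<Sum>e\<in>expo N T. \<bar>c e\<bar>) \<le> int B"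
    "\<And>x. f x = (\<Sum>e\<in>expo N T. of_int (c e) * monom_val N e x)"
    using assms(1) by (auto simp: intpoly_def)
  let ?c = "\<lambda>e. if e \<in> expo N T then c e else 0"
  have "(\<Sum>e\<in>expo N T'. \<bar>?c e\<bar>) = (\<Sum>e\<in>expo N T. \<bar>c e\<bar>)"
    using expo_mono[OF assms(2)] by (intro sum.mono_neutral_cong_right) auto
  moreover have "(\<Sum>e\<in>expo N T'. of_int (?c e) * monom_val N e x) = f x" for x
    unfolding c(2) using expo_mono[OF assms(2)] by (intro sum.mono_neutral_cong_right) auto
  ultimately show ?thesis
    unfolding intpoly_def using c(1) assms(3) by (intro exI[of _ ?c]) auto
qed

lemma intpoly_monom:
  assumes "e \<in> expo N T" "\<bar>m\<bar> \<le> int B"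
  shows "intpoly N T B (\<lambda>x. of_int m * monom_val N e x)"
proof -
  let ?c = "\<lambda>e'. if e' = e then m else 0"
  have "(\<Sum>e'\<in>expo N T. \<bar>?c e'\<bar>) = \<bar>m\<bar>"
    using assms(1) by (subst sum.remove[of _ e]) auto
  moreover have "(\<Sum>e'\<in>expo N T. of_int (?c e') * monom_val N e' x) = of_int m * monom_val N e x" for x
    using assms(1) by (subst sum.remove[of _ e]) auto
  ultimately show ?thesis
    unfolding intpoly_def using assms(2) by (intro exI[of _ ?c]) auto
qed

lemma intpoly_const: "\<bar>m\<bar> \<le> int B \<Longrightarrow> intpoly N T B (\<lambda>x. of_int m)"
  using intpoly_monom[of "\<lambda>_. 0" N T m B] by (simp add: expo_def monom_val_def)

lemma intpoly_var:
  assumes "i < N" shows "intpoly N 1 1 (\<lambda>x. x i)"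
proof -
  let ?e = "\<lambda>j. if j = i then 1 else 0 :: nat"
  have "?e \<in> expo N 1" using assms by (auto simp: expo_def)
  moreover have "monom_val N ?e x = x i" for x
    unfolding monom_val_def using assms by (subst prod.remove[of _ i]) auto
  ultimately show ?thesis
    using intpoly_monom[of ?e N 1 1 1] by simp
qed

lemma intpoly_add:
  assumes "intpoly N T B f" "intpoly N T B' g"
  shows "intpoly N T (B + B') (\<lambda>x. f x + g x)"
proof -
  obtain c where c: "(\<Sum>e\<in>expo N T. \<bar>c e\<bar>) \<le> int B"
    "\<And>x. f x = (\<Sum>e\<in>expo N T. of_int (c e) * monom_val N e x)"
    using assms(1) by (auto simp: intpoly_def)
  obtain d where d: "(\<Sum>e\<in>expo N T. \<bar>d e\<bar>) \<le> int B'"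
    "\<And>x. g x = (\<Sum>e\<in>expo N T. of_int (d e) * monom_val N e x)"
    using assms(2) by (auto simp: intpoly_def)
  have "(\<Sum>e\<in>expo N T. \<bar>c e + d e\<bar>) \<le> (\<Sum>e\<in>expo N T. \<bar>c e\<bar> + \<bar>d e\<bar>)"
    by (intro sum_mono) auto
  then show ?thesis
    unfolding intpoly_def using c d
    by (intro exI[of _ "\<lambda>e. c e + d e"]) (auto simp: sum.distrib algebra_simps)
qed

lemma intpoly_mult:
  assumes "intpoly N T B f" "intpoly N T' B' g"
  shows "intpoly N (T + T') (B * B') (\<lambda>x. f x * g x)"
proof -
  obtain c where c: "(\<Sum>e\<in>expo N T. \<bar>c e\<bar>) \<le> int B"
    "\<And>x. f x = (\<Sum>e\<in>expo N T. of_int (c e) * monom_val N e x)"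
    using assms(1) by (auto simp: intpoly_def)
  obtain d where d: "(\<Sum>e\<in>expo N T'. \<bar>d e\<bar>) \<le> int B'"
    "\<And>x. g x = (\<Sum>e\<in>expo N T'. of_int (d e) * monom_val N e x)"
    using assms(2) by (auto simp: intpoly_def)
  let ?P = "expo N T \<times> expo N T'"
  let ?h = "\<lambda>(e, e') i. e i + (e' i :: nat)"
  let ?F = "\<lambda>e. {p \<in> ?P. ?h p = e}"
  let ?k = "\<lambda>e. \<Sum>p\<in>?F e. c (fst p) * d (snd p)"
  have h: "?h ` ?P \<subseteq> expo N (T + T')"
    by (auto simp: expo_def sum.distrib)
  have fP: "finite ?P" by simp
  have "(\<Sum>e\<in>expo N (T + T'). \<bar>?k e\<bar>) \<le> (\<Sum>e\<in>expo N (T + T'). \<Sum>p\<in>?F e. \<bar>c (fst p)\<bar> * \<bar>d (snd p)\<bar>)"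
    by (intro sum_mono order.trans[OF sum_abs]) (simp add: abs_mult)
  also have "\<dots> = (\<Sum>p\<in>?P. \<bar>c (fst p)\<bar> * \<bar>d (snd p)\<bar>)"
    by (rule sum.group[OF fP finite_expo h])
  also have "\<dots> = (\<Sum>e\<in>expo N T. \<bar>c e\<bar>) * (\<Sum>e\<in>expo N T'. \<bar>d e\<bar>)"
    by (simp add: sum_product sum.cartesian_product split_def)
  also have "\<dots> \<le> int B * int B'"
    using c(1) d(1) by (intro mult_mono) (auto intro: sum_nonneg)
  finally have 1: "(\<Sum>e\<in>expo N (T + T'). \<bar>?k e\<bar>) \<le> int (B * B')" by simp
  have 2: "f x * g x = (\<Sum>e\<in>expo N (T + T'). of_int (?k e) * monom_val N e x)" for x
  proof -
    have "f x * g x = (\<Sum>p\<in>?P. (of_int (c (fst p)) * monom_val N (fst p) x) * (of_int (d (snd p)) * monom_val N (snd p) x))"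
      unfolding c(2) d(2) by (simp add: sum_product sum.cartesian_product split_def)
    also have "\<dots> = (\<Sum>p\<in>?P. of_int (c (fst p) * d (snd p)) * monom_val N (?h p) x)"
      by (intro sum.cong) (auto simp: monom_val_def power_add prod.distrib)
    also have "\<dots> = (\<Sum>e\<in>expo N (T + T'). \<Sum>p\<in>?F e. of_int (c (fst p) * d (snd p)) * monom_val N (?h p) x)"
      by (rule sum.group[OF fP finite_expo h, symmetric])
    also have "\<dots> = (\<Sum>e\<in>expo N (T + T'). of_int (?k e) * monom_val N e x)"
    proof (intro sum.cong refl)
      fix e
      have "(\<Sum>p\<in>?F e. of_int (c (fst p) * d (snd p)) * monom_val N (?h p) x)
          = (\<Sum>p\<in>?F e. of_int (c (fst p) * d (snd p)) * monom_val N e x)"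
        by (intro sum.cong) auto
      then show "(\<Sum>p\<in>?F e. of_int (c (fst p) * d (snd p)) * monom_val N (?h p) x) = of_int (?k e) * monom_val N e x"
        by (simp add: sum_distrib_right)
    qed
    finally show ?thesis .
  qed
  show ?thesis unfolding intpoly_def using 1 2 by (intro exI[of _ ?k]) auto
qed

lemma intpoly_cmult:
  assumes "intpoly N T B f" "\<bar>m\<bar> \<le> int B'"
  shows "intpoly N T (B' * B) (\<lambda>x. of_int m * f x)"
  using intpoly_mult[OF intpoly_const[OF assms(2), of N 0] assms(1)] by simp

lemma intpoly_diff:
  assumes "intpoly N T B f" "intpoly N T B' g"
  shows "intpoly N T (B + B') (\<lambda>x. f x - g x)"
  using intpoly_add[OF assms(1) intpoly_cmult[OF assms(2), of "-1" 1]] by simp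

lemma intpoly_sum:
  assumes "finite I" "\<And>i. i \<in> I \<Longrightarrow> intpoly N T B (f i)"
  shows "intpoly N T (card I * B) (\<lambda>x. \<Sum>i\<in>I. f i x)"
  using assms
proof (induction I rule: finite_induct)
  case empty
  then show ?case using intpoly_const[of 0 0] by simp
next
  case (insert i I)
  then show ?case using intpoly_add[of N T B "f i" "card I * B"] by simp
qed

lemma intpoly_power:
  assumes "intpoly N T B f"
  shows "intpoly N (T * m) (B ^ m) (\<lambda>x. f x ^ m)"
proof (induction m)
  case 0
  then show ?case using intpoly_const[of 1 1 N 0] by simp
next
  case (Suc m)
  then show ?case using intpoly_mult[OF assms Suc] by simp
qed

lemma intpoly_prod_power:
  fixes n :: nat
  assumes "\<And>i. i < n \<Longrightarrow> intpoly N T B (f i)"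
  shows "intpoly N (T * (\<Sum>i<n. a i)) (B ^ (\<Sum>i<n. a i)) (\<lambda>x. \<Prod>i<n. f i x ^ a i)"
  using assms
proof (induction n)
  case 0
  then show ?case using intpoly_const[of 1 1 N 0] by simp
next
  case (Suc n)
  from intpoly_mult[OF Suc.IH intpoly_power[of N T B "f n" "a n"]] Suc.prems show ?case
    by (simp add: power_add distrib_left)
qed

section \<open>Algebraic dependence of N + 1 polynomials in N variables, with explicit
  bounds\<close>

lemma binomial_scale: "(d * D + N) choose N \<le> d ^ N * ((D + N) choose N)" if "d \<ge> 1"
proof (induction N)
  case (Suc N)
  \<comment> \<open>The quotient of consecutive binomials is \<open>(d * D + Suc N) / Suc N\<close>,
    at most \<open>d\<close> times the one for \<open>D\<close>.\<close>
  have "Suc N * ((d * D + Suc N) choose Suc N) = (d * D + Suc N) * ((d * D + N) choose N)"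
    using Suc_times_binomial_eq[of "d * D + N" N] by (simp add: mult.commute)
  also have "\<dots> \<le> (d * (D + Suc N)) * (d ^ N * ((D + N) choose N))"
    using that mult_le_mono1[of 1 d "Suc N"] by (intro mult_mono Suc) (auto simp: distrib_left)
  also have "\<dots> = d ^ Suc N * ((D + Suc N) * ((D + N) choose N))" by (simp only: mult_ac power_Suc)
  also have "(D + Suc N) * ((D + N) choose N) = Suc N * ((D + Suc N) choose Suc N)"
    using Suc_times_binomial_eq[of "D + N" N] by (simp add: mult.commute)
  finally have "Suc N * ((d * D + Suc N) choose Suc N) \<le> Suc N * (d ^ Suc N * ((D + Suc N) choose Suc N))"
    by (simp only: mult_ac)
  then show ?case by (simp only: Suc_mult_le_cancel1)
qed simp

text \<open>The right side counts the products of degree at most \<open>D\<close> in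
  \<open>N + 1\<close> polynomials of degree \<open>d\<close>, the left side twice the monomials
  into which they expand. Thus there are two unknowns for each linear equation.\<close>

lemma card_expo_double:
  assumes "d \<ge> 1" "D = 2 * Suc N * d ^ N"
  shows "2 * card (expo N (d * D)) \<le> card (expo (Suc N) D)"
proof -
  have "Suc N * (2 * card (expo N (d * D))) \<le> Suc N * (2 * (d ^ N * ((D + N) choose N)))"
    unfolding card_expo by (intro mult_le_mono2 binomial_scale[OF assms(1)])
  also have "\<dots> = D * ((D + N) choose N)" by (subst (2) assms(2)) (simp only: mult_ac)
  also have "\<dots> \<le> (D + Suc N) * ((D + N) choose N)" by (intro mult_le_mono1) simp
  also have "\<dots> = Suc N * ((D + Suc N) choose Suc N)"
    using Suc_times_binomial_eq[of "D + N" N] by (simp add: mult.commute)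
  finally show ?thesis unfolding card_expo by (simp only: Suc_mult_le_cancel1)
qed

text \<open>Siegel's lemma for the linear system that makes every coefficient of the combined
  polynomial vanish; hence one family \<open>c\<close> serves all \<open>x\<close>. Two unknowns per
  equation keep the solution as small as the number of unknowns times the largest entry, up to the
  factor 2.\<close>

lemma integer_relation:
  fixes N d B :: nat
  assumes d: "d \<ge> 1" and B: "B \<ge> 1" and f: "\<And>i. i \<le> N \<Longrightarrow> intpoly N d B (f i)"
  defines "D \<equiv> 2 * Suc N * d ^ N"
  defines "H \<equiv> 2 * card (expo (Suc N) D) * B ^ D"
  obtains c :: "(nat \<Rightarrow> nat) \<Rightarrow> int" where
    "\<exists>a\<in>expo (Suc N) D. c a \<noteq> 0" "\<And>a. \<bar>c a\<bar> \<le> int H"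
    "\<And>x. (\<Sum>a\<in>expo (Suc N) D. of_int (c a) * (\<Prod>i\<le>N. f i x ^ a i)) = 0"
proof -
  let ?A = "expo (Suc N) D" and ?E = "expo N (d * D)"
  have "intpoly N (d * D) (B ^ D) (\<lambda>x. \<Prod>i\<le>N. f i x ^ a i)" if a: "a \<in> ?A" for a
  proof -
    have "(\<Sum>i<Suc N. a i) \<le> D" using a unfolding expo_def by blast
    then show ?thesis
      using intpoly_mono[OF intpoly_prod_power[of "Suc N" N d B f a]] f B
      by (simp add: lessThan_Suc_atMost power_increasing)
  qed
  then have "\<forall>a\<in>?A. \<exists>k. (\<Sum>e\<in>?E. \<bar>k e\<bar>) \<le> int (B ^ D) \<and>
      (\<forall>x. (\<Prod>i\<le>N. f i x ^ a i) = (\<Sum>e\<in>?E. of_int (k e) * monom_val N e x))"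
    unfolding intpoly_def by blast
  from bchoice[OF this] obtain K where K: "\<forall>a\<in>?A. (\<Sum>e\<in>?E. \<bar>K a e\<bar>) \<le> int (B ^ D) \<and>
      (\<forall>x. (\<Prod>i\<le>N. f i x ^ a i) = (\<Sum>e\<in>?E. of_int (K a e) * monom_val N e x))" ..
  have K1: "(\<Sum>e\<in>?E. \<bar>K a e\<bar>) \<le> int (B ^ D)"
    and K2: "(\<Prod>i\<le>N. f i x ^ a i) = (\<Sum>e\<in>?E. of_int (K a e) * monom_val N e x)"
    if "a \<in> ?A" for a x
    using bspec[OF K that] by auto
  have K3: "\<bar>K a e\<bar> \<le> int (B ^ D)" if "a \<in> ?A" "e \<in> ?E" for a e
    using member_le_sum[of e ?E "\<lambda>e. \<bar>K a e\<bar>"] K1[OF that(1)] that by simp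
  define M where "M = H * card ?A * B ^ D"
  let ?C = "?A \<rightarrow>\<^sub>E {0..int H}" and ?T = "?E \<rightarrow>\<^sub>E {- int M..int M}"
  let ?\<Phi> = "\<lambda>c. \<lambda>e\<in>?E. \<Sum>a\<in>?A. c a * K a e"
  have im: "?\<Phi> ` ?C \<subseteq> ?T"
  proof clarify
    fix c assume c: "c \<in> ?C"
    have "\<bar>\<Sum>a\<in>?A. c a * K a e\<bar> \<le> int M" if "e \<in> ?E" for e
    proof -
      have "\<bar>\<Sum>a\<in>?A. c a * K a e\<bar> \<le> (\<Sum>a\<in>?A. \<bar>c a\<bar> * \<bar>K a e\<bar>)"
        by (rule order.trans[OF sum_abs]) (simp add: abs_mult)
      also have "\<dots> \<le> (\<Sum>a\<in>?A. int H * int (B ^ D))"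
        using c K3[OF _ that] by (intro sum_mono mult_mono) (auto simp: PiE_iff)
      finally show ?thesis by (simp add: M_def mult_ac)
    qed
    then show "?\<Phi> c \<in> ?T" by (auto simp: PiE_iff abs_le_iff minus_le_iff)
  qed
  have "card ?C = (H + 1) ^ card ?A"
    by (simp add: card_PiE nat_add_distrib)
  moreover have "card ?T = (2 * M + 1) ^ card ?E"
  proof -
    have "nat (2 * int M + 1) = 2 * M + 1" by linarith
    then show ?thesis by (simp add: card_PiE)
  qed
  moreover have "(2 * M + 1) ^ card ?E < (H + 1) ^ card ?A"
  proof -
    have A: "card ?A \<ge> 1" unfolding card_expo by (simp add: Suc_leI)
    have E: "card ?E \<ge> 1" unfolding card_expo by (simp add: Suc_leI)
    have H: "H \<ge> 1" unfolding H_def using A B by (simp add: Suc_leI)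
    \<comment> \<open>\<open>H\<close> is chosen to make \<open>2 * M\<close> equal to
      \<open>H * H\<close>: the values of one equation number less than \<open>(H + 1)^2\<close>,
      the choices for two unknowns.\<close>
    have "2 * M = H * (2 * card ?A * B ^ D)" by (simp add: M_def)
    also have "\<dots> = H * H" by (simp only: H_def)
    finally have "2 * M + 1 < (H + 1) ^ 2" using H by (simp add: power2_eq_square)
    then have "(2 * M + 1) ^ card ?E < ((H + 1) ^ 2) ^ card ?E"
      using E by (intro power_strict_mono) auto
    also have "\<dots> = (H + 1) ^ (2 * card ?E)" by (simp add: power_mult)
    also have "\<dots> \<le> (H + 1) ^ card ?A"
      using card_expo_double[OF d, of D N] by (intro power_increasing) (auto simp: D_def)
    finally show ?thesis .
  qed
  ultimately have "card ?T < card ?C" by simp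
  moreover have "finite ?T" by (intro finite_PiE) auto
  ultimately have "\<not> inj_on ?\<Phi> ?C"
    using card_inj_on_le[OF _ im] by (meson not_le)
  then obtain c c' where c: "c \<in> ?C" "c' \<in> ?C" "c \<noteq> c'" "?\<Phi> c = ?\<Phi> c'"
    by (meson inj_onI)
  \<comment> \<open>The value 0 outside \<open>?A\<close> makes the bound hold for every
    \<open>a\<close>, as the conclusion asks.\<close>
  define b where "b a = (if a \<in> ?A then c a - c' a else 0)" for a
  show thesis
  proof
    show "\<exists>a\<in>?A. b a \<noteq> 0"
    proof (rule ccontr)
      assume "\<not> ?thesis"
      then have "c a = c' a" if "a \<in> ?A" for a using that by (simp add: b_def)
      with c(1-3) PiE_ext show False by metis
    qed
    show "\<bar>b a\<bar> \<le> int H" for a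
    proof (cases "a \<in> ?A")
      case True
      then have "c a \<in> {0..int H}" "c' a \<in> {0..int H}" using c(1,2) PiE_mem by metis+
      then show ?thesis using True by (simp add: b_def abs_le_iff)
    qed (simp add: b_def)
    fix x
    have "(\<Sum>a\<in>?A. of_int (b a) * (\<Prod>i\<le>N. f i x ^ a i))
       = (\<Sum>a\<in>?A. \<Sum>e\<in>?E. of_int (b a * K a e) * monom_val N e x)"
      by (intro sum.cong) (auto simp: K2 sum_distrib_left mult_ac)
    also have "\<dots> = (\<Sum>e\<in>?E. of_int (\<Sum>a\<in>?A. b a * K a e) * monom_val N e x)"
      by (subst sum.swap) (simp add: sum_distrib_right)
    also have "\<dots> = 0"
    proof (intro sum.neutral ballI)
      fix e assume "e \<in> ?E"
      then have "(\<Sum>a\<in>?A. c a * K a e) = (\<Sum>a\<in>?A. c' a * K a e)"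
        using fun_cong[OF c(4), of e] by simp
      then have "(\<Sum>a\<in>?A. b a * K a e) = 0"
        by (simp add: b_def left_diff_distrib sum_subtractf)
      then show "of_int (\<Sum>a\<in>?A. b a * K a e) * monom_val N e x = 0" by simp
    qed
    finally show "(\<Sum>a\<in>?A. of_int (b a) * (\<Prod>i\<le>N. f i x ^ a i)) = 0" .
  qed
qed

section \<open>Kronecker exponents and a root bound that survives a small perturbation\<close>

lemma digits_unique:
  fixes a b :: "nat \<Rightarrow> nat"
  assumes "\<And>i. i < N \<Longrightarrow> a i < w" "\<And>i. i < N \<Longrightarrow> b i < w"
    and "(\<Sum>i<N. a i * w ^ i) = (\<Sum>i<N. b i * w ^ i)" and "i < N"
  shows "a i = b i"
  using assms
proof (induction N arbitrary: a b i)
  case (Suc N)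
  have split: "(\<Sum>i<Suc N. f i * w ^ i) = f 0 + w * (\<Sum>i<N. f (Suc i) * w ^ i)" for f :: "nat \<Rightarrow> nat"
    by (simp only: sum.lessThan_Suc_shift) (simp add: sum_distrib_left mult_ac)
  have eq: "a 0 + w * (\<Sum>i<N. a (Suc i) * w ^ i) = b 0 + w * (\<Sum>i<N. b (Suc i) * w ^ i)"
    using Suc.prems(3) unfolding split .
  have lt: "a 0 < w" "b 0 < w" using Suc.prems(1,2) by auto
  have 0: "a 0 = b 0" using arg_cong[OF eq, of "\<lambda>m. m mod w"] lt by simp
  then have "(\<Sum>i<N. a (Suc i) * w ^ i) = (\<Sum>i<N. b (Suc i) * w ^ i)"
    using eq lt by simp
  then have "a (Suc j) = b (Suc j)" if "j < N" for j
    using Suc.IH[of "\<lambda>i. a (Suc i)" "\<lambda>i. b (Suc i)" j] Suc.prems(1,2) that by simp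
  with 0 Suc.prems(4) show ?case by (cases i) auto
qed simp

text \<open>Cauchy's root bound: a polynomial with leading coefficient of modulus at least 1 and the
  others of modulus at most \<open>H\<close> has modulus at least 1 at \<open>r\<close>.\<close>

lemma power_dominates:
  fixes r :: real
  assumes "r \<ge> H + 1" "H \<ge> 0"
  shows "r ^ d \<ge> 1 + H * (\<Sum>j<d. r ^ j)"
proof -
  have "H * (\<Sum>j<d. r ^ j) \<le> (r - 1) * (\<Sum>j<d. r ^ j)"
    using assms by (intro mult_right_mono sum_nonneg) auto
  also have "\<dots> = r ^ d - 1"
    by (simp add: power_diff_1_eq)
  finally show ?thesis by simp
qed

text \<open>Each product is \<open>v ^ a 0\<close> times a power of \<open>t\<close> whose exponent
  has the base \<open>Suc D\<close> digits \<open>a 1\<close>, \<open>a 2\<close>, and so on. The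
  products with the least exponent of \<open>t\<close> therefore differ in the power of
  \<open>v\<close> and form a nonzero integer polynomial in \<open>v\<close>. If \<open>v\<close>
  were large, this polynomial would have modulus at least 1 by Cauchy's bound; all other terms keep
  a factor \<open>t\<close> and, as \<open>v\<close> is bounded by \<open>C\<close>, add up to less
  than 1.\<close>

lemma perturbed_root_bound:
  fixes c :: "(nat \<Rightarrow> nat) \<Rightarrow> int" and v C t :: real
  assumes nz: "\<exists>a\<in>expo (Suc N) D. c a \<noteq> 0" and cH: "\<And>a. \<bar>c a\<bar> \<le> int H"
    and y0: "y 0 = v" and yS: "\<And>i. i < N \<Longrightarrow> y (Suc i) = t ^ (Suc D ^ i)"
    and rel: "(\<Sum>a\<in>expo (Suc N) D. of_int (c a) * (\<Prod>i\<le>N. y i ^ a i)) = 0"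
    and t: "0 < t" "t < 1" and C: "\<bar>v\<bar> \<le> C" "C \<ge> 1"
    and small: "card (expo (Suc N) D) * H * C ^ D * t < 1"
  shows "\<bar>v\<bar> \<le> real H + 1"
proof (rule ccontr)
  assume "\<not> ?thesis"
  then have v: "\<bar>v\<bar> \<ge> real H + 1" by simp
  let ?A = "expo (Suc N) D"
  define \<kappa> where "\<kappa> a = (\<Sum>i<N. a (Suc i) * Suc D ^ i)" for a :: "nat \<Rightarrow> nat"
  define S where "S = {a \<in> ?A. c a \<noteq> 0}"
  have S: "finite S" "S \<noteq> {}" "S \<subseteq> ?A" using nz by (auto simp: S_def)
  have tm: "(\<Prod>i\<le>N. y i ^ a i) = v ^ a 0 * t ^ \<kappa> a" for a
  proof -
    have "(\<Prod>i\<le>N. y i ^ a i) = v ^ a 0 * (\<Prod>i<N. y (Suc i) ^ a (Suc i))"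
      by (simp add: lessThan_Suc_atMost[symmetric] y0 prod.lessThan_Suc_shift del: prod.lessThan_Suc)
    also have "(\<Prod>i<N. y (Suc i) ^ a (Suc i)) = (\<Prod>i<N. t ^ (a (Suc i) * Suc D ^ i))"
      by (intro prod.cong) (auto simp: yS power_mult[symmetric] mult.commute)
    also have "\<dots> = t ^ \<kappa> a" by (simp add: \<kappa>_def power_sum)
    finally show ?thesis .
  qed
  define k where "k = Min (\<kappa> ` S)"
  have k: "k \<le> \<kappa> a" if "a \<in> S" for a using S that by (simp add: k_def)
  define S0 where "S0 = {a \<in> S. \<kappa> a = k}"
  have S0: "finite S0" "S0 \<noteq> {}" "S0 \<subseteq> S"
  proof -
    have "Min (\<kappa> ` S) \<in> \<kappa> ` S" using S by (intro Min_in) auto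
    then show "S0 \<noteq> {}" by (auto simp: S0_def k_def)
  qed (use S in \<open>auto simp: S0_def\<close>)
  have inj: "inj_on (\<lambda>a. a 0) S0"
  proof (rule inj_onI)
    fix a b assume ab: "a \<in> S0" "b \<in> S0" "a 0 = b 0"
    have lt: "e i < Suc D" if "e \<in> S0" for e i
      using expo_le[of e "Suc N" D i] that S0 S by auto
    have "a (Suc i) = b (Suc i)" if "i < N" for i
      using digits_unique[of N "\<lambda>i. a (Suc i)" "Suc D" "\<lambda>i. b (Suc i)" i] lt ab that
      by (simp add: S0_def \<kappa>_def)
    moreover have "a i = 0" "b i = 0" if "i \<ge> Suc N" for i
      using ab that S0 S by (auto simp: expo_def)
    ultimately show "a = b" using ab(3)
      by (metis ext not0_implies_Suc not_less_eq_eq not_le)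
  qed
  define d where "d = Max ((\<lambda>a. a 0) ` S0)"
  obtain b where b: "b \<in> S0" "b 0 = d"
  proof -
    have "d \<in> (\<lambda>a. a 0) ` S0" unfolding d_def using S0 by (intro Max_in) auto
    then show thesis using that by auto
  qed
  have le_d: "a 0 < d" if "a \<in> S0 - {b}" for a
  proof -
    have "a 0 \<le> d" using that S0 by (simp add: d_def)
    moreover have "a 0 \<noteq> d" using that b inj by (auto dest: inj_onD)
    ultimately show ?thesis by simp
  qed
  have lead: "\<bar>\<Sum>a\<in>S0. of_int (c a) * v ^ a 0\<bar> \<ge> 1"
  proof -
    have "\<bar>\<Sum>a\<in>S0 - {b}. of_int (c a) * v ^ a 0\<bar> \<le> (\<Sum>a\<in>S0 - {b}. H * \<bar>v\<bar> ^ a 0)"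
    proof (intro order.trans[OF sum_abs] sum_mono)
      fix a
      have "real_of_int \<bar>c a\<bar> \<le> real H" using cH[of a] by linarith
      then show "\<bar>of_int (c a) * v ^ a 0\<bar> \<le> H * \<bar>v\<bar> ^ a 0"
        by (simp add: abs_mult power_abs mult_right_mono)
    qed
    also have "\<dots> = H * (\<Sum>j\<in>(\<lambda>a. a 0) ` (S0 - {b}). \<bar>v\<bar> ^ j)"
      using inj_on_subset[OF inj, of "S0 - {b}"] by (simp add: sum.reindex sum_distrib_left)
    also have "\<dots> \<le> H * (\<Sum>j<d. \<bar>v\<bar> ^ j)"
      using le_d by (intro mult_left_mono sum_mono2) auto
    also have "\<dots> \<le> \<bar>v\<bar> ^ d - 1"
      using power_dominates[OF v, of d] by simp
    finally have rest: "\<bar>\<Sum>a\<in>S0 - {b}. of_int (c a) * v ^ a 0\<bar> \<le> \<bar>v\<bar> ^ d - 1" .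
    have "\<bar>c b\<bar> \<ge> 1" using b(1) by (auto simp: S0_def S_def)
    then have "1 \<le> \<bar>real_of_int (c b)\<bar>" by linarith
    then have "\<bar>v\<bar> ^ d \<le> \<bar>of_int (c b) * v ^ b 0\<bar>"
      using b mult_right_mono[of 1 "\<bar>real_of_int (c b)\<bar>" "\<bar>v\<bar> ^ d"] by (simp add: abs_mult power_abs)
    moreover have "(\<Sum>a\<in>S0. of_int (c a) * v ^ a 0) = of_int (c b) * v ^ b 0 + (\<Sum>a\<in>S0 - {b}. of_int (c a) * v ^ a 0)"
      using S0(1) b(1) by (rule sum.remove)
    ultimately show ?thesis using rest by linarith
  qed
  have "0 = (\<Sum>a\<in>?A. of_int (c a) * (v ^ a 0 * t ^ \<kappa> a))"
    using rel by (simp add: tm)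
  also have "\<dots> = (\<Sum>a\<in>S. of_int (c a) * (v ^ a 0 * t ^ \<kappa> a))"
    by (intro sum.mono_neutral_right) (auto simp: S_def)
  also have "\<dots> = t ^ k * (\<Sum>a\<in>S. of_int (c a) * v ^ a 0 * t ^ (\<kappa> a - k))"
    unfolding sum_distrib_left using k
    by (intro sum.cong) (auto simp: mult_ac power_add[symmetric])
  finally have "(\<Sum>a\<in>S. of_int (c a) * v ^ a 0 * t ^ (\<kappa> a - k)) = 0" using t by simp
  moreover have "(\<Sum>a\<in>S. of_int (c a) * v ^ a 0 * t ^ (\<kappa> a - k))
      = (\<Sum>a\<in>S - S0. of_int (c a) * v ^ a 0 * t ^ (\<kappa> a - k)) + (\<Sum>a\<in>S0. of_int (c a) * v ^ a 0 * t ^ (\<kappa> a - k))"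
    using S0 S by (intro sum.subset_diff) auto
  moreover have "(\<Sum>a\<in>S0. of_int (c a) * v ^ a 0 * t ^ (\<kappa> a - k)) = (\<Sum>a\<in>S0. of_int (c a) * v ^ a 0)"
    by (intro sum.cong) (auto simp: S0_def)
  moreover have "\<bar>\<Sum>a\<in>S - S0. of_int (c a) * v ^ a 0 * t ^ (\<kappa> a - k)\<bar> < 1"
  proof -
    have "\<bar>\<Sum>a\<in>S - S0. of_int (c a) * v ^ a 0 * t ^ (\<kappa> a - k)\<bar> \<le> (\<Sum>a\<in>S - S0. H * C ^ D * t)"
    proof (intro order.trans[OF sum_abs] sum_mono)
      fix a assume a: "a \<in> S - S0"
      have 1: "\<bar>real_of_int (c a)\<bar> \<le> H" using cH[of a] by linarith
      have "\<bar>v\<bar> ^ a 0 \<le> C ^ a 0" using C by (intro power_mono) auto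
      also have "\<dots> \<le> C ^ D" using C expo_le[of a "Suc N" D 0] a S by (intro power_increasing) auto
      finally have 2: "\<bar>v ^ a 0\<bar> \<le> C ^ D" by (simp add: power_abs)
      have "\<kappa> a - k \<ge> 1" using a k[of a] by (auto simp: S0_def)
      then have 3: "t ^ (\<kappa> a - k) \<le> t" using t power_decreasing[of 1 "\<kappa> a - k" t] by simp
      show "\<bar>of_int (c a) * v ^ a 0 * t ^ (\<kappa> a - k)\<bar> \<le> H * C ^ D * t"
        unfolding abs_mult using 1 2 3 t C by (intro mult_mono) auto
    qed
    also have "\<dots> = card (S - S0) * (H * C ^ D * t)" by simp
    also have "\<dots> \<le> card ?A * (H * C ^ D * t)"
      using S C t by (intro mult_right_mono) (auto intro!: card_mono)
    also have "\<dots> < 1" using small by (simp add: mult_ac)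
    finally show ?thesis .
  qed
  ultimately show False using lead by linarith
qed

section \<open>Small solutions of quadratic inequalities\<close>

text \<open>Minimality along each axis is all that the vanishing of partial derivatives needs.
  Coordinates from \<open>k\<close> on are pinned to 0, which makes the set of competitors a product
  of compact sets; \<open>coercive\<close> puts every better point inside it.\<close>

lemma coordinatewise_minimum:
  fixes \<Phi> :: "(nat \<Rightarrow> real) \<Rightarrow> real"
  assumes cont: "continuous_on UNIV \<Phi>"
    and x0: "\<And>i. i < k \<Longrightarrow> \<bar>x0 i\<bar> \<le> C" "\<And>i. i \<ge> k \<Longrightarrow> x0 i = 0"
    and coercive: "\<And>x i. i < k \<Longrightarrow> \<Phi> x \<le> \<Phi> x0 \<Longrightarrow> \<bar>x i\<bar> \<le> C"
  obtains x where "\<Phi> x \<le> \<Phi> x0" "\<And>j t. j < k \<Longrightarrow> \<Phi> x \<le> \<Phi> (x(j := t))"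
proof -
  define S where "S i = (if i < k then {- C..C} else {0})" for i
  define K where "K = Pi\<^sub>E UNIV S"
  have K: "x \<in> K \<longleftrightarrow> (\<forall>i<k. \<bar>x i\<bar> \<le> C) \<and> (\<forall>i\<ge>k. x i = 0)" for x
  proof -
    have "x i \<in> S i \<longleftrightarrow> (if i < k then \<bar>x i\<bar> \<le> C else x i = 0)" for i
      by (auto simp: S_def)
    then show ?thesis by (auto simp: K_def PiE_iff not_less split: if_splits)
  qed
  have "compactin euclidean K"
    unfolding K_def euclidean_product_topology[symmetric] compactin_PiE
    by (auto simp: S_def)
  then have "compact K" by simp
  moreover have x0K: "x0 \<in> K" using x0 by (simp add: K)
  ultimately obtain x where x: "x \<in> K" "\<And>y. y \<in> K \<Longrightarrow> \<Phi> x \<le> \<Phi> y"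
    using continuous_attains_inf[of K \<Phi>] continuous_on_subset[OF cont] by auto
  show thesis
  proof
    show 0: "\<Phi> x \<le> \<Phi> x0" using x x0K by simp
    fix j t assume j: "j < k"
    show "\<Phi> x \<le> \<Phi> (x(j := t))"
    proof (rule ccontr)
      assume nle: "\<not> ?thesis"
      then have "x(j := t) \<in> K" using coercive[of _ "x(j := t)"] 0 x(1) j by (auto simp: K)
      then show False using x(2) nle by blast
    qed
  qed
qed

text \<open>The square makes the penalty differentiable also at the boundary of a constraint. The
  derivative is linear on either side, so the critical equations are polynomial once the set of
  violated constraints is known.\<close>

lemma DERIV_max_0_square:
  "((\<lambda>u. (max 0 u)\<^sup>2) has_real_derivative 2 * max 0 u) (at u)" for u :: real
proof (cases "u = 0")
  case True
  have "((\<lambda>h. max 0 h * (max 0 h / h)) \<longlongrightarrow> 0) (at (0::real))"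
  proof (rule Lim_null_comparison)
    show "\<forall>\<^sub>F h in at 0. norm (max 0 h * (max 0 h / h)) \<le> \<bar>h\<bar>"
      by (intro always_eventually) (auto simp: max_def)
    show "((\<lambda>h. \<bar>h\<bar>) \<longlongrightarrow> 0) (at (0::real))"
      by (intro tendsto_rabs_zero tendsto_ident_at)
  qed
  then show ?thesis using True by (simp add: DERIV_def power2_eq_square)
next
  case False
  then consider "u > 0" | "u < 0" by linarith
  then show ?thesis
  proof cases
    case 1
    have "((\<lambda>u. u\<^sup>2) has_real_derivative 2 * u) (at u)" by (auto intro!: derivative_eq_intros)
    then have "((\<lambda>u. (max 0 u)\<^sup>2) has_real_derivative 2 * u) (at u)"
      by (rule has_field_derivative_transform_within_open[of _ _ _ "{0<..}"]) (use 1 in auto)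
    then show ?thesis using 1 by simp
  next
    case 2
    have "((\<lambda>u. 0) has_real_derivative 0) (at u)" by simp
    then have "((\<lambda>u. (max 0 u)\<^sup>2) has_real_derivative 0) (at u)"
      by (rule has_field_derivative_transform_within_open[of _ _ _ "{..<0}"]) (use 2 in auto)
    then show ?thesis using 2 by simp
  qed
qed

section \<open>Quadratic constraints and the equations of a critical point\<close>

definition quad :: "nat \<Rightarrow> (nat \<Rightarrow> nat \<Rightarrow> int) \<Rightarrow> (nat \<Rightarrow> int) \<Rightarrow> (nat \<Rightarrow> real) \<Rightarrow> real" where
  "quad k M l x = (\<Sum>a<k. \<Sum>b<k. of_int (M a b) * (x a * x b)) + (\<Sum>a<k. of_int (l a) * x a)"

definition quad_deriv :: "nat \<Rightarrow> (nat \<Rightarrow> nat \<Rightarrow> int) \<Rightarrow> (nat \<Rightarrow> int) \<Rightarrow> nat \<Rightarrow> (nat \<Rightarrow> real) \<Rightarrow> real" where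
  "quad_deriv k M l j x = (\<Sum>b<k. of_int (M j b + M b j) * x b) + of_int (l j)"

lemma quad_cong: "(\<And>i. i < k \<Longrightarrow> x i = y i) \<Longrightarrow> quad k M l x = quad k M l y"
  by (simp add: quad_def)

lemma quad_deriv_cong: "(\<And>i. i < k \<Longrightarrow> x i = y i) \<Longrightarrow> quad_deriv k M l j x = quad_deriv k M l j y"
  by (simp add: quad_deriv_def)

lemma DERIV_fun_upd: "((\<lambda>t. (x(j := t)) a) has_real_derivative (if a = j then 1 else 0)) (at u)"
  by simp

lemma DERIV_quad:
  assumes "j < k"
  shows "((\<lambda>t. quad k M l (x(j := t))) has_real_derivative quad_deriv k M l j x) (at (x j))"
proof -
  let ?d = "\<lambda>a. if a = j then 1 else 0 :: real"
  have "((\<lambda>t. quad k M l (x(j := t))) has_real_derivative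
      (\<Sum>a<k. \<Sum>b<k. of_int (M a b) * (?d a * x b + ?d b * x a)) + (\<Sum>a<k. of_int (l a) * ?d a)) (at (x j))"
    unfolding quad_def
    by (rule derivative_eq_intros DERIV_fun_upd refl)+ (simp add: mult.commute)
  also have "(\<Sum>a<k. \<Sum>b<k. of_int (M a b) * (?d a * x b + ?d b * x a))
      = (\<Sum>a<k. \<Sum>b<k. of_int (M a b) * (?d a * x b)) + (\<Sum>a<k. \<Sum>b<k. of_int (M a b) * (?d b * x a))"
    by (simp only: sum.distrib distrib_left)
  also have "(\<Sum>a<k. \<Sum>b<k. of_int (M a b) * (?d a * x b)) = (\<Sum>a<k. if a = j then \<Sum>b<k. of_int (M a b) * x b else 0)"
    by (intro sum.cong) auto
  also have "\<dots> = (\<Sum>b<k. of_int (M j b) * x b)" using assms by simp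
  also have "(\<Sum>a<k. \<Sum>b<k. of_int (M a b) * (?d b * x a)) = (\<Sum>a<k. \<Sum>b<k. if b = j then of_int (M a j) * x a else 0)"
    by (intro sum.cong) auto
  also have "\<dots> = (\<Sum>a<k. of_int (M a j) * x a)" using assms by simp
  also have "(\<Sum>a<k. of_int (l a) * ?d a) = (\<Sum>a<k. if a = j then of_int (l a) else 0)"
    by (intro sum.cong) auto
  also have "\<dots> = of_int (l j)" using assms by simp
  finally show ?thesis
    by (simp add: quad_deriv_def sum.distrib distrib_right fun_upd_def)
qed

lemma intpoly_quad:
  assumes "\<And>a b. \<bar>M a b\<bar> \<le> 1" "\<And>a. \<bar>l a\<bar> \<le> 1" "k \<le> N"
  shows "intpoly N 2 (k * k + k) (quad k M l)"
proof -
  have 1: "intpoly N 2 1 (\<lambda>x. of_int (M a b) * (x a * x b))" if "a < k" "b < k" for a b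
    using intpoly_cmult[OF intpoly_mult[OF intpoly_var intpoly_var, of a N b], of "M a b" 1] that assms
    by (simp add: numeral_2_eq_2)
  have 2: "intpoly N 2 1 (\<lambda>x. of_int (l a) * x a)" if "a < k" for a
    using intpoly_cmult[OF intpoly_mono[OF intpoly_var[of a N], of 2 1], of "l a" 1] that assms by simp
  have "intpoly N 2 (card {..<k} * (card {..<k} * 1) + card {..<k} * 1) (quad k M l)"
    unfolding quad_def[abs_def] by (intro intpoly_add intpoly_sum 1 2) auto
  then show ?thesis by simp
qed

lemma intpoly_quad_deriv:
  assumes "\<And>a b. \<bar>M a b\<bar> \<le> 1" "\<And>a. \<bar>l a\<bar> \<le> 1" "k \<le> N" "j < k"
  shows "intpoly N 1 (2 * k + 1) (quad_deriv k M l j)"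
proof -
  have 1: "intpoly N 1 2 (\<lambda>x. of_int (M j b + M b j) * x b)" if "b < k" for b
    using intpoly_cmult[OF intpoly_var[of b N], of "M j b + M b j" 2] that assms(3) assms(1)[of j b] assms(1)[of b j] by simp
  have "intpoly N 1 (card {..<k} * 2 + 1) (quad_deriv k M l j)"
    unfolding quad_deriv_def[abs_def] using assms
    by (intro intpoly_add intpoly_sum 1 intpoly_const) auto
  then show ?thesis by (simp add: mult.commute)
qed

text \<open>Coefficient norm of a critical equation: 2 for the term \<open>2 * t * x j\<close>, and
  for each of at most \<open>m\<close> violated constraints twice the product of the norms of
  \<open>1 - g\<close> and of a partial derivative of \<open>g\<close>.\<close>

definition norm_bound :: "nat \<Rightarrow> nat \<Rightarrow> nat" where
  "norm_bound k m = 2 + 2 * (m * ((1 + (k * k + k)) * (2 * k + 1)))"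

text \<open>The variable with index \<open>k\<close> stands for \<open>t\<close>: the coefficients
  must be integers, so \<open>t\<close> has to count as an unknown.\<close>

lemma intpoly_critical:
  assumes "\<And>i a b. \<bar>M i a b\<bar> \<le> 1" "\<And>i a. \<bar>l i a\<bar> \<le> 1" "j < k" "finite I" "J \<subseteq> I"
  shows "intpoly (Suc k) 3 (norm_bound k (card I))
    (\<lambda>z. 2 * (z k * z j) - 2 * (\<Sum>i\<in>J. (1 - quad k (M i) (l i) z) * quad_deriv k (M i) (l i) j z))"
proof -
  let ?N = "Suc k"
  have J: "finite J" "card J \<le> card I" using assms(4,5) by (auto intro: finite_subset card_mono)
  have "intpoly ?N (2 + 1) ((1 + (k * k + k)) * (2 * k + 1)) (\<lambda>z. (1 - quad k (M i) (l i) z) * quad_deriv k (M i) (l i) j z)" for i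
    using assms intpoly_const[of 1 1] 
    by (intro intpoly_mult intpoly_diff intpoly_quad intpoly_quad_deriv) auto
  then have "intpoly ?N 3 (card J * ((1 + (k * k + k)) * (2 * k + 1))) (\<lambda>z. \<Sum>i\<in>J. (1 - quad k (M i) (l i) z) * quad_deriv k (M i) (l i) j z)"
    by (intro intpoly_sum J) (simp add: numeral_3_eq_3 numeral_2_eq_2)
  from intpoly_cmult[OF intpoly_mono[OF this order.refl mult_le_mono1[OF J(2)]], of 2 2]
  have 1: "intpoly ?N 3 (2 * (card I * ((1 + (k * k + k)) * (2 * k + 1)))) (\<lambda>z. 2 * (\<Sum>i\<in>J. (1 - quad k (M i) (l i) z) * quad_deriv k (M i) (l i) j z))"
    by simp
  have "intpoly ?N (1 + 1) (1 * 1) (\<lambda>z. z k * z j)"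
    using assms(3) by (intro intpoly_mult intpoly_var) auto
  from intpoly_cmult[OF intpoly_mono[OF this, of 3 1], of 2 2]
  have 2: "intpoly ?N 3 2 (\<lambda>z. 2 * (z k * z j))" by simp
  show ?thesis unfolding norm_bound_def by (rule intpoly_diff[OF 2 1])
qed

text \<open>The height \<open>H\<close> of \<open>integer_relation\<close> for \<open>Suc k\<close>
  variables and degree 3.\<close>

definition coord_bound :: "nat \<Rightarrow> nat \<Rightarrow> nat" where
  "coord_bound k m = (let D = 2 * Suc (Suc k) * 3 ^ Suc k in
     2 * card (expo (Suc (Suc k)) D) * norm_bound k m ^ D)"

text \<open>The size of \<open>x0\<close> enters only \<open>C\<close> and \<open>t\<close>, and
  these drop out, since the root bound depends on the height of the relation alone. The penalty at
  the minimizer is at most 1/4, which costs each constraint at most 1/2.\<close>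

theorem bounded_quadratic_solution:
  fixes M :: "'i \<Rightarrow> nat \<Rightarrow> nat \<Rightarrow> int" and l :: "'i \<Rightarrow> nat \<Rightarrow> int" and x0 :: "nat \<Rightarrow> real"
  assumes fin: "finite I" and M: "\<And>i a b. \<bar>M i a b\<bar> \<le> 1" and l: "\<And>i a. \<bar>l i a\<bar> \<le> 1"
    and feasible: "\<And>i. i \<in> I \<Longrightarrow> quad k (M i) (l i) x0 \<ge> 1"
  obtains x where "\<And>i. i \<in> I \<Longrightarrow> quad k (M i) (l i) x \<ge> 1/2"
    "\<And>j. j < k \<Longrightarrow> \<bar>x j\<bar> \<le> real (coord_bound k (card I)) + 1"
proof -
  define N where "N = Suc k"
  define D where "D = 2 * Suc N * 3 ^ N"
  define B where "B = norm_bound k (card I)"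
  define H where "H = 2 * card (expo (Suc N) D) * B ^ D"
  have H: "coord_bound k (card I) = H"
    by (simp add: coord_bound_def Let_def H_def D_def B_def N_def)
  define g where "g i = quad k (M i) (l i)" for i
  define y0 where "y0 i = (if i < k then x0 i else 0)" for i
  define m where "m = (\<Sum>j<k. (y0 j)\<^sup>2 + \<bar>y0 j\<bar>)"
  \<comment> \<open>The summand \<open>k\<close> pays for the other coordinates: each lowers the sum
    of the \<open>(x j)\<^sup>2 - \<bar>x j\<bar>\<close> by at most 1.\<close>
  define C where "C = m + k + 1"
  have m0: "m \<ge> 0" unfolding m_def by (intro sum_nonneg) auto
  then have C: "C \<ge> 1" by (simp add: C_def)
  have y0: "1 \<le> g i y0" if "i \<in> I" for i
    using feasible[OF that] quad_cong[of k x0 y0] by (simp add: g_def y0_def)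
  define E where "E = real (card (expo (Suc N) D)) * H * C ^ D"
  have E: "E \<ge> 0" using C by (simp add: E_def)
  \<comment> \<open>\<open>C\<close> bounds all minimizers independently of \<open>t\<close>, so \<open>t\<close> may be chosen after it.\<close>
  define t where "t = 1 / (4 * (E + C))"
  have t: "0 < t" "t < 1" "E * t < 1" "t * (m + k) \<le> 1 / 4"
    using E C m0 by (auto simp: t_def field_simps C_def)
  \<comment> \<open>The exponents begin with \<open>Suc D ^ 1\<close>, because
    \<open>Suc D ^ 0\<close> belongs to \<open>t\<close> itself as a value of the relation.\<close>
  define \<tau> where "\<tau> j = t ^ (Suc D ^ Suc j)" for j
  have \<tau>: "0 \<le> \<tau> j" "\<tau> j \<le> t" for j
    using t power_decreasing[of 1 "Suc D ^ Suc j" t] one_le_power[of "Suc D" "Suc j"]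
    by (auto simp: \<tau>_def simp del: power_Suc)
  define pen where "pen x = (\<Sum>i\<in>I. (max 0 (1 - g i x))\<^sup>2)" for x
  define \<Phi> where "\<Phi> x = t * (\<Sum>j<k. (x j)\<^sup>2) + pen x - (\<Sum>j<k. \<tau> j * x j)" for x
  have pen: "pen x \<ge> 0" for x unfolding pen_def by (intro sum_nonneg) auto
  have lower: "t * (\<Sum>j<k. (x j)\<^sup>2 - \<bar>x j\<bar>) + pen x \<le> \<Phi> x" for x
  proof -
    have "(\<Sum>j<k. \<tau> j * x j) \<le> (\<Sum>j<k. t * \<bar>x j\<bar>)"
    proof (rule sum_mono)
      fix j
      have "\<tau> j * x j \<le> \<tau> j * \<bar>x j\<bar>" using \<tau>(1) by (intro mult_left_mono) auto
      also have "\<dots> \<le> t * \<bar>x j\<bar>" using \<tau>(2) by (intro mult_right_mono) auto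
      finally show "\<tau> j * x j \<le> t * \<bar>x j\<bar>" .
    qed
    then show ?thesis by (simp add: \<Phi>_def sum_subtractf sum_distrib_left right_diff_distrib)
  qed
  have upper: "\<Phi> y0 \<le> t * m"
  proof -
    have "pen y0 = 0" using y0 by (simp add: pen_def)
    moreover have "(\<Sum>j<k. - (\<tau> j * y0 j)) \<le> (\<Sum>j<k. t * \<bar>y0 j\<bar>)"
    proof (rule sum_mono)
      fix j
      have "- (\<tau> j * y0 j) \<le> \<tau> j * \<bar>y0 j\<bar>"
        using \<tau>(1)[of j] mult_left_mono[of "- y0 j" "\<bar>y0 j\<bar>" "\<tau> j"] by simp
      also have "\<dots> \<le> t * \<bar>y0 j\<bar>" using \<tau>(2) by (intro mult_right_mono) auto
      finally show "- (\<tau> j * y0 j) \<le> t * \<bar>y0 j\<bar>" .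
    qed
    ultimately show ?thesis
      by (simp add: \<Phi>_def m_def sum.distrib sum_distrib_left distrib_left sum_negf)
  qed
  have ge: "a\<^sup>2 - \<bar>a\<bar> \<ge> - 1" for a :: real
  proof -
    have "0 \<le> (\<bar>a\<bar> - 1 / 2)\<^sup>2" by simp
    then show ?thesis by (simp add: power2_eq_square algebra_simps)
  qed
  have sum_ge: "(\<Sum>j\<in>S. (x j)\<^sup>2 - \<bar>x j\<bar>) \<ge> - real k" if "S \<subseteq> {..<k}" for S x
  proof -
    have "(\<Sum>j\<in>S. (x j)\<^sup>2 - \<bar>x j\<bar>) \<ge> (\<Sum>j\<in>S. - 1)" by (intro sum_mono ge)
    moreover have "card S \<le> k" using card_mono[OF _ that] by simp
    ultimately show ?thesis by simp
  qed
  have coercive: "\<bar>x j\<bar> \<le> C" if "j < k" "\<Phi> x \<le> \<Phi> y0" for x j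
  proof (rule ccontr)
    assume "\<not> ?thesis"
    then have x: "C < \<bar>x j\<bar>" by simp
    have "t * (\<Sum>j<k. (x j)\<^sup>2 - \<bar>x j\<bar>) \<le> t * m"
      using lower[of x] upper pen[of x] that(2) by linarith
    then have "(\<Sum>j<k. (x j)\<^sup>2 - \<bar>x j\<bar>) \<le> m" using t(1) by simp
    moreover have "(\<Sum>j<k. (x j)\<^sup>2 - \<bar>x j\<bar>) = (x j)\<^sup>2 - \<bar>x j\<bar> + (\<Sum>j\<in>{..<k} - {j}. (x j)\<^sup>2 - \<bar>x j\<bar>)"
      using that(1) by (intro sum.remove) auto
    ultimately have "(x j)\<^sup>2 - \<bar>x j\<bar> \<le> m + k" using sum_ge[of "{..<k} - {j}" x] by simp
    moreover have "1 * (C - 1) < \<bar>x j\<bar> * (\<bar>x j\<bar> - 1)"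
      using x C by (intro mult_le_less_imp_less) auto
    moreover have "\<bar>x j\<bar> * (\<bar>x j\<bar> - 1) = (x j)\<^sup>2 - \<bar>x j\<bar>"
      by (simp add: right_diff_distrib power2_eq_square)
    ultimately show False by (simp add: C_def)
  qed
  have cont: "continuous_on UNIV \<Phi>"
    unfolding \<Phi>_def[abs_def] pen_def g_def quad_def
    by (intro continuous_intros continuous_on_product_coordinates)
  obtain x where x: "\<Phi> x \<le> \<Phi> y0" and min: "\<And>j u. j < k \<Longrightarrow> \<Phi> x \<le> \<Phi> (x(j := u))"
  proof (rule coordinatewise_minimum[OF cont, of k y0 C])
    show "\<bar>y0 i\<bar> \<le> C" if "i < k" for i using coercive[OF that] by simp
    show "y0 i = 0" if "i \<ge> k" for i using that by (simp add: y0_def)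
  qed (use coercive in blast)+
  \<comment> \<open>Only violated constraints contribute to the gradient, and for them
    \<open>max 0 (1 - g i x)\<close> is the polynomial \<open>1 - g i x\<close>. With
    \<open>J\<close> frozen, \<open>crit\<close> is a polynomial in all of \<open>z\<close>.\<close>
  define J where "J = {i \<in> I. g i x < 1}"
  define crit where "crit j z = 2 * (z k * z j) - 2 * (\<Sum>i\<in>J. (1 - g i z) * quad_deriv k (M i) (l i) j z)" for j and z :: "nat \<Rightarrow> real"
  define z where "z = x(k := t)"
  have critical: "crit j z = \<tau> j" if j: "j < k" for j
  proof -
    have "((\<lambda>u. \<Phi> (x(j := u))) has_real_derivative
        t * (\<Sum>a<k. 2 * x a * (if a = j then 1 else 0))
        + (\<Sum>i\<in>I. 2 * max 0 (1 - g i x) * (0 - quad_deriv k (M i) (l i) j x))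
        - (\<Sum>a<k. \<tau> a * (if a = j then 1 else 0))) (at (x j))"
    proof -
      have 1: "((\<lambda>u. (max 0 (1 - g i (x(j := u))))\<^sup>2) has_real_derivative
          2 * max 0 (1 - g i x) * (0 - quad_deriv k (M i) (l i) j x)) (at (x j))" for i
      proof -
        have "((\<lambda>u. 1 - g i (x(j := u))) has_real_derivative 0 - quad_deriv k (M i) (l i) j x) (at (x j))"
          unfolding g_def by (intro DERIV_diff DERIV_const DERIV_quad j)
        moreover have "((\<lambda>u. (max 0 u)\<^sup>2) has_real_derivative 2 * max 0 (1 - g i x)) (at (1 - g i (x(j := x j))))"
          using DERIV_max_0_square[of "1 - g i x"] by simp
        ultimately show ?thesis by (rule DERIV_chain2[rotated])
      qed
      have 2: "((\<lambda>u. ((x(j := u)) a)\<^sup>2) has_real_derivative 2 * x a * (if a = j then 1 else 0)) (at (x j))" for a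
        by (cases "a = j") (auto intro!: derivative_eq_intros)
      have 3: "((\<lambda>u. \<tau> a * (x(j := u)) a) has_real_derivative \<tau> a * (if a = j then 1 else 0)) (at (x j))" for a
        by (cases "a = j") (auto intro!: derivative_eq_intros)
      show ?thesis unfolding \<Phi>_def pen_def
        by (intro DERIV_diff DERIV_add DERIV_cmult DERIV_sum 1 2 3)
    qed
    then have "t * (\<Sum>a<k. 2 * x a * (if a = j then 1 else 0))
        + (\<Sum>i\<in>I. 2 * max 0 (1 - g i x) * (0 - quad_deriv k (M i) (l i) j x))
        - (\<Sum>a<k. \<tau> a * (if a = j then 1 else 0)) = 0"
      by (rule DERIV_local_min[of _ _ _ 1]) (use min[OF j] in auto)
    moreover have "(\<Sum>a<k. 2 * x a * (if a = j then 1 else 0)) = (\<Sum>a<k. if a = j then 2 * x a else 0)"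
      by (intro sum.cong) auto
    then have "(\<Sum>a<k. 2 * x a * (if a = j then 1 else 0)) = 2 * x j" using j by simp
    moreover have "(\<Sum>a<k. \<tau> a * (if a = j then 1 else 0)) = (\<Sum>a<k. if a = j then \<tau> a else 0)"
      by (intro sum.cong) auto
    then have "(\<Sum>a<k. \<tau> a * (if a = j then 1 else 0)) = \<tau> j" using j by simp
    moreover have "(\<Sum>i\<in>I. 2 * max 0 (1 - g i x) * (0 - quad_deriv k (M i) (l i) j x))
        = (\<Sum>i\<in>J. 2 * max 0 (1 - g i x) * (0 - quad_deriv k (M i) (l i) j x))"
      using fin by (intro sum.mono_neutral_right) (auto simp: J_def)
    moreover have "\<dots> = - 2 * (\<Sum>i\<in>J. (1 - g i x) * quad_deriv k (M i) (l i) j x)"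
      unfolding sum_distrib_left by (intro sum.cong) (auto simp: J_def)
    moreover have "(\<Sum>i\<in>J. (1 - g i z) * quad_deriv k (M i) (l i) j z) = (\<Sum>i\<in>J. (1 - g i x) * quad_deriv k (M i) (l i) j x)"
      unfolding g_def z_def
      by (intro sum.cong arg_cong2[of _ _ _ _ "(*)"] arg_cong2[of _ _ _ _ "(-)"] quad_cong quad_deriv_cong) auto
    ultimately show ?thesis using j by (simp add: crit_def z_def)
  qed
  have bound: "\<bar>x j\<bar> \<le> real H + 1" if j: "j < k" for j
  proof -
    \<comment> \<open>Order of the values at \<open>z\<close>: the coordinate to be bounded, then
      \<open>t\<close>, then the derivatives with values \<open>\<tau> 0\<close>,
      \<open>\<tau> 1\<close>, and so on, as \<open>perturbed_root_bound\<close> expects.\<close>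
    define f where "f i = (if i = 0 then (\<lambda>z. z j) else if i = 1 then (\<lambda>z. z k) else crit (i - 2))" for i :: nat
    have B: "B \<ge> 1" by (simp add: B_def norm_bound_def)
    have "intpoly N 3 B (f i)" if iN: "i \<le> N" for i
    proof -
      consider "i = 0" | "i = 1" | "i \<ge> 2" "i - 2 < k" using iN j unfolding N_def by linarith
      then show ?thesis
      proof cases
        case 3
        have "intpoly (Suc k) 3 (norm_bound k (card I)) (crit (i - 2))"
          unfolding crit_def[abs_def] g_def using 3 M l fin by (intro intpoly_critical) (auto simp: J_def)
        then show ?thesis using 3 by (simp add: f_def N_def B_def)
      qed (use intpoly_mono[OF intpoly_var[of j N], of 3 B] intpoly_mono[OF intpoly_var[of k N], of 3 B] j B in
          \<open>auto simp: f_def N_def\<close>)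
    qed
    then obtain c where c: "\<exists>a\<in>expo (Suc N) D. c a \<noteq> 0" "\<And>a. \<bar>c a\<bar> \<le> int H"
      "\<And>x. (\<Sum>a\<in>expo (Suc N) D. of_int (c a) * (\<Prod>i\<le>N. f i x ^ a i)) = 0"
      using integer_relation[of 3 B N f] B unfolding H_def D_def by auto
    show ?thesis
    proof (rule perturbed_root_bound[where y = "\<lambda>i. f i z", OF c(1,2) _ _ c(3)])
      show "f 0 z = x j" using j by (simp add: f_def z_def)
      show "f (Suc i) z = t ^ (Suc D ^ i)" if "i < N" for i
      proof (cases i)
        case (Suc i')
        then show ?thesis using that critical[of i'] by (simp add: f_def N_def \<tau>_def)
      qed (simp add: f_def z_def)
      show "\<bar>x j\<bar> \<le> C" using coercive[OF j x] .
      show "real (card (expo (Suc N) D) * H) * C ^ D * t < 1" using t(3) by (simp add: E_def)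
    qed (use t C in auto)
  qed
  show thesis
  proof
    show "\<bar>x j\<bar> \<le> real (coord_bound k (card I)) + 1" if "j < k" for j using bound[OF that] by (simp add: H)
    fix i assume i: "i \<in> I"
    have "pen x \<le> t * (m + k)"
      using lower[of x] x upper mult_left_mono[OF sum_ge[of "{..<k}" x], of t] t(1) by (simp add: algebra_simps)
    moreover have "(max 0 (1 - g i x))\<^sup>2 \<le> pen x"
      unfolding pen_def using i fin by (intro member_le_sum) auto
    ultimately have "(max 0 (1 - g i x))\<^sup>2 \<le> (1 / 2)\<^sup>2" using t(4) by (simp add: power2_eq_square)
    then have "max 0 (1 - g i x) \<le> 1 / 2" by (rule power2_le_imp_le) simp
    then have "1 - g i x \<le> 1 / 2" by (rule order.trans[OF max.cobounded2])
    then show "quad k (M i) (l i) x \<ge> 1/2" by (simp add: g_def)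
  qed
qed

section \<open>Integer realizations of bounded size\<close>

definition disk_form :: "real ^ 2 \<Rightarrow> real \<Rightarrow> real ^ 2 \<Rightarrow> real \<Rightarrow> real" where
  "disk_form a r b s = (r + s)\<^sup>2 - (a $ 1 - b $ 1)\<^sup>2 - (a $ 2 - b $ 2)\<^sup>2"

lemma disk_form_dist: "disk_form a r b s = (r + s)\<^sup>2 - (dist a b)\<^sup>2"
  by (simp add: disk_form_def dist_vec_def L2_set_def sum_2 dist_real_def sum_nonneg)

lemma balls_meet_iff:
  fixes a b :: "'a :: real_normed_vector"
  assumes "r > 0" "s > 0"
  shows "ball a r \<inter> ball b s \<noteq> {} \<longleftrightarrow> dist a b < r + s"
proof
  assume "ball a r \<inter> ball b s \<noteq> {}"
  then obtain x where "dist a x < r" "dist b x < s" by auto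
  then show "dist a b < r + s" using dist_triangle[of a b x] by (simp add: dist_commute)
next
  assume d: "dist a b < r + s"
  define x where "x = a + (r / (r + s)) *\<^sub>R (b - a)"
  have "dist a x = r / (r + s) * dist a b"
    using assms by (simp add: x_def dist_norm norm_minus_commute)
  also have "\<dots> < r" using mult_strict_left_mono[OF d, of r] assms by (simp add: field_simps)
  finally have 1: "dist a x < r" .
  have "b - x = (1 - r / (r + s)) *\<^sub>R (b - a)"
    by (simp add: x_def scaleR_left_diff_distrib)
  also have "1 - r / (r + s) = s / (r + s)" using assms by (simp add: field_simps)
  finally have "b - x = (s / (r + s)) *\<^sub>R (b - a)" .
  then have "dist b x = s / (r + s) * dist a b"
    using assms by (simp add: dist_norm norm_minus_commute)
  also have "\<dots> < s" using mult_strict_left_mono[OF d, of s] assms by (simp add: field_simps)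
  finally have "dist b x < s" .
  with 1 show "ball a r \<inter> ball b s \<noteq> {}" by auto
qed

lemma disks_meet_iff:
  assumes "r > 0" "s > 0"
  shows "ball a r \<inter> ball b s \<noteq> {} \<longleftrightarrow> disk_form a r b s > 0"
proof -
  have "(dist a b)\<^sup>2 < (r + s)\<^sup>2 \<longleftrightarrow> dist a b < r + s"
    using assms power_mono_iff[of "r + s" "dist a b" 2] by (simp add: not_le[symmetric])
  then show ?thesis unfolding balls_meet_iff[OF assms] disk_form_dist by simp
qed

lemma ball_subset_box:
  fixes c :: "real ^ 2"
  assumes "\<And>i. \<bar>c $ i\<bar> + r \<le> k"
  shows "ball c r \<subseteq> cbox (\<chi> i. - k) (\<chi> i. k)"
proof
  fix x assume "x \<in> ball c r"
  then have "norm (x - c) < r" by (simp add: dist_norm norm_minus_commute)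
  then have "\<bar>x $ i - c $ i\<bar> < r" for i
    using component_le_norm_cart[of "x - c" i] by simp
  then show "x \<in> cbox (\<chi> i. - k) (\<chi> i. k)"
    using assms unfolding mem_box_cart by (simp add: abs_less_iff abs_le_iff) (smt (verit))
qed

lemma finite_uniform_scale:
  fixes f :: "'a \<Rightarrow> real"
  assumes "finite S" "\<And>i. i \<in> S \<Longrightarrow> f i > 0"
  obtains c where "c \<ge> 1" "\<And>i. i \<in> S \<Longrightarrow> c * f i \<ge> 1"
proof
  let ?c = "1 + (\<Sum>i\<in>S. 1 / f i)"
  have nn: "1 / f i \<ge> 0" if "i \<in> S" for i using assms(2)[OF that] by simp
  show "?c \<ge> 1" using nn by (simp add: sum_nonneg)
  show "?c * f i \<ge> 1" if "i \<in> S" for i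
  proof -
    have "1 / f i \<le> ?c" using member_le_sum[of i S "\<lambda>i. 1 / f i"] assms(1) nn that by fastforce
    then show ?thesis using assms(2)[OF that] by (simp add: field_simps)
  qed
qed

text \<open>All radii shrink by the same small \<open>\<delta>\<close>. Overlap is an open condition
  and survives, while tangency, which disjoint open disks may show, becomes strict separation.
  Without a strict gap scaling could not produce a margin of 1.\<close>

lemma strict_disk_realization:
  fixes V :: "'v set" and c :: "'v \<Rightarrow> real ^ 2"
  assumes "finite V" "\<And>v. v \<in> V \<Longrightarrow> r v > 0"
  obtains s where "\<And>v. v \<in> V \<Longrightarrow> s v > 0"
    "\<And>u v. u \<in> V \<Longrightarrow> v \<in> V \<Longrightarrow> disk_form (c u) (r u) (c v) (r v) > 0 \<Longrightarrow> disk_form (c u) (s u) (c v) (s v) > 0"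
    "\<And>u v. u \<in> V \<Longrightarrow> v \<in> V \<Longrightarrow> disk_form (c u) (r u) (c v) (r v) \<le> 0 \<Longrightarrow> disk_form (c u) (s u) (c v) (s v) < 0"
proof -
  have "\<forall>\<^sub>F \<delta> in at_right (0::real). \<forall>v\<in>V. \<delta> < r v"
    using assms by (intro eventually_ball_finite ballI eventually_at_right_less[THEN eventually_mono]
      order_tendstoD(2)[OF tendsto_ident_at]) auto
  moreover have "\<forall>\<^sub>F \<delta> in at_right (0::real). \<forall>p\<in>V \<times> V. disk_form (c (fst p)) (r (fst p)) (c (snd p)) (r (snd p)) > 0 \<longrightarrow>
      disk_form (c (fst p)) (r (fst p) - \<delta>) (c (snd p)) (r (snd p) - \<delta>) > 0"
  proof (intro eventually_ball_finite ballI)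
    fix p
    have "((\<lambda>\<delta>. disk_form (c (fst p)) (r (fst p) - \<delta>) (c (snd p)) (r (snd p) - \<delta>)) \<longlongrightarrow>
       disk_form (c (fst p)) (r (fst p) - 0) (c (snd p)) (r (snd p) - 0)) (at_right 0)"
      unfolding disk_form_def by (intro tendsto_intros)
    then show "\<forall>\<^sub>F \<delta> in at_right (0::real). disk_form (c (fst p)) (r (fst p)) (c (snd p)) (r (snd p)) > 0 \<longrightarrow>
      disk_form (c (fst p)) (r (fst p) - \<delta>) (c (snd p)) (r (snd p) - \<delta>) > 0"
      by (cases "disk_form (c (fst p)) (r (fst p)) (c (snd p)) (r (snd p)) > 0") (auto dest: order_tendstoD(1))
  qed (use assms in auto)
  moreover have "\<forall>\<^sub>F \<delta> in at_right (0::real). \<delta> > 0"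
    by (rule eventually_at_right_less)
  ultimately have "\<forall>\<^sub>F \<delta> in at_right (0::real). (\<forall>v\<in>V. \<delta> < r v) \<and>
      (\<forall>p\<in>V \<times> V. disk_form (c (fst p)) (r (fst p)) (c (snd p)) (r (snd p)) > 0 \<longrightarrow>
      disk_form (c (fst p)) (r (fst p) - \<delta>) (c (snd p)) (r (snd p) - \<delta>) > 0) \<and> \<delta> > 0"
    by (intro eventually_conj)
  then obtain \<delta> where \<delta>: "\<And>v. v \<in> V \<Longrightarrow> \<delta> < r v" "\<delta> > 0"
    "\<And>u v. u \<in> V \<Longrightarrow> v \<in> V \<Longrightarrow> disk_form (c u) (r u) (c v) (r v) > 0 \<Longrightarrow> disk_form (c u) (r u - \<delta>) (c v) (r v - \<delta>) > 0"
    using eventually_happens'[OF trivial_limit_at_right_real] by fastforce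
  show thesis
  proof (rule that[of "\<lambda>v. r v - \<delta>"])
    fix u v assume uv: "u \<in> V" "v \<in> V" and le: "disk_form (c u) (r u) (c v) (r v) \<le> 0"
    have "(r u - \<delta> + (r v - \<delta>))\<^sup>2 < (r u + r v)\<^sup>2"
      using \<delta>(1)[OF uv(1)] \<delta>(1)[OF uv(2)] \<delta>(2) by (intro power_strict_mono) auto
    then show "disk_form (c u) (r u - \<delta>) (c v) (r v - \<delta>) < 0"
      using le by (simp add: disk_form_def)
  qed (use \<delta> in auto)
qed

text \<open>
  Disk \<open>i\<close> has centre \<open>(x (3 * i), x (3 * i + 1))\<close> and radius \<open>x (3 * i + 2)\<close>; \<open>disk_sel u v e s\<close> is the
  coefficient vector of \<open>x (3 * u + e) + s * x (3 * v + e)\<close>.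
\<close>

definition disk_sel :: "nat \<Rightarrow> nat \<Rightarrow> nat \<Rightarrow> int \<Rightarrow> nat \<Rightarrow> int" where
  "disk_sel u v e s a = (if a = 3 * u + e then 1 else 0) + (if a = 3 * v + e then s else 0)"

definition disk_M :: "int \<Rightarrow> nat \<Rightarrow> nat \<Rightarrow> nat \<Rightarrow> nat \<Rightarrow> int" where
  "disk_M \<sigma> u v a b = \<sigma> * (disk_sel u v 2 1 a * disk_sel u v 2 1 b
     - disk_sel u v 0 (-1) a * disk_sel u v 0 (-1) b - disk_sel u v 1 (-1) a * disk_sel u v 1 (-1) b)"

lemma sum_disk_sel:
  assumes "u < n" "v < n" "e < 3"
  shows "(\<Sum>a<3 * n. of_int (disk_sel u v e s a) * x a) = x (3 * u + e) + of_int s * (x (3 * v + e) :: real)"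
proof -
  have "(\<Sum>a<3 * n. of_int (disk_sel u v e s a) * x a)
      = (\<Sum>a<3 * n. if a = 3 * u + e then x a else 0) + (\<Sum>a<3 * n. if a = 3 * v + e then of_int s * x a else 0)"
    unfolding sum.distrib[symmetric] by (intro sum.cong) (auto simp: disk_sel_def distrib_right)
  moreover have "(\<Sum>a<3 * n. if a = 3 * u + e then x a else 0) = x (3 * u + e)"
    "(\<Sum>a<3 * n. if a = 3 * v + e then of_int s * x a else 0) = of_int s * x (3 * v + e)"
    using assms by simp_all
  ultimately show ?thesis by (simp only:)
qed

lemma quad_square:
  "(\<Sum>a<k. \<Sum>b<k. of_int (w a * w b) * (x a * x b)) = (\<Sum>a<k. of_int (w a) * (x a :: real))\<^sup>2"
  by (simp add: power2_eq_square sum_product mult_ac)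

lemma quad_disk_M:
  assumes "u < n" "v < n"
  shows "quad (3 * n) (disk_M \<sigma> u v) (\<lambda>_. 0) x = of_int \<sigma> * ((x (3 * u + 2) + x (3 * v + 2))\<^sup>2
    - (x (3 * u) - x (3 * v))\<^sup>2 - (x (3 * u + 1) - x (3 * v + 1))\<^sup>2)"
proof -
  have "quad (3 * n) (disk_M \<sigma> u v) (\<lambda>_. 0) x = of_int \<sigma> *
     ((\<Sum>a<3*n. \<Sum>b<3*n. of_int (disk_sel u v 2 1 a * disk_sel u v 2 1 b) * (x a * x b))
    - (\<Sum>a<3*n. \<Sum>b<3*n. of_int (disk_sel u v 0 (-1) a * disk_sel u v 0 (-1) b) * (x a * x b))
    - (\<Sum>a<3*n. \<Sum>b<3*n. of_int (disk_sel u v 1 (-1) a * disk_sel u v 1 (-1) b) * (x a * x b)))"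
    unfolding sum_subtractf[symmetric] sum_distrib_left quad_def
    by (simp add: disk_M_def algebra_simps)
  then show ?thesis
    unfolding quad_square using assms by (simp add: sum_disk_sel)
qed

lemma abs_disk_sel: "u \<noteq> v \<Longrightarrow> \<bar>s\<bar> = 1 \<Longrightarrow> \<bar>disk_sel u v e s a\<bar> = (if a = 3 * u + e \<or> a = 3 * v + e then 1 else 0)"
  by (auto simp: disk_sel_def)

text \<open>The three products live on different residues of \<open>a\<close> modulo 3, so at most
  one of them is nonzero at any entry.\<close>

lemma abs_disk_M:
  assumes "u \<noteq> v" "\<bar>\<sigma>\<bar> = 1"
  shows "\<bar>disk_M \<sigma> u v a b\<bar> \<le> 1"
proof -
  let ?p = "\<lambda>e s. disk_sel u v e s a * disk_sel u v e s b"
  have p: "\<bar>?p e s\<bar> \<le> (if a mod 3 = e then 1 else 0)" if "\<bar>s\<bar> = 1" "e < 3" for e s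
  proof -
    have "a mod 3 = e" if "a = 3 * u + e \<or> a = 3 * v + e" using that \<open>e < 3\<close> by auto
    then show ?thesis using assms that by (auto simp: abs_mult abs_disk_sel)
  qed
  have "\<bar>disk_M \<sigma> u v a b\<bar> = \<bar>?p 2 1 - ?p 0 (-1) - ?p 1 (-1)\<bar>"
    using assms by (simp add: disk_M_def abs_mult)
  also have "\<dots> \<le> \<bar>?p 2 1\<bar> + \<bar>?p 0 (-1)\<bar> + \<bar>?p 1 (-1)\<bar>" by linarith
  also have "\<dots> \<le> (if a mod 3 = 2 then 1 else 0) + (if a mod 3 = 0 then 1 else 0) + (if a mod 3 = 1 then 1 else 0)"
    by (intro add_mono p) auto
  also have "\<dots> \<le> 1" by auto
  finally show ?thesis .
qed

lemma square_rounding: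
  fixes A B K :: real
  assumes "\<bar>A - B\<bar> \<le> 2" "\<bar>B\<bar> \<le> K"
  shows "\<bar>A\<^sup>2 - B\<^sup>2\<bar> \<le> 4 * K + 4"
proof -
  have "\<bar>A\<^sup>2 - B\<^sup>2\<bar> = \<bar>A - B\<bar> * \<bar>A + B\<bar>"
    by (simp add: power2_eq_square algebra_simps flip: abs_mult)
  also have "\<dots> \<le> 2 * (2 * K + 2)"
    using assms by (intro mult_mono) linarith+
  finally show ?thesis by simp
qed

lemma integer_realization_bound:
  assumes "G \<in> DG n"
  obtains A where "integer_DG_realization A G"
    "\<And>v. v \<in> pverts G \<Longrightarrow> A v \<subseteq> cbox (\<chi> i. - real (202 * (coord_bound (3 * n) (n * n) + 1)\<^sup>2)) (\<chi> i. real (202 * (coord_bound (3 * n) (n * n) + 1)\<^sup>2))"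
proof -
  from assms obtain A0 where pg: "pair_graph G" and card: "card (pverts G) = n"
    and A0: "realizes A0 G" "\<And>v. v \<in> pverts G \<Longrightarrow> open_disk (A0 v)"
    by (auto simp: DG_def disk_graph_def)
  interpret pair_graph G by (rule pg)
  have fin: "finite (pverts G)" by (rule pair_finite_verts)
  have "\<forall>v\<in>pverts G. \<exists>p. snd p > 0 \<and> A0 v = ball (fst p) (snd p)"
    using A0(2) by (auto simp: open_disk_def)
  from bchoice[OF this] obtain p where p: "\<And>v. v \<in> pverts G \<Longrightarrow> snd (p v) > 0"
    "\<And>v. v \<in> pverts G \<Longrightarrow> A0 v = ball (fst (p v)) (snd (p v))" by auto
  define c where "c v = fst (p v)" for v
  obtain r where r: "\<And>v. v \<in> pverts G \<Longrightarrow> r v > 0"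
    "\<And>u v. u \<in> pverts G \<Longrightarrow> v \<in> pverts G \<Longrightarrow> A0 u \<inter> A0 v \<noteq> {} \<Longrightarrow> disk_form (c u) (r u) (c v) (r v) > 0"
    "\<And>u v. u \<in> pverts G \<Longrightarrow> v \<in> pverts G \<Longrightarrow> A0 u \<inter> A0 v = {} \<Longrightarrow> disk_form (c u) (r u) (c v) (r v) < 0"
  proof (rule strict_disk_realization[OF fin p(1), where c = c])
    fix s assume s: "\<And>v. v \<in> pverts G \<Longrightarrow> 0 < s v"
      "\<And>u v. u \<in> pverts G \<Longrightarrow> v \<in> pverts G \<Longrightarrow> 0 < disk_form (c u) (snd (p u)) (c v) (snd (p v)) \<Longrightarrow> 0 < disk_form (c u) (s u) (c v) (s v)"
      "\<And>u v. u \<in> pverts G \<Longrightarrow> v \<in> pverts G \<Longrightarrow> disk_form (c u) (snd (p u)) (c v) (snd (p v)) \<le> 0 \<Longrightarrow> disk_form (c u) (s u) (c v) (s v) < 0"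
    have "A0 u \<inter> A0 v \<noteq> {} \<longleftrightarrow> 0 < disk_form (c u) (snd (p u)) (c v) (snd (p v))"
      if "u \<in> pverts G" "v \<in> pverts G" for u v
      using disks_meet_iff[OF p(1)[OF that(1)] p(1)[OF that(2)]] p(2) that by (simp add: c_def)
    with s that[of s] show thesis by (metis not_less)
  qed
  obtain q where q: "bij_betw q {..<n} (pverts G)"
    using ex_bij_betw_nat_finite[OF fin] card by (auto simp: lessThan_atLeast0)
  have qV: "q i \<in> pverts G" if "i < n" for i using q that by (auto simp: bij_betw_def)
  define adj where "adj i j \<longleftrightarrow> A0 (q i) \<inter> A0 (q j) \<noteq> {}" for i j
  define \<sigma> where "\<sigma> i j = (if adj i j then 1 else - 1 :: int)" for i j
  define I where "I = {..<n} \<times> {..<n}"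
  \<comment> \<open>The diagonal pairs \<open>(i, i)\<close> are free to carry the linear constraint
    that radius \<open>i\<close> is positive; this makes \<open>n * n\<close> constraints in
    all.\<close>
  define M where "M = (\<lambda>(i, j). if i = j then (\<lambda>_ _. 0) else disk_M (\<sigma> i j) i j)"
  define l where "l = (\<lambda>(i :: nat, j). if i = j then (\<lambda>a. if a = 3 * i + 2 then 1 else 0 :: int) else (\<lambda>_. 0))"
  have quad_pair: "quad (3 * n) (M (i, j)) (l (i, j)) x = of_int (\<sigma> i j) * ((x (3 * i + 2) + x (3 * j + 2))\<^sup>2
    - (x (3 * i) - x (3 * j))\<^sup>2 - (x (3 * i + 1) - x (3 * j + 1))\<^sup>2)" if "i < n" "j < n" "i \<noteq> j" for i j x
    using that quad_disk_M by (simp add: M_def l_def)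
  have quad_diag: "quad (3 * n) (M (i, i)) (l (i, i)) x = x (3 * i + 2)" if "i < n" for i x
  proof -
    have "quad (3 * n) (M (i, i)) (l (i, i)) x = (\<Sum>a<3 * n. of_int (if a = 3 * i + 2 then 1 else 0) * x a)"
      unfolding quad_def M_def l_def by (simp del: of_int_eq_iff cong: if_cong)
    also have "\<dots> = (\<Sum>a<3 * n. if a = 3 * i + 2 then x a else 0)"
      by (intro sum.cong) auto
    finally show ?thesis using that by simp
  qed
  define y :: "nat \<Rightarrow> real" where "y a = (if a mod 3 = 0 then c (q (a div 3)) $ 1 else if a mod 3 = 1 then c (q (a div 3)) $ 2 else r (q (a div 3)))" for a
  have y: "y (3 * i) = c (q i) $ 1" "y (3 * i + 1) = c (q i) $ 2" "y (3 * i + 2) = r (q i)" for i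
  proof -
    have "(3 * i + e) mod 3 = e" "(3 * i + e) div 3 = i" if "e < 3" for e
      using that by simp_all
    from this[of 0] this[of 1] this[of 2]
    show "y (3 * i) = c (q i) $ 1" "y (3 * i + 1) = c (q i) $ 2" "y (3 * i + 2) = r (q i)"
      by (simp_all add: y_def)
  qed
  have pos: "quad (3 * n) (M p) (l p) y > 0" if pI: "p \<in> I" for p
  proof -
    obtain i j where ij: "p = (i, j)" "i < n" "j < n" using pI by (auto simp: I_def)
    show ?thesis
    proof (cases "i = j")
      case True
      then show ?thesis using ij quad_diag y r(1) qV by simp
    next
      case False
      have "quad (3 * n) (M p) (l p) y = of_int (\<sigma> i j) * disk_form (c (q i)) (r (q i)) (c (q j)) (r (q j))"
          using quad_pair[OF ij(2,3) False, of y] by (simp only: ij y disk_form_def)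
      then show ?thesis
        using r(2,3)[OF qV qV, OF ij(2,3)] by (auto simp: \<sigma>_def adj_def)
    qed
  qed
  \<comment> \<open>Scaling by \<open>s\<close> multiplies the radius constraints by
    \<open>s\<close> and the pair constraints by \<open>s\<^sup>2\<close>; with
    \<open>s \<ge> 1\<close> one factor serves both.\<close>
  have "finite I" by (simp add: I_def)
  then obtain s where s: "s \<ge> 1" "\<And>p. p \<in> I \<Longrightarrow> s * quad (3 * n) (M p) (l p) y \<ge> 1"
    by (rule finite_uniform_scale) (use pos in blast)+
  have feasible: "quad (3 * n) (M p) (l p) (\<lambda>a. s * y a) \<ge> 1" if pI: "p \<in> I" for p
  proof -
    obtain i j where ij: "p = (i, j)" "i < n" "j < n" using pI by (auto simp: I_def)
    show ?thesis
    proof (cases "i = j")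
      case True
      then show ?thesis using ij quad_diag s(2)[OF pI] by simp
    next
      case False
      have "quad (3 * n) (M p) (l p) (\<lambda>a. s * y a) = s * (s * quad (3 * n) (M p) (l p) y)"
        unfolding ij(1) quad_pair[OF ij(2,3) False] by (simp add: power2_eq_square algebra_simps)
      then show ?thesis using s(1) s(2)[OF pI] mult_mono[of 1 s 1] by simp
    qed
  qed
  have M: "\<bar>M p a b\<bar> \<le> 1" for p a b
    by (auto simp: M_def \<sigma>_def split: prod.split intro!: abs_disk_M)
  have l: "\<bar>l p a\<bar> \<le> 1" for p a
    by (auto simp: l_def split: prod.split)
  define K where "K = coord_bound (3 * n) (n * n) + 1"
  obtain x where x: "\<And>p. p \<in> I \<Longrightarrow> quad (3 * n) (M p) (l p) x \<ge> 1/2" "\<And>j. j < 3 * n \<Longrightarrow> \<bar>x j\<bar> \<le> K"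
  proof (rule bounded_quadratic_solution[of I M l "3 * n" "\<lambda>a. s * y a", OF \<open>finite I\<close> M l feasible])
    fix x assume "\<And>p. p \<in> I \<Longrightarrow> quad (3 * n) (M p) (l p) x \<ge> 1 / 2"
      "\<And>j. j < 3 * n \<Longrightarrow> \<bar>x j\<bar> \<le> real (coord_bound (3 * n) (card I)) + 1"
    then show thesis using that[of x] by (simp add: I_def K_def add.commute)
  qed
  \<comment> \<open>The factor 100 makes the scaled margin \<open>L\<^sup>2 / 2\<close> equal to
    \<open>50 * (L * K)\<close>, above the rounding error of the three squares, which is at most
    \<open>24 * (L * K) + 12\<close>.\<close>
  define L where "L = 100 * real K"
  have K: "real K \<ge> 1" by (simp add: K_def)
  define X where "X a = \<lfloor>L * x a\<rfloor>" for a
  have X: "\<bar>real_of_int (X a) - L * x a\<bar> \<le> 1" for a unfolding X_def by linarith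
  have LK: "\<bar>L * x a\<bar> \<le> L * K" if "a < 3 * n" for a
    using x(2)[OF that] K by (simp add: L_def abs_mult)
  define C :: "nat \<Rightarrow> real ^ 2" where "C i = (\<chi> e. if e = 1 then real_of_int (X (3 * i)) else real_of_int (X (3 * i + 1)))" for i
  define R where "R i = real_of_int (X (3 * i + 2))" for i
  have C: "C i $ 1 = X (3 * i)" "C i $ 2 = X (3 * i + 1)" for i by (simp_all add: C_def)
  have R: "R i > 0" if "i < n" for i
  proof -
    have "x (3 * i + 2) \<ge> 1 / 2" using x(1)[of "(i, i)"] quad_diag[OF that] that by (simp add: I_def)
    then have "L * x (3 * i + 2) \<ge> L * (1 / 2)" using K by (intro mult_left_mono) (auto simp: L_def)
    then show ?thesis using X[of "3 * i + 2"] K unfolding R_def L_def by linarith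
  qed
  have form: "(disk_form (C i) (R i) (C j) (R j) > 0) = adj i j" if ij: "i < n" "j < n" "i \<noteq> j" for i j
  proof -
    have lt: "3 * i + e < 3 * n" "3 * j + e < 3 * n" if "e < 3" for e using ij that by auto
    define a1 a2 a3 where a: "a1 = L * x (3 * i + 2) + L * x (3 * j + 2)"
      "a2 = L * x (3 * i) - L * x (3 * j)" "a3 = L * x (3 * i + 1) - L * x (3 * j + 1)"
    have 1: "\<bar>(R i + R j)\<^sup>2 - a1\<^sup>2\<bar> \<le> 4 * (2 * (L * K)) + 4"
      using X[of "3 * i + 2"] X[of "3 * j + 2"] LK[OF lt(1)[of 2]] LK[OF lt(2)[of 2]]
      by (intro square_rounding) (auto simp: a R_def)
    have 2: "\<bar>(C i $ 1 - C j $ 1)\<^sup>2 - a2\<^sup>2\<bar> \<le> 4 * (2 * (L * K)) + 4"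
      using X[of "3 * i"] X[of "3 * j"] LK[OF lt(1)[of 0]] LK[OF lt(2)[of 0]]
      by (intro square_rounding) (auto simp: a C)
    have 3: "\<bar>(C i $ 2 - C j $ 2)\<^sup>2 - a3\<^sup>2\<bar> \<le> 4 * (2 * (L * K)) + 4"
      using X[of "3 * i + 1"] X[of "3 * j + 1"] LK[OF lt(1)[of 1]] LK[OF lt(2)[of 1]]
      by (intro square_rounding) (auto simp: a C)
    have "1 / 2 \<le> of_int (\<sigma> i j) * ((x (3 * i + 2) + x (3 * j + 2))\<^sup>2
      - (x (3 * i) - x (3 * j))\<^sup>2 - (x (3 * i + 1) - x (3 * j + 1))\<^sup>2)"
      using x(1)[of "(i, j)"] ij quad_pair[OF ij] by (simp add: I_def)
    from mult_left_mono[OF this, of "L\<^sup>2"]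
    have "L\<^sup>2 / 2 \<le> of_int (\<sigma> i j) * (a1\<^sup>2 - a2\<^sup>2 - a3\<^sup>2)"
      by (simp add: a power2_eq_square algebra_simps)
    moreover have "L\<^sup>2 / 2 = 50 * (L * K)" by (simp add: L_def power2_eq_square)
    moreover have "L * K \<ge> 100" using K mult_mono[of 1 "real K" 1 "real K"] by (simp add: L_def)
    ultimately show ?thesis
      using 1 2 3 unfolding \<sigma>_def disk_form_def by (simp split: if_splits)
  qed
  define A where "A v = ball (C (inv_into {..<n} q v)) (R (inv_into {..<n} q v))" for v
  have inv: "inv_into {..<n} q v < n" "q (inv_into {..<n} q v) = v" if "v \<in> pverts G" for v
    using that q inv_into_into[of v q "{..<n}"] by (auto simp: bij_betw_def f_inv_into_f)
  have meet: "A u \<inter> A v \<noteq> {} \<longleftrightarrow> A0 u \<inter> A0 v \<noteq> {}" if uv: "u \<in> pverts G" "v \<in> pverts G" "u \<noteq> v" for u v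
  proof -
    let ?i = "inv_into {..<n} q u" and ?j = "inv_into {..<n} q v"
    have "?i \<noteq> ?j" using inv(2) uv by metis
    then have "A u \<inter> A v \<noteq> {} \<longleftrightarrow> adj ?i ?j"
      unfolding A_def using disks_meet_iff R inv(1) uv form by simp
    then show ?thesis using inv(2) uv by (simp add: adj_def)
  qed
  have "realizes A G"
  proof -
    have "intersection_graph (pverts G) A = intersection_graph (pverts G) A0"
      unfolding intersection_graph_def using meet by auto
    then show ?thesis using A0(1) by (simp add: realizes_def)
  qed
  moreover have "integer_open_disk (A v)" if "v \<in> pverts G" for v
    unfolding integer_open_disk_def A_def using R[OF inv(1)[OF that]]
    by (intro exI conjI) (auto simp: C_def R_def)
  ultimately have 1: "integer_DG_realization A G" by (simp add: integer_DG_realization_def)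
  have "A v \<subseteq> cbox (\<chi> i. - real (202 * K\<^sup>2)) (\<chi> i. real (202 * K\<^sup>2))" if "v \<in> pverts G" for v
    unfolding A_def
  proof (rule ball_subset_box)
    fix e
    let ?i = "inv_into {..<n} q v"
    have lt: "3 * ?i + e < 3 * n" if "e < 3" for e using inv(1)[OF \<open>v \<in> pverts G\<close>] that by linarith
    have b: "\<bar>real_of_int (X a)\<bar> \<le> L * K + 1" if "a < 3 * n" for a
      using X[of a] LK[OF that] by linarith
    have "\<bar>C ?i $ e\<bar> \<le> L * K + 1" using b[OF lt[of 0]] b[OF lt[of 1]] by (simp add: C_def)
    moreover have "R ?i \<le> L * K + 1" using b[OF lt[of 2]] by (simp add: R_def)
    ultimately have "\<bar>C ?i $ e\<bar> + R ?i \<le> 2 * (L * K + 1)" by simp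
    also have "\<dots> \<le> real (202 * K\<^sup>2)"
      using K mult_mono[of 1 "real K" 1 "real K"] by (simp add: L_def power2_eq_square)
    finally show "\<bar>C ?i $ e\<bar> + R ?i \<le> real (202 * K\<^sup>2)" .
  qed
  with 1 show thesis using that by (simp add: K_def)
qed

section \<open>Numerical form of the upper bound\<close>

lemma f_DG_graph_le:
  assumes "G \<in> DG n"
  shows "f_DG_graph G \<le> 202 * (coord_bound (3 * n) (n * n) + 1)\<^sup>2"
proof -
  obtain A where A: "integer_DG_realization A G"
    "\<And>v. v \<in> pverts G \<Longrightarrow> A v \<subseteq> cbox (\<chi> i. - real (202 * (coord_bound (3 * n) (n * n) + 1)\<^sup>2)) (\<chi> i. real (202 * (coord_bound (3 * n) (n * n) + 1)\<^sup>2))"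
    using integer_realization_bound[OF assms] by blast
  have "f_DG_graph G \<le> box_size (A ` pverts G)"
    unfolding f_DG_graph_def using A(1) by (intro Least_le) blast
  also have "\<dots> \<le> 202 * (coord_bound (3 * n) (n * n) + 1)\<^sup>2"
    unfolding box_size_def by (rule Least_le) (use A(2) in blast)
  finally show ?thesis .
qed

text \<open>The term \<open>3 ^ (3 * n + 1)\<close> in \<open>D\<close> dominates; estimated by a
  power of 4 it leads to \<open>2 ^ (8 * n + 13)\<close> for the whole exponent. The 21 is
  \<open>8 + 13\<close>, which absorbs the constant already at \<open>n = 1\<close>.\<close>

lemma coord_bound_double_exp:
  assumes n: "n \<ge> 1"
  shows "202 * (coord_bound (3 * n) (n * n) + 1)\<^sup>2 \<le> 2 ^ (2 ^ (21 * n))"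
proof -
  define D where "D = 2 * (3 * n + 2) * 3 ^ (3 * n + 1)"
  define b where "b = norm_bound (3 * n) (n * n)"
  define P where "P = (2 :: nat) ^ n"
  have P: "n \<le> P" "n \<le> 2 ^ n" unfolding P_def by (simp_all add: less_imp_le)
  have P2: "2 ^ (n + 2) = 4 * P" "2 ^ (n + 3) = 8 * P" "2 ^ (n + 4) = 16 * P" "2 ^ (n + 5) = 32 * P"
    by (simp_all add: P_def power_add)
  have b: "b \<le> 2 ^ (5 * n + 12)"
  proof -
    have k: "3 * n \<le> 2 ^ (n + 2)" unfolding P2 using P by linarith
    have one: "1 \<le> 3 * n" using n by simp
    have "3 * n \<le> 3 * n * (3 * n)" by (rule le_square)
    with one have "1 + (3 * n * (3 * n) + 3 * n) \<le> 4 * (3 * n * (3 * n))" by linarith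
    also have "\<dots> \<le> 4 * (2 ^ (n + 2) * 2 ^ (n + 2))" using k by (intro mult_le_mono) auto
    also have "\<dots> = 2 ^ (2 + ((n + 2) + (n + 2)))" by (simp add: power_add)
    also have "2 + ((n + 2) + (n + 2)) = 2 * n + 6" by simp
    finally have 1: "1 + (3 * n * (3 * n) + 3 * n) \<le> 2 ^ (2 * n + 6)" .
    have 2: "2 * (3 * n) + 1 \<le> 2 ^ (n + 4)" unfolding P2 using P n by linarith
    have 3: "n * n \<le> 2 ^ (2 * n)" using mult_le_mono[OF P(2) P(2)] by (simp add: mult_2 power_add)
    have "2 * (n * n * ((1 + (3 * n * (3 * n) + 3 * n)) * (2 * (3 * n) + 1))) \<le> 2 * (2 ^ (2 * n) * (2 ^ (2 * n + 6) * 2 ^ (n + 4)))"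
      by (intro mult_le_mono order.refl 1 2 3)
    also have "\<dots> = 2 ^ (1 + (2 * n + (2 * n + 6 + (n + 4))))" by (simp only: power_add power_one_right)
    also have "1 + (2 * n + (2 * n + 6 + (n + 4))) = 5 * n + 11" by simp
    finally have "b \<le> 2 + 2 ^ (5 * n + 11)" by (simp add: b_def norm_bound_def)
    moreover have "2 \<le> (2 :: nat) ^ (5 * n + 11)" using power_increasing[of 1 "5 * n + 11" "2 :: nat"] by simp
    moreover have "(2 :: nat) ^ (5 * n + 12) = 2 ^ (5 * n + 11) + 2 ^ (5 * n + 11)" by (simp add: power_add)
    ultimately show ?thesis by linarith
  qed
  have D: "D \<le> 2 ^ (7 * n + 6)"
  proof -
    have "3 * n + 2 \<le> 2 ^ (n + 3)" unfolding P2 using P n by linarith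
    moreover have "(3 :: nat) ^ (3 * n + 1) \<le> 4 ^ (3 * n + 1)" by (intro power_mono) auto
    then have "(3 :: nat) ^ (3 * n + 1) \<le> 2 ^ (2 * (3 * n + 1))" by (simp only: power_mult) simp
    ultimately have "D \<le> 2 * 2 ^ (n + 3) * 2 ^ (2 * (3 * n + 1))" unfolding D_def by (intro mult_le_mono) auto
    also have "\<dots> = 2 ^ (1 + (n + 3) + 2 * (3 * n + 1))" by (simp only: power_add power_one_right)
    also have "1 + (n + 3) + 2 * (3 * n + 1) = 7 * n + 6" by simp
    finally show ?thesis .
  qed
  have "coord_bound (3 * n) (n * n) = 2 * ((D + (3 * n + 2)) choose (3 * n + 2)) * b ^ D"
    by (simp add: coord_bound_def Let_def D_def b_def card_expo)
  also have "\<dots> \<le> 2 * 2 ^ (D + (3 * n + 2)) * (2 ^ (5 * n + 12)) ^ D"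
    using b by (intro mult_le_mono order.refl binomial_le_pow2 power_mono) auto
  also have "\<dots> = 2 ^ (1 + (D + (3 * n + 2)) + (5 * n + 12) * D)"
    by (simp only: power_add power_mult power_one_right)
  also have "1 + (D + (3 * n + 2)) + (5 * n + 12) * D = 3 + 3 * n + (5 * n + 13) * D"
    by (simp add: algebra_simps)
  finally have cb: "coord_bound (3 * n) (n * n) \<le> 2 ^ (3 + 3 * n + (5 * n + 13) * D)" (is "_ \<le> 2 ^ ?e") .
  have "(coord_bound (3 * n) (n * n) + 1)\<^sup>2 \<le> (2 ^ ?e + 2 ^ ?e)\<^sup>2"
    using cb by (intro power_mono add_mono) auto
  also have "2 ^ ?e + 2 ^ ?e = (2 :: nat) ^ (?e + 1)"
    by (simp only: Suc_eq_plus1[symmetric] power_Suc mult_2)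
  also have "(2 ^ (?e + 1))\<^sup>2 = (2 :: nat) ^ (2 * (?e + 1))"
    by (simp only: power_mult[symmetric] mult.commute)
  finally have "202 * (coord_bound (3 * n) (n * n) + 1)\<^sup>2 \<le> 2 ^ 8 * 2 ^ (2 * (?e + 1))"
    by (intro mult_le_mono) auto
  also have "\<dots> = 2 ^ (8 + 2 * (?e + 1))" by (simp only: power_add)
  also have "\<dots> \<le> 2 ^ (2 ^ (21 * n))"
  proof (intro power_increasing)
    have "2 * ((5 * n + 13) * D) \<le> 2 * (2 ^ (n + 5) * 2 ^ (7 * n + 6))"
    proof (intro mult_le_mono D order.refl)
      show "5 * n + 13 \<le> 2 ^ (n + 5)" unfolding P2 using P n by linarith
    qed
    also have "\<dots> = 2 ^ (1 + (n + 5 + (7 * n + 6)))" by (simp only: power_add power_one_right)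
    also have "1 + (n + 5 + (7 * n + 6)) = 8 * n + 12" by simp
    finally have 1: "2 * ((5 * n + 13) * D) \<le> 2 ^ (8 * n + 12)" .
    have "16 + 6 * n \<le> 2 ^ (n + 5)" unfolding P2 using P n by linarith
    also have "\<dots> \<le> 2 ^ (8 * n + 12)" by (intro power_increasing) auto
    finally have 2: "16 + 6 * n \<le> 2 ^ (8 * n + 12)" .
    have "8 + 2 * (3 + 3 * n + x + 1) \<le> y + y" if "16 + 6 * n \<le> y" "2 * x \<le> y" for x y :: nat
      using add_mono[OF that] by simp
    from this[OF 2 1] have "8 + 2 * (?e + 1) \<le> 2 ^ (8 * n + 12) + 2 ^ (8 * n + 12)" .
    also have "\<dots> = 2 ^ (8 * n + 13)" by (simp add: power_add)
    also have "\<dots> \<le> 2 ^ (21 * n)" using n by (intro power_increasing) auto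
    finally show "8 + 2 * (?e + 1) \<le> 2 ^ (21 * n)" .
  qed auto
  finally show ?thesis .
qed

section \<open>Disks from planar lines\<close>

definition pt :: "real \<Rightarrow> real \<Rightarrow> real ^ 2" where
  "pt x y = (\<chi> i. if i = 1 then x else y)"

lemma pt_nth [simp]: "pt x y $ 1 = x" "pt x y $ 2 = y"
  by (simp_all add: pt_def)

text \<open>
  The point \<open>(x, y)\<close> becomes the unit disk with centre \<open>(\<epsilon>\<^sup>2 x, \<epsilon>\<^sup>3 y)\<close>, and a disk of radius \<open>R\<close> is placed
  almost tangent to these unit disks. With this anisotropic scaling the curvature contributes only at
  order \<open>\<epsilon>\<^sup>4\<close>, whereas \<open>y - m x - b\<close> appears at order \<open>\<epsilon>\<^sup>3\<close>.
\<close>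

definition side_centre :: "real \<Rightarrow> real \<Rightarrow> real \<Rightarrow> real \<Rightarrow> real \<Rightarrow> real ^ 2" where
  "side_centre \<epsilon> s m b R =
     pt (- s * \<epsilon> * (1 + R) * m) (s * (1 + R) + \<epsilon>\<^sup>2 * (- s * (1 + R) * m\<^sup>2 / 2 + \<epsilon> * b))"

text \<open>After scaling, the line has slope \<open>\<epsilon> * m\<close> and passes through
  \<open>(0, \<epsilon> ^ 3 * b)\<close>. The centre is this point plus \<open>s * (1 + R)\<close>
  times \<open>(- \<epsilon> * m, 1 - \<epsilon>\<^sup>2 * m\<^sup>2 / 2)\<close>, the unit normal
  up to second order, so that all terms below order \<open>\<epsilon> ^ 3\<close> cancel.\<close>

lemma disk_form_side:
  assumes "\<bar>s\<bar> = 1"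
  shows "disk_form (side_centre \<epsilon> s m b R) R (pt (\<epsilon>\<^sup>2 * x) (\<epsilon> ^ 3 * y)) 1 =
    \<epsilon> ^ 3 * (2 * (1 + R) * (s * (y - m * x - b)) -
      \<epsilon> * (x\<^sup>2 + \<epsilon>\<^sup>2 * y\<^sup>2 - 2 * y * \<epsilon> * (- s * (1 + R) * m\<^sup>2 / 2 + \<epsilon> * b) + (- s * (1 + R) * m\<^sup>2 / 2 + \<epsilon> * b)\<^sup>2))"
proof -
  have "s = 1 \<or> s = - 1" using assms by linarith
  then show ?thesis
    by (elim disjE) (simp_all add: disk_form_def side_centre_def power2_eq_square power3_eq_cube field_simps)
qed

lemma eventually_side:
  assumes "\<bar>s\<bar> = 1" "R > 0" "s * (y - m * x - b) \<noteq> 0"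
  shows "\<forall>\<^sub>F \<epsilon> in at_right 0. sgn (disk_form (side_centre \<epsilon> s m b R) R (pt (\<epsilon>\<^sup>2 * x) (\<epsilon> ^ 3 * y)) 1) = sgn (s * (y - m * x - b))"
proof -
  let ?g = "\<lambda>\<epsilon>. 2 * (1 + R) * (s * (y - m * x - b)) -
      \<epsilon> * (x\<^sup>2 + \<epsilon>\<^sup>2 * y\<^sup>2 - 2 * y * \<epsilon> * (- s * (1 + R) * m\<^sup>2 / 2 + \<epsilon> * b) + (- s * (1 + R) * m\<^sup>2 / 2 + \<epsilon> * b)\<^sup>2)"
  have "(?g \<longlongrightarrow> ?g 0) (at_right 0)" by (intro tendsto_intros)
  then have lim: "(?g \<longlongrightarrow> 2 * (1 + R) * (s * (y - m * x - b))) (at_right 0)" by simp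
  have "\<forall>\<^sub>F \<epsilon> in at_right 0. sgn (?g \<epsilon>) = sgn (s * (y - m * x - b))"
  proof (cases "s * (y - m * x - b) > 0")
    case True
    then have "2 * (1 + R) * (s * (y - m * x - b)) > 0" using assms(2) by simp
    from order_tendstoD(1)[OF lim this] show ?thesis
      by (rule eventually_mono) (use True in simp)
  next
    case False
    then have neg: "s * (y - m * x - b) < 0" using assms(3) by (meson linorder_cases)
    then have "2 * (1 + R) * (s * (y - m * x - b)) < 0" using assms(2) by (simp add: mult_pos_neg)
    from order_tendstoD(2)[OF lim this] show ?thesis
      by (rule eventually_mono) (use neg in simp)
  qed
  then show ?thesis
    using eventually_at_right_less[of 0]
    by eventually_elim (simp only: disk_form_side[OF assms(1)] sgn_mult, simp)
qed

text \<open>For \<open>\<epsilon>\<close> tending to 0 the centre tends to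
  \<open>(0, s * (1 + R))\<close> whatever the line is. So the meeting with a fixed disk depends on
  \<open>R\<close> alone.\<close>

lemma eventually_side_fixed:
  assumes s: "\<bar>s\<bar> = 1" and nz: "(r + R)\<^sup>2 - a\<^sup>2 - (1 + R)\<^sup>2 \<noteq> 0"
  shows "\<forall>\<^sub>F \<epsilon> in at_right 0. sgn (disk_form (side_centre \<epsilon> s m b R) R (pt a 0) r) = sgn ((r + R)\<^sup>2 - a\<^sup>2 - (1 + R)\<^sup>2)"
proof -
  let ?g = "\<lambda>\<epsilon>. disk_form (side_centre \<epsilon> s m b R) R (pt a 0) r"
  have "?g = (\<lambda>\<epsilon>. (R + r)\<^sup>2 - (- s * \<epsilon> * (1 + R) * m - a)\<^sup>2 -
      (s * (1 + R) + \<epsilon>\<^sup>2 * (- s * (1 + R) * m\<^sup>2 / 2 + \<epsilon> * b))\<^sup>2)"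
    by (simp add: disk_form_def side_centre_def)
  moreover have "((\<lambda>\<epsilon>. (R + r)\<^sup>2 - (- s * \<epsilon> * (1 + R) * m - a)\<^sup>2 -
      (s * (1 + R) + \<epsilon>\<^sup>2 * (- s * (1 + R) * m\<^sup>2 / 2 + \<epsilon> * b))\<^sup>2) \<longlongrightarrow>
      (R + r)\<^sup>2 - (- s * 0 * (1 + R) * m - a)\<^sup>2 -
      (s * (1 + R) + 0\<^sup>2 * (- s * (1 + R) * m\<^sup>2 / 2 + 0 * b))\<^sup>2) (at_right 0)"
    by (intro tendsto_intros)
  moreover have "s\<^sup>2 = 1" using s by (simp add: power2_eq_1_iff abs_eq_iff')
  ultimately have lim: "(?g \<longlongrightarrow> (r + R)\<^sup>2 - a\<^sup>2 - (1 + R)\<^sup>2) (at_right 0)"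
    by (simp add: power_mult_distrib add.commute)
  show ?thesis
  proof (cases "(r + R)\<^sup>2 - a\<^sup>2 - (1 + R)\<^sup>2 > 0")
    case True
    from order_tendstoD(1)[OF lim this] show ?thesis
      by (rule eventually_mono) (use True in simp)
  next
    case False
    then have "(r + R)\<^sup>2 - a\<^sup>2 - (1 + R)\<^sup>2 < 0" using nz by simp
    with order_tendstoD(2)[OF lim this] show ?thesis
      by (auto elim!: eventually_mono)
  qed
qed

text \<open>
  A planar line becomes four disks, on either side of it and of either of two radii; the disk
  \<open>Wide\<close> meets all of them, the disk \<open>Far\<close> only the large ones.
\<close>

datatype ('p, 'l) name = Point 'p | Side 'l bool bool | Wide | Far

text \<open>Finitely many strict sign conditions hold for all small \<epsilon>, so one \<epsilon>
  serves them all. In the limit the form with \<open>Wide\<close> (centre 0, radius 2) is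
  \<open>2 * R + 3\<close>, and with \<open>Far\<close> (centre \<open>(3, 0)\<close>, radius 2) it
  is \<open>2 * R - 6\<close>; the radii 4 and 1 lie on either side of its zero.\<close>

lemma line_disks_exist:
  fixes P :: "'p \<Rightarrow> real \<times> real" and h :: "'l \<Rightarrow> real \<times> real \<times> real"
  assumes "finite Q" "finite L" and nv: "\<And>l. l \<in> L \<Longrightarrow> fst (snd (h l)) \<noteq> 0"
  defines "val \<equiv> \<lambda>l p. fst (h l) * fst (P p) + fst (snd (h l)) * snd (P p) + snd (snd (h l))"
  obtains c :: "('p, 'l) name \<Rightarrow> real ^ 2" and r where "\<And>v. r v > 0"
    "\<And>l p s R. l \<in> L \<Longrightarrow> p \<in> Q \<Longrightarrow> val l p \<noteq> 0 \<Longrightarrow>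
       disk_form (c (Side l s R)) (r (Side l s R)) (c (Point p)) (r (Point p)) > 0 \<longleftrightarrow> (val l p > 0 \<longleftrightarrow> s)"
    "\<And>l s R. l \<in> L \<Longrightarrow> disk_form (c (Side l s R)) (r (Side l s R)) (c Wide) (r Wide) > 0"
    "\<And>l s R. l \<in> L \<Longrightarrow> disk_form (c (Side l s R)) (r (Side l s R)) (c Far) (r Far) > 0 \<longleftrightarrow> R"
proof -
  define \<sigma> where "\<sigma> l s = (if fst (snd (h l)) > 0 \<longleftrightarrow> s then 1 else - 1 :: real)" for l s
  define m where "m l = - (fst (h l) / fst (snd (h l)))" for l
  define b where "b l = - (snd (snd (h l)) / fst (snd (h l)))" for l
  define rad where "rad R = (if R then 4 else 1 :: real)" for R
  have \<sigma>: "\<bar>\<sigma> l s\<bar> = 1" for l s by (simp add: \<sigma>_def)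
  have sgn_val: "sgn (\<sigma> l s * (snd (P p) - m l * fst (P p) - b l)) = (if s then sgn (val l p) else - sgn (val l p))"
    if l: "l \<in> L" for l s p
  proof -
    have "val l p = fst (snd (h l)) * (snd (P p) - m l * fst (P p) - b l)"
      using nv[OF that] by (simp add: val_def m_def b_def field_simps)
    then have eq: "sgn (val l p) = sgn (fst (snd (h l))) * sgn (snd (P p) - m l * fst (P p) - b l)"
      by (simp only: sgn_mult)
    show ?thesis
    proof (cases "fst (snd (h l)) > 0")
      case True
      then show ?thesis unfolding eq sgn_mult by (cases s) (simp_all add: \<sigma>_def)
    next
      case False
      then have "sgn (fst (snd (h l))) = - 1" using nv[OF l] by simp
      then show ?thesis using False unfolding eq sgn_mult by (cases s) (simp_all add: \<sigma>_def)
    qed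
  qed
  define I where "I = L \<times> (UNIV :: bool set) \<times> (UNIV :: bool set)"
  have I: "finite I" using assms(2) by (simp add: I_def)
  let ?f = "\<lambda>\<epsilon> l s R. disk_form (side_centre \<epsilon> (\<sigma> l s) (m l) (b l) (rad R)) (rad R)"
  have "\<forall>\<^sub>F \<epsilon> in at_right 0. \<forall>p\<in>Q. \<forall>(l, s, R)\<in>I. val l p \<noteq> 0 \<longrightarrow>
     sgn (?f \<epsilon> l s R (pt (\<epsilon>\<^sup>2 * fst (P p)) (\<epsilon> ^ 3 * snd (P p))) 1) = (if s then sgn (val l p) else - sgn (val l p))"
  proof (intro eventually_ball_finite[OF assms(1)] eventually_ball_finite[OF I] ballI)
    fix p i assume "i \<in> I"
    then obtain l s R where i: "i = (l, s, R)" "l \<in> L" by (auto simp: I_def)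
    have "\<forall>\<^sub>F \<epsilon> in at_right 0. val l p \<noteq> 0 \<longrightarrow>
       sgn (?f \<epsilon> l s R (pt (\<epsilon>\<^sup>2 * fst (P p)) (\<epsilon> ^ 3 * snd (P p))) 1) = (if s then sgn (val l p) else - sgn (val l p))"
    proof (cases "val l p = 0")
      case False
      then have "\<sigma> l s * (snd (P p) - m l * fst (P p) - b l) \<noteq> 0"
        using sgn_val[OF i(2), of s p] by (metis neg_equal_0_iff_equal sgn_eq_0_iff)
      from eventually_side[OF \<sigma> _ this, of "rad R"] show ?thesis
        unfolding sgn_val[OF i(2)] by (auto simp: rad_def elim!: eventually_mono)
    qed simp
    then show "\<forall>\<^sub>F \<epsilon> in at_right 0. case i of (l, s, R) \<Rightarrow> val l p \<noteq> 0 \<longrightarrow>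
       sgn (?f \<epsilon> l s R (pt (\<epsilon>\<^sup>2 * fst (P p)) (\<epsilon> ^ 3 * snd (P p))) 1) = (if s then sgn (val l p) else - sgn (val l p))"
      unfolding i by simp
  qed
  moreover have "\<forall>\<^sub>F \<epsilon> in at_right 0. \<forall>(l, s, R)\<in>I. sgn (?f \<epsilon> l s R (pt 0 0) 2) = 1"
  proof (intro eventually_ball_finite[OF I] ballI)
    fix i :: "'l \<times> bool \<times> bool"
    obtain l s R where i: "i = (l, s, R)" by (cases i)
    have "sgn ((2 + rad R)\<^sup>2 - 0\<^sup>2 - (1 + rad R)\<^sup>2) = 1"
      by (simp add: rad_def power2_eq_square)
    moreover from this have "(2 + rad R)\<^sup>2 - 0\<^sup>2 - (1 + rad R)\<^sup>2 \<noteq> 0"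
      by (auto split: if_splits)
    from eventually_side_fixed[OF \<sigma> this]
    have "\<forall>\<^sub>F \<epsilon> in at_right 0. sgn (?f \<epsilon> l s R (pt 0 0) 2) = sgn ((2 + rad R)\<^sup>2 - 0\<^sup>2 - (1 + rad R)\<^sup>2)" .
    ultimately show "\<forall>\<^sub>F \<epsilon> in at_right 0. case i of (l, s, R) \<Rightarrow> sgn (?f \<epsilon> l s R (pt 0 0) 2) = 1"
      unfolding i by simp
  qed
  moreover have "\<forall>\<^sub>F \<epsilon> in at_right 0. \<forall>(l, s, R)\<in>I. sgn (?f \<epsilon> l s R (pt 3 0) 2) = (if R then 1 else - 1)"
  proof (intro eventually_ball_finite[OF I] ballI)
    fix i :: "'l \<times> bool \<times> bool"
    obtain l s R where i: "i = (l, s, R)" by (cases i)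
    have "sgn ((2 + rad R)\<^sup>2 - 3\<^sup>2 - (1 + rad R)\<^sup>2) = (if R then 1 else - 1)"
      by (simp add: rad_def power2_eq_square)
    moreover from this have "(2 + rad R)\<^sup>2 - 3\<^sup>2 - (1 + rad R)\<^sup>2 \<noteq> 0"
      by (auto split: if_splits)
    from eventually_side_fixed[OF \<sigma> this]
    have "\<forall>\<^sub>F \<epsilon> in at_right 0. sgn (?f \<epsilon> l s R (pt 3 0) 2) = sgn ((2 + rad R)\<^sup>2 - 3\<^sup>2 - (1 + rad R)\<^sup>2)" .
    ultimately show "\<forall>\<^sub>F \<epsilon> in at_right 0. case i of (l, s, R) \<Rightarrow> sgn (?f \<epsilon> l s R (pt 3 0) 2) = (if R then 1 else - 1)"
      unfolding i by simp
  qed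
  ultimately have "\<forall>\<^sub>F \<epsilon> in at_right 0. (\<forall>p\<in>Q. \<forall>(l, s, R)\<in>I. val l p \<noteq> 0 \<longrightarrow>
     sgn (?f \<epsilon> l s R (pt (\<epsilon>\<^sup>2 * fst (P p)) (\<epsilon> ^ 3 * snd (P p))) 1) = (if s then sgn (val l p) else - sgn (val l p)))
     \<and> (\<forall>(l, s, R)\<in>I. sgn (?f \<epsilon> l s R (pt 0 0) 2) = 1)
     \<and> (\<forall>(l, s, R)\<in>I. sgn (?f \<epsilon> l s R (pt 3 0) 2) = (if R then 1 else - 1))"
    by (intro eventually_conj)
  from eventually_happens'[OF trivial_limit_at_right_real this] obtain \<epsilon> where
    E: "(\<forall>p\<in>Q. \<forall>(l, s, R)\<in>I. val l p \<noteq> 0 \<longrightarrow>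
     sgn (?f \<epsilon> l s R (pt (\<epsilon>\<^sup>2 * fst (P p)) (\<epsilon> ^ 3 * snd (P p))) 1) = (if s then sgn (val l p) else - sgn (val l p)))
     \<and> (\<forall>(l, s, R)\<in>I. sgn (?f \<epsilon> l s R (pt 0 0) 2) = 1)
     \<and> (\<forall>(l, s, R)\<in>I. sgn (?f \<epsilon> l s R (pt 3 0) 2) = (if R then 1 else - 1))" ..
  have 1: "sgn (?f \<epsilon> l s R (pt (\<epsilon>\<^sup>2 * fst (P p)) (\<epsilon> ^ 3 * snd (P p))) 1) = (if s then sgn (val l p) else - sgn (val l p))"
    if "p \<in> Q" "l \<in> L" "val l p \<noteq> 0" for p l s R
    using bspec[OF bspec[OF conjunct1[OF E] that(1)], of "(l, s, R)"] that by (simp add: I_def)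
  have 2: "sgn (?f \<epsilon> l s R (pt 0 0) 2) = 1" if "l \<in> L" for l s R
    using bspec[OF conjunct1[OF conjunct2[OF E]], of "(l, s, R)"] that by (simp add: I_def)
  have 3: "sgn (?f \<epsilon> l s R (pt 3 0) 2) = (if R then 1 else - 1)" if "l \<in> L" for l s R
    using bspec[OF conjunct2[OF conjunct2[OF E]], of "(l, s, R)"] that by (simp add: I_def)
  define c where "c v = (case v of Point p \<Rightarrow> pt (\<epsilon>\<^sup>2 * fst (P p)) (\<epsilon> ^ 3 * snd (P p))
    | Side l s R \<Rightarrow> side_centre \<epsilon> (\<sigma> l s) (m l) (b l) (rad R) | Wide \<Rightarrow> pt 0 0 | Far \<Rightarrow> pt 3 0)" for v
  define r where "r v = (case v of Point p \<Rightarrow> 1 | Side l s R \<Rightarrow> rad R | Wide \<Rightarrow> 2 | Far \<Rightarrow> 2)" for v :: "('p, 'l) name"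
  show thesis
  proof (rule that[of r c])
    show "r v > 0" for v by (simp add: r_def rad_def split: name.split)
    fix l s R assume l: "l \<in> L"
    show "disk_form (c (Side l s R)) (r (Side l s R)) (c Wide) (r Wide) > 0"
      using 2[OF l, of s R] by (simp add: c_def r_def sgn_1_pos)
    show "disk_form (c (Side l s R)) (r (Side l s R)) (c Far) (r Far) > 0 \<longleftrightarrow> R"
      using 3[OF l, of s R] by (simp add: c_def r_def sgn_1_pos sgn_1_neg split: if_splits)
    fix p assume "p \<in> Q" "val l p \<noteq> 0"
    then show "disk_form (c (Side l s R)) (r (Side l s R)) (c (Point p)) (r (Point p)) > 0 \<longleftrightarrow> (val l p > 0 \<longleftrightarrow> s)"
      using 1[OF _ l, of p s R] by (auto simp: c_def r_def sgn_if split: if_splits)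
  qed
qed

section \<open>Eliminating auxiliary disks\<close>

type_synonym r5 = "real \<times> real \<times> real \<times> real \<times> real"

definition lift :: "real ^ 2 \<Rightarrow> real \<Rightarrow> r5" where
  "lift c r = (1, r, c $ 1, c $ 2, r\<^sup>2 - (c $ 1)\<^sup>2 - (c $ 2)\<^sup>2)"

definition dual :: "real ^ 2 \<Rightarrow> real \<Rightarrow> r5" where
  "dual c r = (r\<^sup>2 - (c $ 1)\<^sup>2 - (c $ 2)\<^sup>2, 2 * r, 2 * c $ 1, 2 * c $ 2, 1)"

lemma disk_form_inner: "disk_form a r b s = dual a r \<bullet> lift b s"
  by (simp add: disk_form_def dual_def lift_def power2_eq_square algebra_simps)

text \<open>Written without division, so that integer values stay integers. When
  \<open>f \<bullet> e > 0\<close> and \<open>g \<bullet> e \<le> 0\<close>, both coefficients are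
  nonnegative, and a sign common to \<open>f\<close> and \<open>g\<close> is kept.\<close>

definition elim :: "'a :: real_inner \<Rightarrow> 'a \<Rightarrow> 'a \<Rightarrow> 'a" where
  "elim e f g = (f \<bullet> e) *\<^sub>R g - (g \<bullet> e) *\<^sub>R f"

lemma elim_inner: "elim e f g \<bullet> x = (f \<bullet> e) * (g \<bullet> x) - (g \<bullet> e) * (f \<bullet> x)"
  by (simp add: elim_def inner_diff_left)

lemma elim_self [simp]: "elim e f g \<bullet> e = 0"
  by (simp add: elim_inner)

lemma elim_pos:
  assumes "f \<bullet> e > 0" "g \<bullet> e \<le> 0" "f \<bullet> x > 0" "g \<bullet> x > 0"
  shows "elim e f g \<bullet> x > 0"
proof -
  have "(f \<bullet> e) * (g \<bullet> x) > 0" "(g \<bullet> e) * (f \<bullet> x) \<le> 0"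
    using assms by (simp_all add: mult_nonpos_nonneg)
  then show ?thesis by (simp add: elim_inner)
qed

lemma elim_nonpos:
  assumes "f \<bullet> e > 0" "g \<bullet> e \<le> 0" "f \<bullet> x \<le> 0" "g \<bullet> x \<le> 0"
  shows "elim e f g \<bullet> x \<le> 0"
proof -
  have "(f \<bullet> e) * (g \<bullet> x) \<le> 0" "(g \<bullet> e) * (f \<bullet> x) \<ge> 0"
    using assms by (simp_all add: mult_nonneg_nonpos mult_nonpos_nonpos)
  then show ?thesis by (simp add: elim_inner)
qed

lemma elim_neg:
  assumes "f \<bullet> e > 0" "g \<bullet> e \<le> 0" "f \<bullet> x < 0" "g \<bullet> x < 0"
  shows "elim e f g \<bullet> x < 0"
proof -
  have "(f \<bullet> e) * (g \<bullet> x) < 0" "(g \<bullet> e) * (f \<bullet> x) \<ge> 0"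
    using assms by (simp_all add: mult_pos_neg mult_nonpos_nonpos)
  then show ?thesis by (simp add: elim_inner)
qed

definition int_bounded :: "real \<Rightarrow> real \<Rightarrow> bool" where
  "int_bounded B a \<longleftrightarrow> a \<in> \<int> \<and> \<bar>a\<bar> \<le> B"

lemma int_bounded_elim:
  assumes "int_bounded B (f \<bullet> e)" "int_bounded B (g \<bullet> e)" "int_bounded B (f \<bullet> x)" "int_bounded B (g \<bullet> x)"
  shows "int_bounded (2 * B\<^sup>2) (elim e f g \<bullet> x)"
proof -
  have "\<bar>(f \<bullet> e) * (g \<bullet> x) - (g \<bullet> e) * (f \<bullet> x)\<bar> \<le> \<bar>f \<bullet> e\<bar> * \<bar>g \<bullet> x\<bar> + \<bar>g \<bullet> e\<bar> * \<bar>f \<bullet> x\<bar>"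
    using abs_triangle_ineq4[of "(f \<bullet> e) * (g \<bullet> x)" "(g \<bullet> e) * (f \<bullet> x)"] by (simp only: abs_mult)
  also have "\<dots> \<le> B * B + B * B"
    using assms by (intro add_mono mult_mono) (auto simp: int_bounded_def intro: order.trans[OF abs_ge_zero])
  finally show ?thesis
    using assms by (simp add: int_bounded_def elim_inner power2_eq_square)
qed

text \<open>\<open>A1\<close>, \<open>A2\<close> are the large and the small disk on one side of a
  line, \<open>B1\<close>, \<open>B2\<close> those on the other. Within a side only the large one
  meets \<open>f\<close>, so eliminating \<open>f\<close> keeps signs. Both results are positive at
  \<open>w\<close>; eliminating \<open>w\<close> subtracts them, and opposite signs at a point then
  support each other.\<close>

definition line_fun :: "'a :: real_inner \<Rightarrow> 'a \<Rightarrow> 'a \<Rightarrow> 'a \<Rightarrow> 'a \<Rightarrow> 'a \<Rightarrow> 'a" where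
  "line_fun w f A1 A2 B1 B2 = elim w (elim f B1 B2) (elim f A1 A2)"

lemma line_fun_vanish: "line_fun w f A1 A2 B1 B2 \<bullet> w = 0" "line_fun w f A1 A2 B1 B2 \<bullet> f = 0"
  by (simp_all add: line_fun_def elim_inner)

lemma line_fun_sign:
  assumes "A1 \<bullet> f > 0" "A2 \<bullet> f \<le> 0" "B1 \<bullet> f > 0" "B2 \<bullet> f \<le> 0"
    and "A1 \<bullet> w > 0" "A2 \<bullet> w > 0" "B1 \<bullet> w > 0" "B2 \<bullet> w > 0"
  shows "A1 \<bullet> x > 0 \<Longrightarrow> A2 \<bullet> x > 0 \<Longrightarrow> B1 \<bullet> x \<le> 0 \<Longrightarrow> B2 \<bullet> x \<le> 0 \<Longrightarrow> line_fun w f A1 A2 B1 B2 \<bullet> x > 0"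
    and "A1 \<bullet> x \<le> 0 \<Longrightarrow> A2 \<bullet> x \<le> 0 \<Longrightarrow> B1 \<bullet> x > 0 \<Longrightarrow> B2 \<bullet> x > 0 \<Longrightarrow> line_fun w f A1 A2 B1 B2 \<bullet> x < 0"
proof -
  define a b where "a = elim f A1 A2" and "b = elim f B1 B2"
  have w: "a \<bullet> w > 0" "b \<bullet> w > 0" unfolding a_def b_def using assms by (simp_all add: elim_pos)
  have eq: "line_fun w f A1 A2 B1 B2 \<bullet> x = (b \<bullet> w) * (a \<bullet> x) - (a \<bullet> w) * (b \<bullet> x)"
    by (simp add: line_fun_def a_def b_def elim_inner[of w])
  show "line_fun w f A1 A2 B1 B2 \<bullet> x > 0"
    if "A1 \<bullet> x > 0" "A2 \<bullet> x > 0" "B1 \<bullet> x \<le> 0" "B2 \<bullet> x \<le> 0"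
  proof -
    have "a \<bullet> x > 0" "b \<bullet> x \<le> 0" unfolding a_def b_def using assms that by (simp_all add: elim_pos elim_nonpos)
    with w have "(b \<bullet> w) * (a \<bullet> x) > 0" "(a \<bullet> w) * (b \<bullet> x) \<le> 0" by (simp_all add: mult_nonneg_nonpos)
    then show ?thesis unfolding eq by linarith
  qed
  show "line_fun w f A1 A2 B1 B2 \<bullet> x < 0"
    if "A1 \<bullet> x \<le> 0" "A2 \<bullet> x \<le> 0" "B1 \<bullet> x > 0" "B2 \<bullet> x > 0"
  proof -
    have "a \<bullet> x \<le> 0" "b \<bullet> x > 0" unfolding a_def b_def using assms that by (simp_all add: elim_pos elim_nonpos)
    with w have "(b \<bullet> w) * (a \<bullet> x) \<le> 0" "(a \<bullet> w) * (b \<bullet> x) > 0" by (simp_all add: mult_nonneg_nonpos)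
    then show ?thesis unfolding eq by linarith
  qed
qed

lemma r5_combination:
  fixes e1 e2 e3 e4 e5 x :: r5
  assumes "\<And>a b c d e. a *\<^sub>R e1 + b *\<^sub>R e2 + c *\<^sub>R e3 + d *\<^sub>R e4 + e *\<^sub>R e5 = 0 \<Longrightarrow> a = 0 \<and> b = 0 \<and> c = 0 \<and> d = 0 \<and> e = 0"
  obtains a b c d e where "x = a *\<^sub>R e1 + b *\<^sub>R e2 + c *\<^sub>R e3 + d *\<^sub>R e4 + e *\<^sub>R e5"
proof -
  define T :: "r5 \<Rightarrow> r5" where
    "T v = fst v *\<^sub>R e1 + fst (snd v) *\<^sub>R e2 + fst (snd (snd v)) *\<^sub>R e3 + fst (snd (snd (snd v))) *\<^sub>R e4 + snd (snd (snd (snd v))) *\<^sub>R e5" for v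
  have lin: "linear T"
    by (rule linearI) (simp_all add: T_def scaleR_add_left scaleR_add_right algebra_simps)
  have "v = 0" if "T v = 0" for v
    using assms[OF that[unfolded T_def]] by (simp add: prod_eq_iff)
  then have "inj T" by (simp add: linear_injective_0[OF lin])
  with lin have "surj T" by (rule linear_inj_imp_surj)
  then obtain v where "x = T v" by (rule surjE)
  then show thesis using that by (simp add: T_def)
qed

section \<open>Inequalities that single points force between the three pencils\<close>

lemma growth_a:
  fixes x y z y' u1 u2 u3 :: real
  assumes "x > 0" "y > 0" "z > 0" "y' > 0"
    and "u1 > x * u2" "u2 > y * u3" "u1 < z * u3" "u2 + y' * u3 > 0"
  shows "z > x * y"
proof -
  \<comment> \<open>In an arbitrary realization the coordinates of a point may have any sign. The
    last hypothesis, which comes from the lines \<open>LP\<close>, fixes the orientation.\<close>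
  have u3: "u3 > 0"
  proof (rule ccontr)
    assume "\<not> ?thesis"
    then have "z * u3 \<le> 0" "y' * u3 \<le> 0" using assms by (simp_all add: mult_nonneg_nonpos)
    with assms have "x * u2 < 0" "u2 > 0" by linarith+
    with assms show False by (simp add: mult_less_0_iff)
  qed
  have "x * (y * u3) < x * u2" using assms by simp
  with assms have "x * (y * u3) < z * u3" by linarith
  then have "(x * y) * u3 < z * u3" by (simp only: mult.assoc)
  with u3 show ?thesis by simp
qed

lemma growth_b_pos:
  fixes x' y0 z y' u1 u2 u3 :: real
  assumes "x' > 0" "y0 > 0" "z > 0" "y' > 0"
    and "u1 > z * u3" "u2 < y0 * u3" "u1 < x' * u2" "u2 + y' * u3 > 0"
  shows "u2 > 0" "u3 > 0"
proof -
  show u2: "u2 > 0"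
  proof (rule ccontr)
    assume "\<not> ?thesis"
    then have "x' * u2 \<le> 0" using assms by (simp add: mult_nonneg_nonpos)
    with assms have "z * u3 < 0" by linarith
    then have "u3 < 0" using assms by (simp add: mult_less_0_iff)
    then have "y' * u3 < 0" using assms by (simp add: mult_pos_neg)
    with assms \<open>\<not> u2 > 0\<close> show False by linarith
  qed
  then have "y0 * u3 > 0" using assms by linarith
  then show "u3 > 0" using assms by (simp add: zero_less_mult_iff)
qed

lemma growth_b:
  fixes x' y0 z y' u1 u2 u3 :: real
  assumes "x' > 0" "y0 > 0" "z > 0" "y' > 0"
    and "u1 > z * u3" "u2 < y0 * u3" "u1 < x' * u2" "u2 + y' * u3 > 0"
  shows "x' * y0 > z"
proof -
  have u: "u2 > 0" "u3 > 0" using growth_b_pos[OF assms] by auto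
  have "x' * u2 < x' * (y0 * u3)" using assms by simp
  with assms have "z * u3 < x' * (y0 * u3)" by linarith
  then have "z * u3 < (x' * y0) * u3" by (simp only: mult.assoc)
  with u show ?thesis by simp
qed

lemma growth_c:
  fixes x0 y1 z y' u1 u2 u3 :: real
  assumes "x0 > 0" "y1 > 0" "z > 0" "y' > 0"
    and "u1 > z * u3" "u1 < x0 * u2" "u2 < y1 * u3" "u2 + y' * u3 > 0"
  shows "x0 * y1 > z"
proof -
  have u3: "u3 > 0"
  proof (rule ccontr)
    assume "\<not> ?thesis"
    then have "y1 * u3 \<le> 0" "y' * u3 \<le> 0" using assms by (simp_all add: mult_nonneg_nonpos)
    with assms show False by linarith
  qed
  have "x0 * u2 < x0 * (y1 * u3)" using assms by simp
  with assms have "z * u3 < x0 * (y1 * u3)" by linarith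
  then have "z * u3 < (x0 * y1) * u3" by (simp only: mult.assoc)
  with u3 show ?thesis by simp
qed

text \<open>Applied to \<open>D1\<close>, which lies beyond the edge \<open>E1 E2\<close>: there
  \<open>u3 < 0 < u2\<close>, so the term \<open>q * u3\<close> only helps, and comparing the two
  lines isolates the slope \<open>p\<close>.\<close>

lemma slope_bound:
  fixes x0 y0 p q y' y'' u1 u2 u3 :: real
  assumes "x0 > 0" "y0 > 0" "q > 0" "y' > 0" "y'' > 0"
    and "u1 > x0 * u2" "u2 > y0 * u3" "u1 < p * u2 + q * u3" "u2 + y' * u3 < 0" "u2 + y'' * u3 > 0"
  shows "p > x0"
proof -
  have u3: "u3 < 0"
  proof (rule ccontr)
    assume "\<not> ?thesis"
    then have "y0 * u3 \<ge> 0" "y' * u3 \<ge> 0" using assms by simp_all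
    with assms show False by linarith
  qed
  then have "y'' * u3 < 0" "q * u3 < 0" using assms by (simp_all add: mult_pos_neg)
  with assms have "u2 > 0" "x0 * u2 < p * u2" by linarith+
  then show ?thesis by simp
qed

text \<open>The counterpart for \<open>D2\<close>, beyond the edge \<open>E1 E3\<close>: now
  \<open>u2 < 0 < u3\<close> and the intercept \<open>q\<close> is isolated.\<close>

lemma intercept_bound:
  fixes z0 y0 p q y' y'' u1 u2 u3 :: real
  assumes "z0 > 0" "y0 > 0" "p > 0" "y' > 0" "y'' > 0"
    and "u1 > z0 * u3" "u2 < y0 * u3" "u1 < p * u2 + q * u3" "u2 + y'' * u3 < 0" "u2 + y' * u3 > 0"
  shows "q > z0"
proof -
  have u3: "u3 > 0"
  proof (rule ccontr)
    assume "\<not> ?thesis"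
    then have "y0 * u3 \<le> 0" "y' * u3 \<le> 0" using assms by (simp_all add: mult_nonneg_nonpos)
    with assms show False by linarith
  qed
  then have "y'' * u3 > 0" using assms by simp
  with assms have "u2 < 0" by linarith
  then have "p * u2 < 0" using assms by (simp add: mult_pos_neg)
  with assms have "z0 * u3 < q * u3" by linarith
  with u3 show ?thesis by simp
qed

text \<open>The chain is \<open>x1 * u2 > p * u2 + q * u3 > x0 * u2 + x0 * y0 * u3 > 2 * x0 *
  u2\<close>, the last step by \<open>u2 < y0 * u3\<close>.\<close>

lemma doubling:
  fixes x0 x1 y0 z0 p q y' u1 u2 u3 :: real
  assumes "x0 > 0" "x1 > 0" "y0 > 0" "z0 > x0 * y0" "y' > 0" "p > x0" "q > z0"
    and "u1 > z0 * u3" "u2 < y0 * u3" "u1 < x1 * u2" "u2 + y' * u3 > 0" "u1 > p * u2 + q * u3"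
  shows "x1 > 2 * x0"
proof -
  have "z0 > 0" using assms(1,3,4) by (meson mult_pos_pos order.strict_trans)
  then have u: "u2 > 0" "u3 > 0" using growth_b_pos[where x' = x1 and z = z0 and ?u1.0 = u1, OF assms(2,3) _ assms(5,8-11)] by auto
  have "p * u2 > x0 * u2" using assms u by simp
  moreover have "q * u3 > x0 * y0 * u3" using assms u by simp
  moreover have "x0 * (y0 * u3) > x0 * u2" using assms by simp
  moreover have "x0 * y0 * u3 = x0 * (y0 * u3)" by (rule mult.assoc)
  ultimately have "x1 * u2 > x0 * u2 + x0 * u2" using assms by linarith
  then have "x1 * u2 > (2 * x0) * u2" by (simp add: mult_ac)
  with u show ?thesis by simp
qed

text \<open>Both ratios \<open>x (Suc k) / x 0\<close> and \<open>y (Suc k) / y 0\<close> exceed the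
  product of the two ratios at \<open>k\<close>, hence a common lower bound is squared. The index is
  shifted by two because the factor 2 is there for \<open>x\<close> at 1 but reaches
  \<open>y\<close> only at 2.\<close>

lemma double_exponential_growth:
  fixes x y z :: "nat \<Rightarrow> real"
  assumes "x 0 > 0" "y 0 > 0" "x 1 > 2 * x 0"
    and a: "\<And>k. k < m \<Longrightarrow> z k > x k * y k"
    and b: "\<And>k. k < m \<Longrightarrow> x (Suc k) * y 0 > z k"
    and c: "\<And>k. k < m \<Longrightarrow> x 0 * y (Suc k) > z k"
  assumes "Suc (Suc k) \<le> m"
  shows "x (Suc (Suc k)) \<ge> 2 ^ 2 ^ k * x 0 \<and> y (Suc (Suc k)) \<ge> 2 ^ 2 ^ k * y 0"
  using assms(7)
proof (induction k)
  case 0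
  have "x 0 * y 1 > x 0 * y 0" using a[of 0] c[of 0] 0 by simp
  then have "y 1 > y 0" using assms by simp
  then have "x 1 * y 1 > (2 * x 0) * y 0" using assms by (intro mult_strict_mono) auto
  with a[of 1] have z: "z 1 > 2 * x 0 * y 0" using 0 by simp
  with b[of 1] c[of 1] 0 have "x 2 * y 0 > (2 * x 0) * y 0" "x 0 * y 2 > x 0 * (2 * y 0)"
    by (simp_all add: numeral_2_eq_2 mult_ac)
  then have "x 2 > 2 * x 0" "y 2 > 2 * y 0"
    using assms(1,2) mult_less_cancel_right_pos mult_less_cancel_left_pos by blast+
  then show ?case by (simp add: numeral_2_eq_2)
next
  case (Suc k)
  let ?k = "Suc (Suc k)" and ?E = "(2 :: real) ^ 2 ^ k"
  have "(?E * x 0) * (?E * y 0) \<le> x ?k * y ?k"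
    using Suc assms by (intro mult_mono) (auto intro: order.trans[rotated])
  moreover have "(2 :: real) ^ 2 ^ Suc k = ?E * ?E" by (simp add: power_add[symmetric])
  ultimately have "2 ^ 2 ^ Suc k * (x 0 * y 0) < z ?k" using a[of ?k] Suc.prems by (simp add: mult_ac)
  with b[of ?k] c[of ?k] Suc.prems
  have "(2 ^ 2 ^ Suc k * x 0) * y 0 < x (Suc ?k) * y 0" "x 0 * (2 ^ 2 ^ Suc k * y 0) < x 0 * y (Suc ?k)"
    by (simp_all only: mult_ac) linarith+
  then show ?case using assms(1,2) by (simp add: mult_less_cancel_right_pos)
qed

section \<open>Forcing a doubly exponential cross ratio\<close>

text \<open>In the model \<open>x k = y k = lev k\<close> and
  \<open>z k = 8 * (lev k)\<^sup>2\<close>. The factor 64 leaves a gap of 8 between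
  \<open>x k * y k\<close> and \<open>z k\<close>, and again between \<open>z k\<close> and the next
  level, with room for test points strictly inside.\<close>

fun lev :: "nat \<Rightarrow> real" where
  "lev 0 = 1"
| "lev (Suc k) = 64 * (lev k)\<^sup>2"

lemma lev_ge_1: "lev k \<ge> 1"
proof (induction k)
  case (Suc k)
  then have "1 \<le> (lev k)\<^sup>2" by (rule one_le_power)
  then show ?case by simp
qed simp

text \<open>
  Barycentric coordinates. The lines \<open>L12 k\<close>, \<open>L23 k\<close>, \<open>L13 k\<close> through the vertices \<open>E3\<close>, \<open>E1\<close>, \<open>E2\<close> are
  \<open>u\<^sub>1 = x\<^sub>k u\<^sub>2\<close>, \<open>u\<^sub>2 = y\<^sub>k u\<^sub>3\<close>, \<open>u\<^sub>1 = z\<^sub>k u\<^sub>3\<close>, and the flag selects one of two perturbations on either side of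
  the vertex. The points \<open>PA k\<close>, \<open>PB k\<close>, \<open>PC k\<close> force \<open>z\<^sub>k > x\<^sub>k y\<^sub>k\<close>, \<open>x\<^sub>k\<^sub>+\<^sub>1 y\<^sub>0 > z\<^sub>k\<close> and \<open>x\<^sub>0 y\<^sub>k\<^sub>+\<^sub>1 > z\<^sub>k\<close>;
  the remaining points and lines force \<open>x\<^sub>1 > 2 x\<^sub>0\<close>, which starts the growth.
\<close>

datatype point = E1 | E2 | E3 | D1 | D2 | PA nat | PB nat | PC nat

datatype line = LS | LP bool | LQ bool | L12 nat bool | L23 nat bool | L13 nat bool

fun bary :: "point \<Rightarrow> real \<times> real \<times> real" where
  "bary E1 = (1, 0, 0)"
| "bary E2 = (0, 1, 0)"
| "bary E3 = (0, 0, 1)"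
| "bary D1 = (150, 100, - 1)"
| "bary D2 = (100, - 1, 10)"
| "bary (PA k) = (4 * (lev k)\<^sup>2, 2 * lev k, 1)"
| "bary (PB k) = (64 * (lev k)\<^sup>2, 2, 4)"
| "bary (PC k) = (16 * (lev k)\<^sup>2, 32 * (lev k)\<^sup>2, 1)"

text \<open>\<eta> multiplies the coordinate of the vertex through which the unperturbed line
  passes, so the two flags put that vertex on opposite sides. The numbers in \<open>LS\<close> are a
  slope 2 above \<open>x 0 = 1\<close> and an intercept 12 above \<open>z 0 = 8\<close>.\<close>

fun coef :: "real \<Rightarrow> line \<Rightarrow> real \<times> real \<times> real" where
  "coef \<eta> LS = (1, - 2, - 12)"
| "coef \<eta> (LP s) = ((if s then \<eta> else - \<eta>), 1, 200)"
| "coef \<eta> (LQ s) = ((if s then \<eta> else - \<eta>), 20, 1)"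
| "coef \<eta> (L12 k s) = (1, - lev k, (if s then \<eta> else - \<eta>))"
| "coef \<eta> (L23 k s) = ((if s then \<eta> else - \<eta>), 1, - lev k)"
| "coef \<eta> (L13 k s) = (1, (if s then \<eta> else - \<eta>), - 8 * (lev k)\<^sup>2)"

definition points :: "nat \<Rightarrow> point set" where
  "points m = {E1, E2, E3, D1, D2} \<union> PA ` {..<m} \<union> PB ` {..<m} \<union> PC ` {..<m}"

definition lines :: "nat \<Rightarrow> line set" where
  "lines m = {LS} \<union> range LP \<union> range LQ \<union>
     (\<lambda>(k, s). L12 k s) ` ({..m} \<times> UNIV) \<union> (\<lambda>(k, s). L23 k s) ` ({..m} \<times> UNIV) \<union>
     (\<lambda>(k, s). L13 k s) ` ({..m} \<times> UNIV)"

text \<open>Two lines with a vertex strictly between them replace a line exactly through the vertex,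
  an incidence that no intersection pattern could prescribe.\<close>

lemma elim_pair_sign:
  assumes "f True \<bullet> e > 0" "f False \<bullet> e < 0"
  shows "(\<And>s. f s \<bullet> x > 0) \<Longrightarrow> elim e (f True) (f False) \<bullet> x > 0"
    and "(\<And>s. f s \<bullet> x < 0) \<Longrightarrow> elim e (f True) (f False) \<bullet> x < 0"
  using assms by (simp_all add: elim_pos elim_neg)

text \<open>Modulo \<open>e4\<close> and \<open>e5\<close> the space has dimension three with basis
  \<open>X E1\<close>, \<open>X E2\<close>, \<open>X E3\<close>, which recovers the plane inside any
  realization; \<open>x\<close>, \<open>y\<close>, \<open>z\<close> are then ratios of values at the
  vertices. The bound on \<eta> makes \<eta> times any coordinate of a test point less than 1, while
  the unperturbed values that the proof uses have modulus at least 1.\<close>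

lemma forcing:
  fixes W :: "line \<Rightarrow> r5" and X :: "point \<Rightarrow> r5" and e4 e5 :: r5
  assumes m: "m \<ge> 1" and \<eta>: "\<eta> > 0" "\<And>k. k < m \<Longrightarrow> \<eta> * (64 * (lev k)\<^sup>2 + 200) < 1"
    and vanish: "\<And>l. l \<in> lines m \<Longrightarrow> W l \<bullet> e4 = 0 \<and> W l \<bullet> e5 = 0"
    and indep: "\<And>a b. a *\<^sub>R e4 + b *\<^sub>R e5 = 0 \<Longrightarrow> a = 0 \<and> b = 0"
    and pos: "\<And>l p. l \<in> lines m \<Longrightarrow> p \<in> points m \<Longrightarrow> coef \<eta> l \<bullet> bary p > 0 \<Longrightarrow> W l \<bullet> X p > 0"
    and neg: "\<And>l p. l \<in> lines m \<Longrightarrow> p \<in> points m \<Longrightarrow> coef \<eta> l \<bullet> bary p < 0 \<Longrightarrow> W l \<bullet> X p < 0"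
  defines "H \<equiv> \<lambda>k. elim (X E3) (W (L12 k True)) (W (L12 k False))"
  shows "H 0 \<bullet> X E1 > 0" "H 0 \<bullet> X E2 < 0" "H m \<bullet> X E1 > 0" "H m \<bullet> X E2 < 0"
    and "Suc (Suc j) = m \<Longrightarrow> (H m \<bullet> X E2) * (H 0 \<bullet> X E1) \<le> 2 ^ 2 ^ j * ((H 0 \<bullet> X E2) * (H m \<bullet> X E1))"
proof -
  define h12 h23 h13 hp hq where
    "h12 k = elim (X E3) (W (L12 k True)) (W (L12 k False))" and
    "h23 k = elim (X E1) (W (L23 k True)) (W (L23 k False))" and
    "h13 k = elim (X E2) (W (L13 k True)) (W (L13 k False))" and
    "hp = elim (X E1) (W (LP True)) (W (LP False))" and
    "hq = elim (X E1) (W (LQ True)) (W (LQ False))" for k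
  have lines [simp]: "LS \<in> lines m" "LP s \<in> lines m" "LQ s \<in> lines m"
    "L12 k s \<in> lines m \<longleftrightarrow> k \<le> m" "L23 k s \<in> lines m \<longleftrightarrow> k \<le> m" "L13 k s \<in> lines m \<longleftrightarrow> k \<le> m" for k s
    by (auto simp: lines_def)
  have points [simp]: "E1 \<in> points m" "E2 \<in> points m" "E3 \<in> points m" "D1 \<in> points m" "D2 \<in> points m"
    "PA k \<in> points m \<longleftrightarrow> k < m" "PB k \<in> points m \<longleftrightarrow> k < m" "PC k \<in> points m \<longleftrightarrow> k < m" for k
    by (auto simp: points_def)
  have sc: "lev k \<ge> 1" for k by (rule lev_ge_1)
  have sc2: "(lev k)\<^sup>2 \<ge> lev k" for k
    using mult_right_mono[OF sc[of k], of "lev k"] sc[of k] by (simp add: power2_eq_square)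
  have \<eta>1: "200 * \<eta> < 1" using \<eta>(1) \<eta>(2)[of 0] m by (simp add: algebra_simps)
  have \<eta>2: "0 \<le> \<eta> * (lev k)\<^sup>2" "64 * (\<eta> * (lev k)\<^sup>2) < 1" "0 \<le> \<eta> * lev k" "\<eta> * lev k \<le> \<eta> * (lev k)\<^sup>2" if "k < m" for k
    using \<eta>(1) \<eta>(2)[OF that] sc[of k] sc2[of k] by (simp_all add: algebra_simps)
  have P12: "h12 k \<bullet> x > 0" if "\<And>s. W (L12 k s) \<bullet> x > 0" "k \<le> m" for k x
    unfolding h12_def using \<eta>(1) that by (intro elim_pair_sign(1)) (auto intro!: pos neg)
  have N12: "h12 k \<bullet> x < 0" if "\<And>s. W (L12 k s) \<bullet> x < 0" "k \<le> m" for k x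
    unfolding h12_def using \<eta>(1) that by (intro elim_pair_sign(2)) (auto intro!: pos neg)
  have P23: "h23 k \<bullet> x > 0" if "\<And>s. W (L23 k s) \<bullet> x > 0" "k \<le> m" for k x
    unfolding h23_def using \<eta>(1) that by (intro elim_pair_sign(1)) (auto intro!: pos neg)
  have N23: "h23 k \<bullet> x < 0" if "\<And>s. W (L23 k s) \<bullet> x < 0" "k \<le> m" for k x
    unfolding h23_def using \<eta>(1) that by (intro elim_pair_sign(2)) (auto intro!: pos neg)
  have P13: "h13 k \<bullet> x > 0" if "\<And>s. W (L13 k s) \<bullet> x > 0" "k \<le> m" for k x
    unfolding h13_def using \<eta>(1) that by (intro elim_pair_sign(1)) (auto intro!: pos neg)
  have N13: "h13 k \<bullet> x < 0" if "\<And>s. W (L13 k s) \<bullet> x < 0" "k \<le> m" for k x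
    unfolding h13_def using \<eta>(1) that by (intro elim_pair_sign(2)) (auto intro!: pos neg)
  have PP: "hp \<bullet> x > 0" if "\<And>s. W (LP s) \<bullet> x > 0" for x
    unfolding hp_def using \<eta>(1) that by (intro elim_pair_sign(1)) (auto intro!: pos neg)
  have NP: "hp \<bullet> x < 0" if "\<And>s. W (LP s) \<bullet> x < 0" for x
    unfolding hp_def using \<eta>(1) that by (intro elim_pair_sign(2)) (auto intro!: pos neg)
  have PQ: "hq \<bullet> x > 0" if "\<And>s. W (LQ s) \<bullet> x > 0" for x
    unfolding hq_def using \<eta>(1) that by (intro elim_pair_sign(1)) (auto intro!: pos neg)
  have NQ: "hq \<bullet> x < 0" if "\<And>s. W (LQ s) \<bullet> x < 0" for x
    unfolding hq_def using \<eta>(1) that by (intro elim_pair_sign(2)) (auto intro!: pos neg)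
  have e12: "h12 k \<bullet> X E1 > 0" "h12 k \<bullet> X E2 < 0" if "k \<le> m" for k
    using that sc[of k] by (auto intro!: P12 N12 pos neg)
  have e23: "h23 k \<bullet> X E2 > 0" "h23 k \<bullet> X E3 < 0" if "k \<le> m" for k
    using that sc[of k] by (auto intro!: P23 N23 pos neg)
  have e13: "h13 k \<bullet> X E1 > 0" "h13 k \<bullet> X E3 < 0" if "k \<le> m" for k
    using that sc[of k] by (auto intro!: P13 N13 pos neg)
  have ep: "hp \<bullet> X E2 > 0" "hp \<bullet> X E3 > 0" by (auto intro!: PP pos)
  have eq: "hq \<bullet> X E2 > 0" "hq \<bullet> X E3 > 0" by (auto intro!: PQ pos)
  have es: "W LS \<bullet> X E1 > 0" "W LS \<bullet> X E2 < 0" "W LS \<bullet> X E3 < 0" by (auto intro!: pos neg)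
  have v12: "h12 k \<bullet> X E3 = 0" "h12 k \<bullet> e4 = 0" "h12 k \<bullet> e5 = 0" if "k \<le> m" for k
    using that vanish by (simp_all add: h12_def) (simp_all add: elim_inner)
  have v23: "h23 k \<bullet> X E1 = 0" "h23 k \<bullet> e4 = 0" "h23 k \<bullet> e5 = 0" if "k \<le> m" for k
    using that vanish by (simp_all add: h23_def) (simp_all add: elim_inner)
  have v13: "h13 k \<bullet> X E2 = 0" "h13 k \<bullet> e4 = 0" "h13 k \<bullet> e5 = 0" if "k \<le> m" for k
    using that vanish by (simp_all add: h13_def) (simp_all add: elim_inner)
  have vp: "hp \<bullet> X E1 = 0" "hp \<bullet> e4 = 0" "hp \<bullet> e5 = 0"
    using vanish by (simp_all add: hp_def) (simp_all add: elim_inner)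
  have vq: "hq \<bullet> X E1 = 0" "hq \<bullet> e4 = 0" "hq \<bullet> e5 = 0"
    using vanish by (simp_all add: hq_def) (simp_all add: elim_inner)
  have vs: "W LS \<bullet> e4 = 0" "W LS \<bullet> e5 = 0" using vanish by simp_all
  \<comment> \<open>\<open>hp\<close> has equal and \<open>h23 0\<close> opposite signs at
    \<open>X E2\<close> and \<open>X E3\<close>, and both vanish at \<open>X E1\<close>. This forces
    \<open>b = c = 0\<close>, and \<open>h12 0\<close> then removes \<open>a\<close>.\<close>
  have ind: "a = 0 \<and> b = 0 \<and> c = 0 \<and> d = 0 \<and> e = 0"
    if z: "a *\<^sub>R X E1 + b *\<^sub>R X E2 + c *\<^sub>R X E3 + d *\<^sub>R e4 + e *\<^sub>R e5 = 0" for a b c d e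
  proof -
    have ip: "a * (f \<bullet> X E1) + b * (f \<bullet> X E2) + c * (f \<bullet> X E3) + d * (f \<bullet> e4) + e * (f \<bullet> e5) = 0" for f
      using arg_cong[OF z, of "\<lambda>x. f \<bullet> x"] by (simp add: inner_add_right)
    have 1: "b * (hp \<bullet> X E2) + c * (hp \<bullet> X E3) = 0" using ip[of hp] vp by simp
    have 2: "b * (h23 0 \<bullet> X E2) + c * (h23 0 \<bullet> X E3) = 0" using ip[of "h23 0"] v23[of 0] by simp
    have b: "b = 0"
    proof (rule ccontr)
      assume "b \<noteq> 0"
      then consider "b > 0" | "b < 0" by linarith
      then show False
      proof cases
        case 1
        then have "b * (hp \<bullet> X E2) > 0" "b * (h23 0 \<bullet> X E2) > 0" using ep e23[of 0] by simp_all
        then have "c * (hp \<bullet> X E3) < 0" "c * (h23 0 \<bullet> X E3) < 0" using \<open>b * (hp \<bullet> X E2) + c * (hp \<bullet> X E3) = 0\<close> 2 by linarith+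
        then show False using ep e23[of 0] by (simp add: mult_less_0_iff)
      next
        case 2
        then have "b * (hp \<bullet> X E2) < 0" "b * (h23 0 \<bullet> X E2) < 0" using ep e23[of 0] by (simp_all add: mult_neg_pos)
        then have "c * (hp \<bullet> X E3) > 0" "c * (h23 0 \<bullet> X E3) > 0" using 1 \<open>b * (h23 0 \<bullet> X E2) + c * (h23 0 \<bullet> X E3) = 0\<close> by linarith+
        then show False using ep e23[of 0] by (simp add: zero_less_mult_iff)
      qed
    qed
    with 1 have c: "c = 0" using ep by simp
    have a: "a = 0" using ip[of "h12 0"] v12[of 0] e12[of 0] b c by simp
    show ?thesis using indep[of d e] z a b c by simp
  qed
  \<comment> \<open>Only the components along the three vertices are kept, so they are described
    through the functionals that vanish at \<open>e4\<close> and \<open>e5\<close>.\<close>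
  have "\<forall>p. \<exists>v :: real \<times> real \<times> real. \<forall>f. f \<bullet> e4 = 0 \<longrightarrow> f \<bullet> e5 = 0 \<longrightarrow>
      f \<bullet> X p = fst v * (f \<bullet> X E1) + fst (snd v) * (f \<bullet> X E2) + snd (snd v) * (f \<bullet> X E3)"
  proof
    fix p
    obtain a b c d e where "X p = a *\<^sub>R X E1 + b *\<^sub>R X E2 + c *\<^sub>R X E3 + d *\<^sub>R e4 + e *\<^sub>R e5"
      using r5_combination[OF ind] by blast
    then have "f \<bullet> X p = a * (f \<bullet> X E1) + b * (f \<bullet> X E2) + c * (f \<bullet> X E3)" if "f \<bullet> e4 = 0" "f \<bullet> e5 = 0" for f
      using that by (simp add: inner_add_right)
    then show "\<exists>v :: real \<times> real \<times> real. \<forall>f. f \<bullet> e4 = 0 \<longrightarrow> f \<bullet> e5 = 0 \<longrightarrow>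
      f \<bullet> X p = fst v * (f \<bullet> X E1) + fst (snd v) * (f \<bullet> X E2) + snd (snd v) * (f \<bullet> X E3)"
      by (intro exI[of _ "(a, b, c)"]) simp
  qed
  from choice[OF this] obtain v :: "point \<Rightarrow> real \<times> real \<times> real" where
    v: "\<forall>p f. f \<bullet> e4 = 0 \<longrightarrow> f \<bullet> e5 = 0 \<longrightarrow>
      f \<bullet> X p = fst (v p) * (f \<bullet> X E1) + fst (snd (v p)) * (f \<bullet> X E2) + snd (snd (v p)) * (f \<bullet> X E3)" ..
  define u1 u2 u3 where "u1 p = fst (v p)" and "u2 p = fst (snd (v p))" and "u3 p = snd (snd (v p))" for p
  have u: "f \<bullet> X p = u1 p * (f \<bullet> X E1) + u2 p * (f \<bullet> X E2) + u3 p * (f \<bullet> X E3)"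
    if "f \<bullet> e4 = 0" "f \<bullet> e5 = 0" for p f
    using v that unfolding u1_def u2_def u3_def by blast
  \<comment> \<open>Normalized so that the sign of \<open>h12 k\<close> at a point is that of
    \<open>u1 - x k * u2\<close>, and likewise for the other two pencils.\<close>
  define x y z where "x k = - (h12 k \<bullet> X E2) / (h12 k \<bullet> X E1)" and "y k = - (h23 k \<bullet> X E3) / (h23 k \<bullet> X E2)"
    and "z k = - (h13 k \<bullet> X E3) / (h13 k \<bullet> X E1)" for k
  define y' y'' p q where "y' = (hp \<bullet> X E3) / (hp \<bullet> X E2)" and "y'' = (hq \<bullet> X E3) / (hq \<bullet> X E2)"
    and "p = - (W LS \<bullet> X E2) / (W LS \<bullet> X E1)" and "q = - (W LS \<bullet> X E3) / (W LS \<bullet> X E1)"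
  have xyz: "x k > 0" "y k > 0" "z k > 0" if "k \<le> m" for k
    using e12[OF that] e23[OF that] e13[OF that] by (simp_all add: x_def y_def z_def divide_neg_pos)
  have pq: "y' > 0" "y'' > 0" "p > 0" "q > 0"
    using ep eq es by (simp_all add: y'_def y''_def p_def q_def divide_neg_pos)
  have s12: "h12 k \<bullet> X P = (h12 k \<bullet> X E1) * (u1 P - x k * u2 P)" if "k \<le> m" for k P
    using u[of "h12 k" P] v12[OF that] e12[OF that] by (simp add: x_def field_simps)
  have s23: "h23 k \<bullet> X P = (h23 k \<bullet> X E2) * (u2 P - y k * u3 P)" if "k \<le> m" for k P
    using u[of "h23 k" P] v23[OF that] e23[OF that] by (simp add: y_def field_simps)
  have s13: "h13 k \<bullet> X P = (h13 k \<bullet> X E1) * (u1 P - z k * u3 P)" if "k \<le> m" for k P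
    using u[of "h13 k" P] v13[OF that] e13[OF that] by (simp add: z_def field_simps)
  have sp: "hp \<bullet> X P = (hp \<bullet> X E2) * (u2 P + y' * u3 P)" for P
    using u[of hp P] vp ep by (simp add: y'_def field_simps)
  have sq: "hq \<bullet> X P = (hq \<bullet> X E2) * (u2 P + y'' * u3 P)" for P
    using u[of hq P] vq eq by (simp add: y''_def field_simps)
  have ss: "W LS \<bullet> X P = (W LS \<bullet> X E1) * (u1 P - p * u2 P - q * u3 P)" for P
    using u[of "W LS" P] vs es by (simp add: p_def q_def field_simps)
  have g12: "u1 P > x k * u2 P" if "\<And>s. coef \<eta> (L12 k s) \<bullet> bary P > 0" "k \<le> m" "P \<in> points m" for k P
  proof -
    have "W (L12 k s) \<bullet> X P > 0" for s using that by (intro pos) auto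
    then show ?thesis using P12[of k "X P"] that s12[of k P] e12[of k] by (simp add: zero_less_mult_iff)
  qed
  have l12: "u1 P < x k * u2 P" if "\<And>s. coef \<eta> (L12 k s) \<bullet> bary P < 0" "k \<le> m" "P \<in> points m" for k P
  proof -
    have "W (L12 k s) \<bullet> X P < 0" for s using that by (intro neg) auto
    then show ?thesis using N12[of k "X P"] that s12[of k P] e12[of k] by (simp add: mult_less_0_iff)
  qed
  have g23: "u2 P > y k * u3 P" if "\<And>s. coef \<eta> (L23 k s) \<bullet> bary P > 0" "k \<le> m" "P \<in> points m" for k P
  proof -
    have "W (L23 k s) \<bullet> X P > 0" for s using that by (intro pos) auto
    then show ?thesis using P23[of k "X P"] that s23[of k P] e23[of k] by (simp add: zero_less_mult_iff)
  qed
  have l23: "u2 P < y k * u3 P" if "\<And>s. coef \<eta> (L23 k s) \<bullet> bary P < 0" "k \<le> m" "P \<in> points m" for k P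
  proof -
    have "W (L23 k s) \<bullet> X P < 0" for s using that by (intro neg) auto
    then show ?thesis using N23[of k "X P"] that s23[of k P] e23[of k] by (simp add: mult_less_0_iff)
  qed
  have g13: "u1 P > z k * u3 P" if "\<And>s. coef \<eta> (L13 k s) \<bullet> bary P > 0" "k \<le> m" "P \<in> points m" for k P
  proof -
    have "W (L13 k s) \<bullet> X P > 0" for s using that by (intro pos) auto
    then show ?thesis using P13[of k "X P"] that s13[of k P] e13[of k] by (simp add: zero_less_mult_iff)
  qed
  have l13: "u1 P < z k * u3 P" if "\<And>s. coef \<eta> (L13 k s) \<bullet> bary P < 0" "k \<le> m" "P \<in> points m" for k P
  proof -
    have "W (L13 k s) \<bullet> X P < 0" for s using that by (intro neg) auto
    then show ?thesis using N13[of k "X P"] that s13[of k P] e13[of k] by (simp add: mult_less_0_iff)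
  qed
  have gp: "u2 P + y' * u3 P > 0" if "\<And>s. coef \<eta> (LP s) \<bullet> bary P > 0" "P \<in> points m" for P
  proof -
    have "W (LP s) \<bullet> X P > 0" for s using that by (intro pos) auto
    then show ?thesis using PP[of "X P"] that sp[of P] ep by (simp add: zero_less_mult_iff)
  qed
  have lp: "u2 P + y' * u3 P < 0" if "\<And>s. coef \<eta> (LP s) \<bullet> bary P < 0" "P \<in> points m" for P
  proof -
    have "W (LP s) \<bullet> X P < 0" for s using that by (intro neg) auto
    then show ?thesis using NP[of "X P"] that sp[of P] ep by (simp add: mult_less_0_iff)
  qed
  have gq: "u2 P + y'' * u3 P > 0" if "\<And>s. coef \<eta> (LQ s) \<bullet> bary P > 0" "P \<in> points m" for P
  proof -
    have "W (LQ s) \<bullet> X P > 0" for s using that by (intro pos) auto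
    then show ?thesis using PQ[of "X P"] that sq[of P] eq by (simp add: zero_less_mult_iff)
  qed
  have lq: "u2 P + y'' * u3 P < 0" if "\<And>s. coef \<eta> (LQ s) \<bullet> bary P < 0" "P \<in> points m" for P
  proof -
    have "W (LQ s) \<bullet> X P < 0" for s using that by (intro neg) auto
    then show ?thesis using NQ[of "X P"] that sq[of P] eq by (simp add: mult_less_0_iff)
  qed
  have gs: "u1 P > p * u2 P + q * u3 P" if "coef \<eta> LS \<bullet> bary P > 0" "P \<in> points m" for P
    using pos[of LS P] that ss[of P] es by (simp add: zero_less_mult_iff)
  have ls: "u1 P < p * u2 P + q * u3 P" if "coef \<eta> LS \<bullet> bary P < 0" "P \<in> points m" for P
    using neg[of LS P] that ss[of P] es by (simp add: mult_less_0_iff)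
  have calc: "lev k \<ge> 1" "lev k \<le> lev k * lev k" "0 \<le> \<eta> * (lev k * lev k)" "64 * (\<eta> * (lev k * lev k)) < 1"
    "0 \<le> \<eta> * lev k" "\<eta> * lev k \<le> \<eta> * (lev k * lev k)" "200 * \<eta> < 1" "0 < \<eta>" if "k < m" for k
    using sc[of k] sc2[of k, unfolded power2_eq_square] \<eta>2[OF that, unfolded power2_eq_square] \<eta>1 \<eta>(1) by auto
  have A: "z k > x k * y k" if k: "k < m" for k
  proof (rule growth_a[where y' = y'])
    show "x k * u2 (PA k) < u1 (PA k)"
    proof (rule g12)
      fix s show "coef \<eta> (L12 k s) \<bullet> bary (PA k) > 0" by (cases s; simp add: algebra_simps power2_eq_square; use calc[OF k] in linarith)
    qed (use k in auto)
    show "y k * u3 (PA k) < u2 (PA k)"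
    proof (rule g23)
      fix s show "coef \<eta> (L23 k s) \<bullet> bary (PA k) > 0" by (cases s; simp add: algebra_simps power2_eq_square; use calc[OF k] in linarith)
    qed (use k in auto)
    show "u1 (PA k) < z k * u3 (PA k)"
    proof (rule l13)
      fix s show "coef \<eta> (L13 k s) \<bullet> bary (PA k) < 0" by (cases s; simp add: algebra_simps power2_eq_square; use calc[OF k] in linarith)
    qed (use k in auto)
    show "0 < u2 (PA k) + y' * u3 (PA k)"
    proof (rule gp)
      fix s show "coef \<eta> (LP s) \<bullet> bary (PA k) > 0" by (cases s; simp add: algebra_simps power2_eq_square; use calc[OF k] in linarith)
    qed (use k in auto)
  qed (use xyz pq k in auto)
  have b1: "u1 (PB k) > z k * u3 (PB k)" if k: "k < m" for k
    proof (rule g13)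
      fix s show "coef \<eta> (L13 k s) \<bullet> bary (PB k) > 0" by (cases s; simp add: algebra_simps power2_eq_square; use calc[OF k] in linarith)
    qed (use k in auto)
  have b2: "u2 (PB k) < y 0 * u3 (PB k)" if k: "k < m" for k
    proof (rule l23)
      fix s show "coef \<eta> (L23 0 s) \<bullet> bary (PB k) < 0" by (cases s; simp add: algebra_simps power2_eq_square; use calc[OF k] in linarith)
    qed (use k in auto)
  have b3: "u1 (PB k) < x (Suc k) * u2 (PB k)" if k: "k < m" for k
    proof (rule l12)
      fix s show "coef \<eta> (L12 (Suc k) s) \<bullet> bary (PB k) < 0" by (cases s; simp add: algebra_simps power2_eq_square; use calc[OF k] in linarith)
    qed (use k in auto)
  have b4: "u2 (PB k) + y' * u3 (PB k) > 0" if k: "k < m" for k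
    proof (rule gp)
      fix s show "coef \<eta> (LP s) \<bullet> bary (PB k) > 0" by (cases s; simp add: algebra_simps power2_eq_square; use calc[OF k] in linarith)
    qed (use k in auto)
  have B: "x (Suc k) * y 0 > z k" if k: "k < m" for k
    using growth_b[OF _ _ _ _ b1 b2 b3 b4] xyz pq k by simp
  have C: "x 0 * y (Suc k) > z k" if k: "k < m" for k
  proof (rule growth_c[where y' = y'])
    show "z k * u3 (PC k) < u1 (PC k)"
    proof (rule g13)
      fix s show "coef \<eta> (L13 k s) \<bullet> bary (PC k) > 0" by (cases s; simp add: algebra_simps power2_eq_square; use calc[OF k] in linarith)
    qed (use k in auto)
    show "u1 (PC k) < x 0 * u2 (PC k)"
    proof (rule l12)
      fix s show "coef \<eta> (L12 0 s) \<bullet> bary (PC k) < 0" by (cases s; simp add: algebra_simps power2_eq_square; use calc[OF k] in linarith)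
    qed (use k in auto)
    show "u2 (PC k) < y (Suc k) * u3 (PC k)"
    proof (rule l23)
      fix s show "coef \<eta> (L23 (Suc k) s) \<bullet> bary (PC k) < 0" by (cases s; simp add: algebra_simps power2_eq_square; use calc[OF k] in linarith)
    qed (use k in auto)
    show "0 < u2 (PC k) + y' * u3 (PC k)"
    proof (rule gp)
      fix s show "coef \<eta> (LP s) \<bullet> bary (PC k) > 0" by (cases s; simp add: algebra_simps power2_eq_square; use calc[OF k] in linarith)
    qed (use k in auto)
  qed (use xyz pq k in auto)
  have p: "p > x 0"
  proof (rule slope_bound[where ?y0.0 = "y 0" and y' = y' and y'' = y'' and q = q])
    show "x 0 * u2 D1 < u1 D1" using \<eta>1 \<eta>(1) by (intro g12) auto
    show "y 0 * u3 D1 < u2 D1" using \<eta>1 \<eta>(1) by (intro g23) auto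
    show "u1 D1 < p * u2 D1 + q * u3 D1" by (intro ls) auto
    show "u2 D1 + y' * u3 D1 < 0" using \<eta>1 \<eta>(1) by (intro lp) auto
    show "0 < u2 D1 + y'' * u3 D1" using \<eta>1 \<eta>(1) by (intro gq) auto
  qed (use xyz pq in auto)
  have q: "q > z 0"
  proof (rule intercept_bound[where ?y0.0 = "y 0" and y' = y' and y'' = y'' and p = p])
    show "z 0 * u3 D2 < u1 D2" using \<eta>1 \<eta>(1) by (intro g13) auto
    show "u2 D2 < y 0 * u3 D2" using \<eta>1 \<eta>(1) by (intro l23) auto
    show "u1 D2 < p * u2 D2 + q * u3 D2" by (intro ls) auto
    show "u2 D2 + y'' * u3 D2 < 0" using \<eta>1 \<eta>(1) by (intro lq) auto
    show "0 < u2 D2 + y' * u3 D2" using \<eta>1 \<eta>(1) by (intro gp) auto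
  qed (use xyz pq in auto)
  have D: "x 1 > 2 * x 0"
  proof (rule doubling[where ?y0.0 = "y 0" and y' = y', OF _ _ _ _ _ p q])
    show "u1 (PB 0) > z 0 * u3 (PB 0)" "u2 (PB 0) < y 0 * u3 (PB 0)" "u2 (PB 0) + y' * u3 (PB 0) > 0"
      using b1[of 0] b2[of 0] b4[of 0] m by auto
    show "u1 (PB 0) < x 1 * u2 (PB 0)" using b3[of 0] m by simp
    show "p * u2 (PB 0) + q * u3 (PB 0) < u1 (PB 0)" using m by (intro gs) auto
    show "x 0 * y 0 < z 0" using A[of 0] m by simp
  qed (use xyz pq m in auto)
  show "H 0 \<bullet> X E1 > 0" "H 0 \<bullet> X E2 < 0" "H m \<bullet> X E1 > 0" "H m \<bullet> X E2 < 0"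
    using e12[of 0] e12[of m] by (simp_all add: H_def h12_def)
  show "(H m \<bullet> X E2) * (H 0 \<bullet> X E1) \<le> 2 ^ 2 ^ j * ((H 0 \<bullet> X E2) * (H m \<bullet> X E1))" if j: "Suc (Suc j) = m"
  proof -
    have "x (Suc (Suc j)) \<ge> 2 ^ 2 ^ j * x 0 \<and> y (Suc (Suc j)) \<ge> 2 ^ 2 ^ j * y 0"
      by (rule double_exponential_growth[where m = m and z = z])
        (fact D A B C xyz(1)[OF le0] xyz(2)[OF le0] | use j in simp)+
    then have growth: "2 ^ 2 ^ j * (- (h12 0 \<bullet> X E2) / (h12 0 \<bullet> X E1)) \<le> - (h12 m \<bullet> X E2) / (h12 m \<bullet> X E1)"
      using j by (simp only: x_def)
    have clear: "am * b0 \<le> E * (a0 * bm)" if "E * (- a0 / b0) \<le> - am / bm" "b0 > 0" "bm > 0" for a0 b0 am bm E :: real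
      using that by (simp add: field_simps)
    have eq: "H 0 = h12 0" "H m = h12 m" by (simp_all only: H_def h12_def)
    show ?thesis unfolding eq by (rule clear[OF growth]) (simp_all add: e12)
  qed
qed

section \<open>Disk graphs without small integer realizations\<close>

lemma int_bounded_disk_form:
  assumes "\<And>i. c $ i \<in> \<int>" "r \<in> \<int>" "r > 0" "\<And>i. \<bar>c $ i\<bar> + r \<le> K"
    and "\<And>i. c' $ i \<in> \<int>" "r' \<in> \<int>" "r' > 0" "\<And>i. \<bar>c' $ i\<bar> + r' \<le> K"
  shows "int_bounded (8 * K\<^sup>2) (disk_form c r c' r')"
proof -
  have int: "disk_form c r c' r' \<in> \<int>" unfolding disk_form_def using assms by (intro Ints_diff Ints_power Ints_add) auto
  have "(r + r')\<^sup>2 \<le> (2 * K)\<^sup>2"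
    using assms(3,7) assms(4)[of 1] assms(8)[of 1] by (intro power_mono) auto
  moreover have "(c $ i - c' $ i)\<^sup>2 \<le> (2 * K)\<^sup>2" for i
  proof -
    have "\<bar>c $ i - c' $ i\<bar> \<le> \<bar>2 * K\<bar>" using assms(3,7) assms(4)[of i] assms(8)[of i] by linarith
    then show ?thesis by (simp only: abs_le_square_iff)
  qed
  moreover have "(2 * K)\<^sup>2 = 4 * K\<^sup>2" by simp
  ultimately have "\<bar>disk_form c r c' r'\<bar> \<le> 8 * K\<^sup>2"
    unfolding disk_form_def abs_le_iff
    using zero_le_power2[of "r + r'"] zero_le_power2[of "c $ 1 - c' $ 1"] zero_le_power2[of "c $ 2 - c' $ 2"]
    by (smt (verit))
  with int show ?thesis by (simp add: int_bounded_def)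
qed

definition names :: "nat \<Rightarrow> (point, line) name set" where
  "names m = Point ` points m \<union> (\<lambda>(l, s, R). Side l s R) ` (lines m \<times> UNIV \<times> UNIV) \<union> {Wide, Far}"

lemma names_iff [simp]:
  "Point p \<in> names m \<longleftrightarrow> p \<in> points m" "Side l s R \<in> names m \<longleftrightarrow> l \<in> lines m" "Wide \<in> names m" "Far \<in> names m"
  by (force simp: names_def image_iff)+

lemma finite_points: "finite (points m)" and finite_lines: "finite (lines m)"
  by (auto simp: points_def lines_def)

lemma finite_names: "finite (names m)"
  by (auto simp: names_def finite_points finite_lines)

lemma card_names: "card (names m) \<le> 27 * m + 51"
proof -
  have p: "card (points m) \<le> 5 + 3 * m"
  proof -
    have "card (points m) \<le> card {E1, E2, E3, D1, D2} + card (PA ` {..<m}) + card (PB ` {..<m}) + card (PC ` {..<m})"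
      unfolding points_def by (intro card_Un_le[THEN order.trans] add_mono order.refl)
    also have "\<dots> \<le> 5 + m + m + m"
      by (intro add_mono order.trans[OF card_image_le]) (auto simp: card_insert_if)
    finally show ?thesis by simp
  qed
  have l: "card (lines m) \<le> 6 * m + 11"
  proof -
    let ?I = "{..m} \<times> (UNIV :: bool set)"
    have "card (lines m) \<le> card {LS} + card (range LP) + card (range LQ) + card ((\<lambda>(k, s). L12 k s) ` ?I)
        + card ((\<lambda>(k, s). L23 k s) ` ?I) + card ((\<lambda>(k, s). L13 k s) ` ?I)"
      unfolding lines_def by (intro card_Un_le[THEN order.trans] add_mono order.refl)
    also have "\<dots> \<le> 1 + 2 + 2 + 2 * Suc m + 2 * Suc m + 2 * Suc m"
      by (intro add_mono order.trans[OF card_image_le]) auto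
    finally show ?thesis by simp
  qed
  have "card (names m) \<le> card (Point ` points m :: (point, line) name set)
      + card ((\<lambda>(l, s, R). Side l s R) ` (lines m \<times> UNIV \<times> UNIV) :: (point, line) name set)
      + card {Wide, Far :: (point, line) name}"
    unfolding names_def by (intro card_Un_le[THEN order.trans] add_mono order.refl)
  also have "\<dots> \<le> card (points m) + card (lines m \<times> (UNIV :: bool set) \<times> (UNIV :: bool set)) + 2"
    by (intro add_mono card_image_le) (auto simp: finite_points finite_lines)
  also have "\<dots> \<le> (5 + 3 * m) + (6 * m + 11) * 4 + 2"
    using p l by (simp add: card_cartesian_product)
  finally show ?thesis by simp
qed

text \<open>The ratio of the slopes at levels \<open>m\<close> and 0 is a quotient of products of
  integers with nonzero denominator, so its size is bounded by the numerator. Each elimination turns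
  a bound \<open>B\<close> into \<open>2 * B\<^sup>2\<close>; two of them make \<open>W\<close> and
  a third makes \<open>H\<close>, whence \<open>128 * B ^ 8\<close>.\<close>

lemma integer_disks_large:
  fixes c :: "(point, line) name \<Rightarrow> real ^ 2"
  assumes m: "m \<ge> 2" and \<eta>: "\<eta> > 0" "\<And>k. k < m \<Longrightarrow> \<eta> * (64 * (lev k)\<^sup>2 + 200) < 1"
    and int: "\<And>v i. v \<in> names m \<Longrightarrow> c v $ i \<in> \<int>" "\<And>v. v \<in> names m \<Longrightarrow> r v \<in> \<int>"
    and box: "\<And>v. v \<in> names m \<Longrightarrow> r v > 0" "\<And>v i. v \<in> names m \<Longrightarrow> \<bar>c v $ i\<bar> + r v \<le> K"
    and adj: "\<And>l p s R. l \<in> lines m \<Longrightarrow> p \<in> points m \<Longrightarrow> coef \<eta> l \<bullet> bary p \<noteq> 0 \<Longrightarrow>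
       disk_form (c (Side l s R)) (r (Side l s R)) (c (Point p)) (r (Point p)) > 0 \<longleftrightarrow> (coef \<eta> l \<bullet> bary p > 0 \<longleftrightarrow> s)"
      "\<And>l s R. l \<in> lines m \<Longrightarrow> disk_form (c (Side l s R)) (r (Side l s R)) (c Wide) (r Wide) > 0"
      "\<And>l s R. l \<in> lines m \<Longrightarrow> disk_form (c (Side l s R)) (r (Side l s R)) (c Far) (r Far) > 0 \<longleftrightarrow> R"
  shows "2 ^ 2 ^ (m - 2) \<le> (128 * (8 * K\<^sup>2) ^ 8)\<^sup>2"
proof -
  define L where "L v = lift (c v) (r v)" for v
  define A where "A l s R = dual (c (Side l s R)) (r (Side l s R))" for l s R
  define W where "W l = line_fun (L Wide) (L Far) (A l True True) (A l True False) (A l False True) (A l False False)" for l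
  define H where "H k = elim (L (Point E3)) (W (L12 k True)) (W (L12 k False))" for k
  define B where "B = 8 * K\<^sup>2"
  have AL: "A l s R \<bullet> L v = disk_form (c (Side l s R)) (r (Side l s R)) (c v) (r v)" for l s R v
    by (simp add: A_def L_def disk_form_inner)
  have bA: "int_bounded B (A l s R \<bullet> L v)" if "l \<in> lines m" "v \<in> names m" for l s R v
    unfolding AL B_def using that int box by (intro int_bounded_disk_form) auto
  have bW: "int_bounded (8 * B ^ 4) (W l \<bullet> L v)" if "l \<in> lines m" "v \<in> names m" for l v
  proof -
    have "int_bounded (2 * (2 * B\<^sup>2)\<^sup>2) (W l \<bullet> L v)"
      unfolding W_def line_fun_def using that by (intro int_bounded_elim bA) auto
    then show ?thesis by (simp add: power_mult_distrib flip: power_mult)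
  qed
  have lines: "L12 k s \<in> lines m" if "k \<le> m" for k s using that by (auto simp: lines_def)
  have points: "E1 \<in> points m" "E2 \<in> points m" "E3 \<in> points m" by (auto simp: points_def)
  have bH: "int_bounded (128 * B ^ 8) (H k \<bullet> L (Point p))" if "k \<le> m" "p \<in> points m" for k p
  proof -
    have "int_bounded (2 * (8 * B ^ 4)\<^sup>2) (H k \<bullet> L (Point p))"
      unfolding H_def using that points by (intro int_bounded_elim bW lines) auto
    then show ?thesis by (simp add: power_mult_distrib flip: power_mult)
  qed
  have LS: "LS \<in> lines m" by (auto simp: lines_def)
  have wide: "A l s R \<bullet> L Wide > 0" if "l \<in> lines m" for l s R using adj(2)[OF that] by (simp add: AL)
  have far: "A l s True \<bullet> L Far > 0" "A l s False \<bullet> L Far \<le> 0" if "l \<in> lines m" for l s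
    using adj(3)[OF that, of s True] adj(3)[OF that, of s False] by (simp_all add: AL)
  \<comment> \<open>Both lifts have first coordinate 1, so dependent lifts would be equal; but a
    small side disk meets \<open>Wide\<close> and not \<open>Far\<close>.\<close>
  have indep: "a = 0 \<and> b = 0" if z: "a *\<^sub>R L Wide + b *\<^sub>R L Far = 0" for a b
  proof -
    have "a + b = 0" using arg_cong[OF z, of fst] by (simp add: L_def lift_def)
    moreover have "a * (A LS True False \<bullet> L Wide) + b * (A LS True False \<bullet> L Far) = 0"
      using arg_cong[OF z, of "\<lambda>x. A LS True False \<bullet> x"] by (simp add: inner_add_right)
    ultimately have "a * (A LS True False \<bullet> L Wide - A LS True False \<bullet> L Far) = 0"
      by (simp add: algebra_simps add_eq_0_iff2)
    moreover have "A LS True False \<bullet> L Wide - A LS True False \<bullet> L Far > 0"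
      using wide[OF LS, of True False] far(2)[OF LS, of True] by linarith
    ultimately show ?thesis using \<open>a + b = 0\<close> by simp
  qed
  have side: "A l s R \<bullet> L (Point p) > 0 \<longleftrightarrow> (coef \<eta> l \<bullet> bary p > 0 \<longleftrightarrow> s)"
    if "l \<in> lines m" "p \<in> points m" "coef \<eta> l \<bullet> bary p \<noteq> 0" for l p s R
    using adj(1)[OF that] by (simp add: AL)
  have F: "H 0 \<bullet> L (Point E2) < 0" "H m \<bullet> L (Point E1) > 0"
    "(H m \<bullet> L (Point E2)) * (H 0 \<bullet> L (Point E1)) \<le> 2 ^ 2 ^ (m - 2) * ((H 0 \<bullet> L (Point E2)) * (H m \<bullet> L (Point E1)))"
  proof -
    have v: "W l \<bullet> L Wide = 0 \<and> W l \<bullet> L Far = 0" if "l \<in> lines m" for l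
      by (simp add: W_def line_fun_vanish)
    have pos: "W l \<bullet> L (Point p) > 0" if "l \<in> lines m" "p \<in> points m" "coef \<eta> l \<bullet> bary p > 0" for l p
      unfolding W_def using side[OF that(1,2), of True] side[OF that(1,2), of False] that wide far
      by (intro line_fun_sign(1)) (auto simp: not_less[symmetric])
    have neg: "W l \<bullet> L (Point p) < 0" if "l \<in> lines m" "p \<in> points m" "coef \<eta> l \<bullet> bary p < 0" for l p
      unfolding W_def using side[OF that(1,2), of True] side[OF that(1,2), of False] that wide far
      by (intro line_fun_sign(2)) (auto simp: not_less[symmetric])
    have m1: "1 \<le> m" and m2: "Suc (Suc (m - 2)) = m" using m by auto
    note f = forcing[where W = W and X = "\<lambda>p. L (Point p)" and m = m and \<eta> = \<eta> and ?e4.0 = "L Wide" and ?e5.0 = "L Far", folded H_def]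
    show "H 0 \<bullet> L (Point E2) < 0" by (rule f(2)) (fact m1 \<eta> v indep pos neg)+
    show "H m \<bullet> L (Point E1) > 0" by (rule f(3)) (fact m1 \<eta> v indep pos neg)+
    show "(H m \<bullet> L (Point E2)) * (H 0 \<bullet> L (Point E1)) \<le> 2 ^ 2 ^ (m - 2) * ((H 0 \<bullet> L (Point E2)) * (H m \<bullet> L (Point E1)))"
      by (rule f(5)) (fact m1 m2 \<eta> v indep pos neg)+
  qed
  have b: "H k \<bullet> L (Point E1) \<in> \<int>" "H k \<bullet> L (Point E2) \<in> \<int>" "\<bar>H k \<bullet> L (Point E1)\<bar> \<le> 128 * B ^ 8" "\<bar>H k \<bullet> L (Point E2)\<bar> \<le> 128 * B ^ 8"
    if "k \<le> m" for k
    using bH[OF that points(1)] bH[OF that points(2)] by (simp_all add: int_bounded_def)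
  have "1 \<le> \<bar>H 0 \<bullet> L (Point E2)\<bar>"
    by (rule Ints_nonzero_abs_ge1[OF b(2)]) (use F(1) in auto)
  moreover have "1 \<le> \<bar>H m \<bullet> L (Point E1)\<bar>"
    by (rule Ints_nonzero_abs_ge1[OF b(1)]) (use F(2) in auto)
  ultimately have "1 * 1 \<le> \<bar>H 0 \<bullet> L (Point E2)\<bar> * \<bar>H m \<bullet> L (Point E1)\<bar>" by (intro mult_mono) auto
  then have "2 ^ 2 ^ (m - 2) \<le> 2 ^ 2 ^ (m - 2) * (\<bar>H 0 \<bullet> L (Point E2)\<bar> * \<bar>H m \<bullet> L (Point E1)\<bar>)" by simp
  also have "\<dots> = - (2 ^ 2 ^ (m - 2) * ((H 0 \<bullet> L (Point E2)) * (H m \<bullet> L (Point E1))))"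
    using F(1,2) by simp
  also have "\<dots> \<le> - ((H m \<bullet> L (Point E2)) * (H 0 \<bullet> L (Point E1)))" using F(3) by simp
  also have "\<dots> \<le> \<bar>H m \<bullet> L (Point E2)\<bar> * \<bar>H 0 \<bullet> L (Point E1)\<bar>" by (simp flip: abs_mult)
  also have "\<dots> \<le> (128 * B ^ 8) * (128 * B ^ 8)" using b[of 0] b[of m] by (intro mult_mono) auto
  finally show ?thesis by (simp only: B_def power2_eq_square[of "128 * _"])
qed

section \<open>From intersection patterns to graphs and boxes\<close>

text \<open>The box is closed, so it contains the closed disk and hence its extreme points in each
  axis direction.\<close>

lemma abs_centre_add_radius_le:
  fixes c :: "real ^ 2"
  assumes "ball c r \<subseteq> cbox (\<chi> i. - k) (\<chi> i. k)" "r > 0"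
  shows "\<bar>c $ i\<bar> + r \<le> k"
proof -
  have "cball c r \<subseteq> cbox (\<chi> i. - k) (\<chi> i. k)"
    using closure_minimal[OF assms(1) closed_cbox] assms(2) by simp
  moreover have "c + t *\<^sub>R axis i 1 \<in> cball c r" if "\<bar>t\<bar> = r" for t
    using that by (simp add: dist_norm)
  ultimately have "c + t *\<^sub>R axis i 1 \<in> cbox (\<chi> i. - k) (\<chi> i. k)" if "\<bar>t\<bar> = r" for t
    using that by blast
  then have "- k \<le> (c + t *\<^sub>R axis i 1) $ i \<and> (c + t *\<^sub>R axis i 1) $ i \<le> k" if "\<bar>t\<bar> = r" for t
    using that unfolding mem_box_cart by (metis vec_lambda_beta)
  then have "- k \<le> c $ i + t \<and> c $ i + t \<le> k" if "\<bar>t\<bar> = r" for t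
    using that by (simp add: axis_def)
  from this[of r] this[of "- r"] show ?thesis using assms(2) by auto
qed

lemma box_size_attained:
  assumes "finite V" "\<And>v. v \<in> V \<Longrightarrow> open_disk (A v)" "v \<in> V"
  shows "A v \<subseteq> cbox (\<chi> i. - real (box_size (A ` V))) (\<chi> i. real (box_size (A ` V)))"
proof -
  have "bounded (\<Union> (A ` V))"
  proof (intro bounded_Union ballI)
    fix D assume "D \<in> A ` V"
    then have "open_disk D" using assms(2) by auto
    then show "bounded D" by (auto simp: open_disk_def)
  qed (use assms(1) in simp)
  then obtain b where b: "\<And>x. x \<in> \<Union> (A ` V) \<Longrightarrow> norm x \<le> b" by (auto simp: bounded_iff)
  have "\<forall>D\<in>A ` V. D \<subseteq> cbox (\<chi> i. - real (nat \<lceil>b\<rceil>)) (\<chi> i. real (nat \<lceil>b\<rceil>))"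
  proof (intro ballI subsetI)
    fix D x assume "D \<in> A ` V" "x \<in> D"
    then have "norm x \<le> b" using b by blast
    then have "\<bar>x $ i\<bar> \<le> real (nat \<lceil>b\<rceil>)" for i
      using component_le_norm_cart[of x i] by linarith
    then show "x \<in> cbox (\<chi> i. - real (nat \<lceil>b\<rceil>)) (\<chi> i. real (nat \<lceil>b\<rceil>))"
      by (simp add: mem_box_cart abs_le_iff minus_le_iff)
  qed
  then have "\<forall>D\<in>A ` V. D \<subseteq> cbox (\<chi> i. - real (box_size (A ` V))) (\<chi> i. real (box_size (A ` V)))"
    unfolding box_size_def by (rule LeastI)
  then show ?thesis using assms(3) by blast
qed

lemma disk_graph_intersection_graph:
  assumes "finite V" "\<And>v. v \<in> V \<Longrightarrow> open_disk (D v)"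
  shows "disk_graph (intersection_graph V D)"
proof -
  let ?G = "intersection_graph V D"
  have "parcs ?G \<subseteq> V \<times> V" by (auto simp: intersection_graph_def)
  then have "finite (parcs ?G)" using assms(1) by (meson finite_SigmaI finite_subset)
  then have "pair_graph ?G"
    using assms(1)
    by unfold_locales (auto simp: intersection_graph_def symmetric_def sym_def)
  moreover have "realizes D ?G" by (simp add: realizes_def intersection_graph_def)
  ultimately show ?thesis
    unfolding disk_graph_def using assms(2) by (auto simp: intersection_graph_def)
qed

lemma perturbation_exists:
  obtains \<eta> :: real where "\<eta> > 0" "\<eta> < 1" "\<And>k. k < m \<Longrightarrow> \<eta> * (64 * (lev k)\<^sup>2 + 200) < 1"
proof -
  define S where "S = (\<Sum>k<m. 64 * (lev k)\<^sup>2 + 200)"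
  have S: "S \<ge> 0" unfolding S_def by (intro sum_nonneg) auto
  have le: "64 * (lev k)\<^sup>2 + 200 \<le> S" if "k < m" for k
    unfolding S_def using that by (intro member_le_sum[of k "{..<m}" "\<lambda>k. 64 * (lev k)\<^sup>2 + 200"]) auto
  show thesis
  proof
    show "1 / (S + 2) > 0" "1 / (S + 2) < 1" using S by simp_all
    show "1 / (S + 2) * (64 * (lev k)\<^sup>2 + 200) < 1" if "k < m" for k
      using S le[OF that] by simp
  qed
qed

text \<open>The graph is read off from the constructed disks, so pairs on which the construction
  makes no claim have whatever adjacency results. An integer realization reproduces all of it, in
  particular the adjacencies that the forcing argument needs.\<close>

lemma hard_graph:
  assumes m: "m \<ge> 2" and n: "27 * m + 51 \<le> n"
  obtains G where "G \<in> DG n"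
    "\<And>A K. integer_DG_realization A G \<Longrightarrow> (\<And>v. v \<in> pverts G \<Longrightarrow> A v \<subseteq> cbox (\<chi> i. - K) (\<chi> i. K)) \<Longrightarrow>
       2 ^ 2 ^ (m - 2) \<le> (128 * (8 * K\<^sup>2) ^ 8)\<^sup>2"
proof -
  obtain \<eta> :: real where \<eta>: "\<eta> > 0" "\<eta> < 1" "\<And>k. k < m \<Longrightarrow> \<eta> * (64 * (lev k)\<^sup>2 + 200) < 1"
    using perturbation_exists[of m] by blast
  \<comment> \<open>Passage to an affine chart: the coordinate sum \<open>w\<close> is positive for
    every point, \<open>D1\<close> and \<open>D2\<close> included. Dividing by it and eliminating
    the third coordinate turns \<open>coef\<close> into \<open>h\<close> without a change of
    sign.\<close>
  define w where "w p = fst (bary p) + fst (snd (bary p)) + snd (snd (bary p))" for p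
  define P where "P p = (fst (bary p) / w p, fst (snd (bary p)) / w p)" for p
  define h where "h l = (fst (coef \<eta> l) - snd (snd (coef \<eta> l)), fst (snd (coef \<eta> l)) - snd (snd (coef \<eta> l)), snd (snd (coef \<eta> l)))" for l
  have lev_pos: "lev k > 0" for k using lev_ge_1[of k] by linarith
  have w: "w p > 0" for p
    using lev_pos by (cases p) (auto simp: w_def less_imp_neq[symmetric] intro!: add_nonneg_pos add_nonneg_nonneg less_imp_le[OF lev_pos])
  have lev2: "8 * (lev k)\<^sup>2 \<ge> 8" for k using one_le_power[OF lev_ge_1, of k 2] by simp
  \<comment> \<open>No line is vertical in this chart; for \<open>L12\<close> and \<open>L13\<close>
    this is where \<open>\<eta> < 1\<close> enters.\<close>
  have nv: "fst (snd (h l)) \<noteq> 0" for l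
    using \<eta>(1,2)
  proof (cases l)
    case (L12 k s)
    then show ?thesis using \<eta>(1,2) lev_ge_1[of k] by (auto simp: h_def)
  next
    case (L23 k s)
    then show ?thesis using \<eta>(1,2) lev_ge_1[of k] by (auto simp: h_def)
  next
    case (L13 k s)
    then show ?thesis using \<eta>(1,2) lev2[of k] by (auto simp: h_def)
  qed (auto simp: h_def)
  have val: "fst (h l) * fst (P p) + fst (snd (h l)) * snd (P p) + snd (snd (h l)) = (coef \<eta> l \<bullet> bary p) / w p" for l p
  proof -
    obtain a1 a2 a3 where a: "coef \<eta> l = (a1, a2, a3)" by (cases "coef \<eta> l") auto
    obtain u1 u2 u3 where u: "bary p = (u1, u2, u3)" by (cases "bary p") auto
    have wp: "w p \<noteq> 0" using w[of p] by simp
    have "(a1 - a3) * (u1 / w p) + (a2 - a3) * (u2 / w p) + a3 = ((a1 - a3) * u1 + (a2 - a3) * u2 + a3 * w p) / w p"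
      using wp by (simp add: add_divide_distrib)
    also have "(a1 - a3) * u1 + (a2 - a3) * u2 + a3 * w p = a1 * u1 + a2 * u2 + a3 * u3"
      by (simp add: w_def u algebra_simps)
    finally show ?thesis by (simp add: h_def P_def a u add.assoc)
  qed
  obtain c :: "(point, line) name \<Rightarrow> real ^ 2" and r where r: "\<And>v. r v > 0"
    and adj: "\<And>l p s R. l \<in> lines m \<Longrightarrow> p \<in> points m \<Longrightarrow> coef \<eta> l \<bullet> bary p \<noteq> 0 \<Longrightarrow>
       disk_form (c (Side l s R)) (r (Side l s R)) (c (Point p)) (r (Point p)) > 0 \<longleftrightarrow> (coef \<eta> l \<bullet> bary p > 0 \<longleftrightarrow> s)"
      "\<And>l s R. l \<in> lines m \<Longrightarrow> disk_form (c (Side l s R)) (r (Side l s R)) (c Wide) (r Wide) > 0"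
      "\<And>l s R. l \<in> lines m \<Longrightarrow> disk_form (c (Side l s R)) (r (Side l s R)) (c Far) (r Far) > 0 \<longleftrightarrow> R"
  proof (rule line_disks_exist[OF finite_points[of m] finite_lines[of m], of h P])
    show "fst (snd (h l)) \<noteq> 0" for l by (rule nv)
    fix r :: "(point, line) name \<Rightarrow> real" and c
    assume r: "\<And>v. r v > 0"
      and 1: "\<And>l p s R. l \<in> lines m \<Longrightarrow> p \<in> points m \<Longrightarrow> fst (h l) * fst (P p) + fst (snd (h l)) * snd (P p) + snd (snd (h l)) \<noteq> 0 \<Longrightarrow>
       disk_form (c (Side l s R)) (r (Side l s R)) (c (Point p)) (r (Point p)) > 0 \<longleftrightarrow>
         (fst (h l) * fst (P p) + fst (snd (h l)) * snd (P p) + snd (snd (h l)) > 0 \<longleftrightarrow> s)"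
      and 2: "\<And>l s R. l \<in> lines m \<Longrightarrow> disk_form (c (Side l s R)) (r (Side l s R)) (c Wide) (r Wide) > 0"
      "\<And>l s R. l \<in> lines m \<Longrightarrow> disk_form (c (Side l s R)) (r (Side l s R)) (c Far) (r Far) > 0 \<longleftrightarrow> R"
    show thesis
    proof (rule that[OF r _ 2])
      fix l p s R assume "l \<in> lines m" "p \<in> points m" "coef \<eta> l \<bullet> bary p \<noteq> 0"
      then show "disk_form (c (Side l s R)) (r (Side l s R)) (c (Point p)) (r (Point p)) > 0 \<longleftrightarrow> (coef \<eta> l \<bullet> bary p > 0 \<longleftrightarrow> s)"
        using 1[of l p s R] w[of p] unfolding val by (simp add: zero_less_divide_iff)
    qed
  qed
  have "card (names m) \<le> card {..<n}" using card_names[of m] n by simp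
  then obtain f :: "(point, line) name \<Rightarrow> nat" where f: "f ` names m \<subseteq> {..<n}" "inj_on f (names m)"
    using card_le_inj[OF finite_names finite_lessThan] by blast
  \<comment> \<open>Indices outside the image of \<open>f\<close> pad the graph to \<open>n\<close>
    vertices. They receive the disk of an unspecified name, which is genuine because
    \<open>r\<close> is positive everywhere.\<close>
  define D where "D i = ball (c (inv_into (names m) f i)) (r (inv_into (names m) f i))" for i
  have Df: "D (f v) = ball (c v) (r v)" if "v \<in> names m" for v
    using that f(2) by (simp add: D_def)
  define G where "G = intersection_graph {..<n} D"
  have V: "pverts G = {..<n}" by (simp add: G_def intersection_graph_def)
  have "disk_graph G"
    unfolding G_def using r by (intro disk_graph_intersection_graph) (auto simp: open_disk_def D_def)
  then have G: "G \<in> DG n" by (simp add: DG_def V)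
  show thesis
  proof (rule that[OF G])
    fix A :: "nat \<Rightarrow> (real ^ 2) set" and K
    assume A: "integer_DG_realization A G" and box: "\<And>v. v \<in> pverts G \<Longrightarrow> A v \<subseteq> cbox (\<chi> i. - K) (\<chi> i. K)"
    have fV: "f v \<in> {..<n}" if "v \<in> names m" for v using f(1) that by blast
    have "\<forall>v\<in>names m. \<exists>d. (\<forall>i. fst d $ i \<in> \<int>) \<and> snd d \<in> \<int> \<and> snd d > 0 \<and> A (f v) = ball (fst d) (snd d)"
      using A fV unfolding integer_DG_realization_def integer_open_disk_def V by fastforce
    from bchoice[OF this] obtain d where
      d: "\<forall>v\<in>names m. (\<forall>i. fst (d v) $ i \<in> \<int>) \<and> snd (d v) \<in> \<int> \<and> snd (d v) > 0 \<and> A (f v) = ball (fst (d v)) (snd (d v))" ..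
    define c' where "c' v = fst (d v)" for v
    define r' where "r' v = snd (d v)" for v
    have d': "c' v $ i \<in> \<int>" "r' v \<in> \<int>" "r' v > 0" "A (f v) = ball (c' v) (r' v)" if "v \<in> names m" for v i
      using d that by (simp_all add: c'_def r'_def)
    have arcs: "A i \<inter> A j \<noteq> {} \<longleftrightarrow> D i \<inter> D j \<noteq> {}" if "i < n" "j < n" "i \<noteq> j" for i j
    proof -
      have "G = intersection_graph {..<n} A"
        using A by (simp add: integer_DG_realization_def realizes_def V)
      then have "(i, j) \<in> parcs (intersection_graph {..<n} A) \<longleftrightarrow> (i, j) \<in> parcs (intersection_graph {..<n} D)"
        unfolding G_def by simp
      then show ?thesis using that by (simp add: intersection_graph_def)
    qed
    have form: "disk_form (c' v) (r' v) (c' u) (r' u) > 0 \<longleftrightarrow> disk_form (c v) (r v) (c u) (r u) > 0"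
      if "v \<in> names m" "u \<in> names m" "v \<noteq> u" for v u
    proof -
      have "f v \<noteq> f u" using f(2) that by (auto dest: inj_onD)
      then have "A (f v) \<inter> A (f u) \<noteq> {} \<longleftrightarrow> D (f v) \<inter> D (f u) \<noteq> {}" using fV that by (intro arcs) auto
      then show ?thesis using that by (simp only: d'(4) Df disks_meet_iff[OF d'(3) d'(3)] disks_meet_iff[OF r r])
    qed
    show "2 ^ 2 ^ (m - 2) \<le> (128 * (8 * K\<^sup>2) ^ 8)\<^sup>2"
    proof (rule integer_disks_large[where c = c' and r = r' and \<eta> = \<eta>])
      show "2 \<le> m" "0 < \<eta>" by (fact m \<eta>)+
      show "\<eta> * (64 * (lev k)\<^sup>2 + 200) < 1" if "k < m" for k using \<eta>(3) that .
      show "c' v $ i \<in> \<int>" "r' v \<in> \<int>" "0 < r' v" if "v \<in> names m" for v i using d'[OF that] by auto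
      show "\<bar>c' v $ i\<bar> + r' v \<le> K" if "v \<in> names m" for v i
      proof (rule abs_centre_add_radius_le)
        show "ball (c' v) (r' v) \<subseteq> cbox (\<chi> i. - K) (\<chi> i. K)"
          using box[of "f v"] fV[OF that] d'(4)[OF that] by (simp add: V)
      qed (use d'(3)[OF that] in simp)
      show "(0 < disk_form (c' (Side l s R)) (r' (Side l s R)) (c' (Point p)) (r' (Point p))) = ((0 < coef \<eta> l \<bullet> bary p) = s)"
        if "l \<in> lines m" "p \<in> points m" "coef \<eta> l \<bullet> bary p \<noteq> 0" for l p s R
        using adj(1)[OF that] form[of "Side l s R" "Point p"] that by simp
      show "0 < disk_form (c' (Side l s R)) (r' (Side l s R)) (c' Wide) (r' Wide)" if "l \<in> lines m" for l s R
        using adj(2)[OF that] form[of "Side l s R" Wide] that by simp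
      show "(0 < disk_form (c' (Side l s R)) (r' (Side l s R)) (c' Far) (r' Far)) = R" if "l \<in> lines m" for l s R
        using adj(3)[OF that] form[of "Side l s R" Far] that by simp
    qed
  qed
qed

section \<open>The lower bound for f and the theorem\<close>

lemma f_DG_graph_attained:
  assumes "G \<in> DG n"
  obtains A where "integer_DG_realization A G"
    "\<And>v. v \<in> pverts G \<Longrightarrow> A v \<subseteq> cbox (\<chi> i. - real (f_DG_graph G)) (\<chi> i. real (f_DG_graph G))"
proof -
  obtain A0 where "integer_DG_realization A0 G" using integer_realization_bound[OF assms] by blast
  then have "\<exists>m A. integer_DG_realization A G \<and> m = box_size (A ` pverts G)" by blast
  then have "\<exists>A. integer_DG_realization A G \<and> f_DG_graph G = box_size (A ` pverts G)"
    unfolding f_DG_graph_def by (rule LeastI_ex)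
  then obtain A where A: "integer_DG_realization A G" "f_DG_graph G = box_size (A ` pverts G)" by blast
  have "pair_graph G" using assms by (simp add: DG_def disk_graph_def)
  then have fin: "finite (pverts G)" by (simp add: pair_graph_def pair_digraph_def pair_fin_digraph_def pair_fin_digraph_axioms_def)
  have od: "open_disk (A v)" if "v \<in> pverts G" for v
    using A(1) that unfolding integer_DG_realization_def integer_open_disk_def open_disk_def by blast
  show thesis
  proof (rule that[OF A(1)])
    show "A v \<subseteq> cbox (\<chi> i. - real (f_DG_graph G)) (\<chi> i. real (f_DG_graph G))" if "v \<in> pverts G" for v
      unfolding A(2) by (rule box_size_attained[OF fin od that])
  qed
qed

text \<open>From \<open>2 ^ 2 ^ (m - 2) \<le> 2 ^ 62 * K ^ 32\<close>: the power 32 lowers the upper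
  exponent by five and the factor \<open>2 ^ 62\<close> by one more, the latter because
  \<open>62 \<le> 32 * 2 ^ (m - 8)\<close> for \<open>m \<ge> 9\<close>.\<close>

lemma f_DG_lower:
  assumes m: "m \<ge> 9" and n: "27 * m + 51 \<le> n"
  shows "2 ^ 2 ^ (m - 8) \<le> f_DG n" and "DG n \<noteq> {}"
proof -
  have m2: "m \<ge> 2" using m by simp
  obtain G where G: "G \<in> DG n" "\<And>A K. integer_DG_realization A G \<Longrightarrow> (\<And>v. v \<in> pverts G \<Longrightarrow> A v \<subseteq> cbox (\<chi> i. - K) (\<chi> i. K)) \<Longrightarrow>
       2 ^ 2 ^ (m - 2) \<le> (128 * (8 * K\<^sup>2) ^ 8)\<^sup>2"
    using hard_graph[OF m2 n] by blast
  then show "DG n \<noteq> {}" by blast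
  define K where "K = f_DG_graph G"
  have "2 ^ 2 ^ (m - 2) \<le> (128 * (8 * (real K)\<^sup>2) ^ 8)\<^sup>2"
  proof (rule f_DG_graph_attained[OF G(1)])
    fix A assume "integer_DG_realization A G"
      "\<And>v. v \<in> pverts G \<Longrightarrow> A v \<subseteq> cbox (\<chi> i. - real (f_DG_graph G)) (\<chi> i. real (f_DG_graph G))"
    then show ?thesis unfolding K_def by (rule G(2))
  qed
  also have "\<dots> = 2 ^ 62 * real K ^ 32"
    by (simp add: power_mult_distrib flip: power_mult)
  finally have le: "(2 :: real) ^ 2 ^ (m - 2) \<le> 2 ^ 62 * real K ^ 32" .
  have "2 ^ 2 ^ (m - 8) \<le> K"
  proof (rule ccontr)
    assume "\<not> ?thesis"
    then have "real K < 2 ^ 2 ^ (m - 8)" using of_nat_less_iff[of K "2 ^ 2 ^ (m - 8)", where ?'a = real] by simp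
    then have "real K ^ 32 < (2 ^ 2 ^ (m - 8)) ^ 32" by (intro power_strict_mono) auto
    then have "2 ^ 62 * real K ^ 32 < 2 ^ 62 * (2 ^ 2 ^ (m - 8)) ^ 32" by simp
    also have "\<dots> = 2 ^ (62 + 2 ^ (m - 8) * 32)" by (simp only: power_add power_mult)
    also have "\<dots> \<le> 2 ^ 2 ^ (m - 2)"
    proof (intro power_increasing)
      have "(2 :: nat) ^ 1 \<le> 2 ^ (m - 8)" using m by (intro power_increasing) auto
      moreover have "m - 2 = (m - 8) + 6" using m by simp
      then have "(2 :: nat) ^ (m - 2) = 2 ^ (m - 8) * 64" by (simp only: power_add) simp
      ultimately show "62 + 2 ^ (m - 8) * 32 \<le> (2 :: nat) ^ (m - 2)" by simp
    qed auto
    finally show False using le by simp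
  qed
  also have "K \<le> f_DG n"
    unfolding f_DG_def K_def using G(1) finite_f_DG_graph_values by (intro Max_ge) auto
  finally show "2 ^ 2 ^ (m - 8) \<le> f_DG n" .
qed

lemma double_powr: "2 powr (2 powr real k) = real (2 ^ 2 ^ k)"
proof -
  have "2 powr real k = real (2 ^ k)" by (simp add: powr_realpow)
  then show ?thesis using powr_realpow[of 2 "2 ^ k"] by simp
qed

theorem theorem1p1:
  shows "\<exists>c1 c2 :: real. c1 > 0 \<and> c2 > 0 \<and> (\<exists>n0 :: nat. \<forall>n \<ge> n0.
           2 powr (2 powr (c1 * real n)) \<le> real (f_DG n) \<and>
           real (f_DG n) \<le> 2 powr (2 powr (c2 * real n)))"
proof (intro exI conjI allI impI)
  show "(1 / 54 :: real) > 0" "(21 :: real) > 0" by simp_all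
  fix n :: nat assume n: "1000 \<le> n"
  \<comment> \<open>A level costs 27 vertices: three points and six lines of four disks each.
    Doubling 27 to 54 absorbs the constants 51 and 8 once \<open>n\<close> is at least 1000.\<close>
  define m where "m = (n - 51) div 27"
  have m: "m \<ge> 9" "27 * m + 51 \<le> n" "n \<le> 54 * (m - 8)"
    using n by (simp_all add: m_def)
  have "2 powr (2 powr (1 / 54 * real n)) \<le> 2 powr (2 powr (real (m - 8)))"
    using m(3) by (intro powr_mono) auto
  also have "\<dots> = real (2 ^ 2 ^ (m - 8))"
    by (simp only: double_powr)
  also have "\<dots> \<le> real (f_DG n)" using f_DG_lower(1)[OF m(1,2)] by (simp only: of_nat_le_iff)
  finally show "2 powr (2 powr (1 / 54 * real n)) \<le> real (f_DG n)" .
  have "f_DG n \<le> 2 ^ 2 ^ (21 * n)"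
    unfolding f_DG_def
  proof (rule Max.boundedI)
    show "f_DG_graph ` DG n \<noteq> {}" using f_DG_lower(2)[OF m(1,2)] by simp
    fix k assume "k \<in> f_DG_graph ` DG n"
    then have "k \<le> 202 * (coord_bound (3 * n) (n * n) + 1)\<^sup>2" using f_DG_graph_le by auto
    also have "\<dots> \<le> 2 ^ 2 ^ (21 * n)" using n by (intro coord_bound_double_exp) simp
    finally show "k \<le> 2 ^ 2 ^ (21 * n)" .
  qed (rule finite_f_DG_graph_values)
  then have "real (f_DG n) \<le> real (2 ^ 2 ^ (21 * n))" by (simp only: of_nat_le_iff)
  also have "\<dots> = 2 powr (2 powr real (21 * n))"
    by (simp only: double_powr)
  finally show "real (f_DG n) \<le> 2 powr (2 powr (21 * real n))" by simp
qed

end
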